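(* Let $F\in\mathcal E$. Suppose that there exist $G\in\mathcal E_2$ of completely regular growth and $\alpha<1$ such that $(FG\cdot\mathcal E)\cap\mathcal F_{(\alpha)}=FG\cdot\mathbb C$ and $\inf_{[0,2\pi]}h_G>0$. Then $F\in\mathcal F_{(\gamma)}$ for every $\gamma\ge\alpha$, and $$\overline{\operatorname{Span}}\{e_\lambda F:\ \lambda\in\mathbb C\}=\mathcal E F\cap\mathcal F.$$
   Context: $\mathcal E$ is the space of all entire functions on $\mathbb C$; for $H\in\mathcal E$, $H\cdot\mathcal E=\mathcal E H=\{hH:h\in\mathcal E\}$ and $H\cdot\mathbb C=\{cH:c\in\mathbb C\}$. For real $\alpha$, $\mathcal F_{(\alpha)}$ is the space of entire functions $F$ with $\frac1\pi\int_{\mathbb C}|F(z)|^2e^{-\alpha\pi|z|^2}\,dm(z)<\infty$, $m$ being area Lebesgue measure, and $\mathcal F=\mathcal F_{(1)}$ with norm the square root of this integral for $\alpha=1$. $e_\lambda(z)=e^{\lambda z}$, and $\overline{\operatorname{Span}}$ denotes the closure in $\mathcal F$ of the linear span. For $a\ge0$, $\mathcal E_{2,a}$ is the class of entire functions $F$ with $\limsup_{|z|\to\infty}\frac{\log|F(z)|}{|z|^2}\le a$, and $\mathcal E_2=\bigcup_{a<\infty}\mathcal E_{2,a}$. For $F\in\mathcal E_2$ the indicator function is $h_F(\theta)=\limsup_{r\to\infty}\frac{\log|F(re^{i\theta})|}{r^2}$, $\theta\in[0,2\pi]$. A function $F\in\mathcal E_2$ is of completely regular growth if $\log|F(re^{i\theta})|/r^2$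 converges to $h_F(\theta)$ uniformly in $\theta\in[0,2\pi]$ as $r\to\infty$, $r\notin E_F$, for some set $E_F\subset[0,\infty)$ of zero relative measure, i.e. $\lim_{R\to\infty}\frac{|E_F\cap[0,R]|}{R}=0$, where $|\cdot|$ is Lebesgue measure on the line. *)

theory Defs
  imports "HOL-Analysis.Analysis" "HOL-Library.Function_Algebras"
begin

text \<open>Sums and products of functions are the pointwise ones of
  \<^theory>\<open>HOL-Library.Function_Algebras\<close>.\<close>

definition entire :: "(complex \<Rightarrow> complex) set" where
  "entire = {f. f holomorphic_on UNIV}"

definition entire_multiples :: "(complex \<Rightarrow> complex) \<Rightarrow> (complex \<Rightarrow> complex) set" where
  "entire_multiples H = {h * H | h. h \<in> entire}"

definition const_multiples :: "(complex \<Rightarrow> complex) \<Rightarrow> (complex \<Rightarrow> complex) set" where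
  "const_multiples H = {(\<lambda>z. c * H z) | c. True}"

definition fock_space :: "real \<Rightarrow> (complex \<Rightarrow> complex) set" where
  "fock_space \<alpha> = {F \<in> entire.
     integrable lborel (\<lambda>z. (norm (F z))\<^sup>2 * exp (- \<alpha> * pi * (norm z)\<^sup>2))}"

text \<open>The norm of \<open>fock_space 1\<close>. Outside that space the Bochner integral may be
  the junk value 0, so it is only meaningful on \<open>fock_space 1\<close>.\<close>

definition fock_norm :: "(complex \<Rightarrow> complex) \<Rightarrow> real" where
  "fock_norm F = sqrt (1 / pi * (\<integral>z. (norm (F z))\<^sup>2 * exp (- pi * (norm z)\<^sup>2) \<partial>lborel))"

definition exp_fun :: "complex \<Rightarrow> complex \<Rightarrow> complex" where
  "exp_fun w = (\<lambda>z. exp (w * z))"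

text \<open>\<open>log |w|\<close> with the convention \<open>log 0 = -\<infinity>\<close> (whereas \<open>ln 0 = 0\<close> in HOL).\<close>

definition log_norm :: "complex \<Rightarrow> ereal" where
  "log_norm w = (if w = 0 then -\<infinity> else ereal (ln (norm w)))"

definition order2_type_le :: "real \<Rightarrow> (complex \<Rightarrow> complex) set" where
  "order2_type_le a = {F \<in> entire.
     Limsup at_infinity (\<lambda>z. log_norm (F z) / ereal ((norm z)\<^sup>2)) \<le> ereal a}"

definition order2_finite_type :: "(complex \<Rightarrow> complex) set" where
  "order2_finite_type = (\<Union>a\<in>{0..}. order2_type_le a)"

definition growth_indicator :: "(complex \<Rightarrow> complex) \<Rightarrow> real \<Rightarrow> ereal" where
  "growth_indicator F \<theta> =
     Limsup at_top (\<lambda>r. log_norm (F (of_real r * cis \<theta>)) / ereal (r\<^sup>2))"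

definition zero_relative_measure :: "real set \<Rightarrow> bool" where
  "zero_relative_measure E \<longleftrightarrow> E \<subseteq> {0..} \<and> E \<in> sets lebesgue \<and>
     ((\<lambda>R. measure lebesgue (E \<inter> {0..R}) / R) \<longlongrightarrow> 0) at_top"

text \<open>The strict bound on the extended-real distance forces both terms to be finite:
  if either is infinite, the absolute value of the difference is \<open>\<infinity>\<close>. In particular
  circles through a zero of \<open>F\<close> must have radius in the exceptional set.\<close>

definition completely_regular_growth :: "(complex \<Rightarrow> complex) \<Rightarrow> bool" where
  "completely_regular_growth F \<longleftrightarrow>
     (\<exists>E. zero_relative_measure E \<and>
       (\<forall>\<epsilon>>0. \<forall>\<^sub>F r in at_top. r \<notin> E \<longrightarrow>
          (\<forall>\<theta>\<in>{0..2*pi}.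
             \<bar>log_norm (F (of_real r * cis \<theta>)) / ereal (r\<^sup>2) - growth_indicator F \<theta>\<bar> < ereal \<epsilon>)))"

interpretation cfun: vector_space "\<lambda>c (f :: complex \<Rightarrow> complex) z. c * f z"
  by standard (auto simp: fun_eq_iff algebra_simps)

lemma fock_integrable:
  "f \<in> fock_space 1 \<Longrightarrow> integrable lborel (\<lambda>z. (norm (f z))\<^sup>2 * exp (- pi * (norm z)\<^sup>2))"
  by (simp add: fock_space_def)

lemma entire_continuous: "f \<in> entire \<Longrightarrow> continuous_on UNIV f"
  by (simp add: entire_def holomorphic_on_imp_continuous_on)

lemma fock_space_entire: "f \<in> fock_space \<alpha> \<Longrightarrow> f \<in> entire"
  by (simp add: fock_space_def)

lemma fock_space_diff:
  assumes "f \<in> fock_space 1" "g \<in> fock_space 1"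
  shows "f - g \<in> fock_space 1"
proof -
  have c: "continuous_on UNIV f" "continuous_on UNIV g"
    using assms fock_space_entire entire_continuous by blast+
  have [measurable]: "f \<in> borel_measurable borel" "g \<in> borel_measurable borel"
    using c by (auto intro: borel_measurable_continuous_onI)
  have dom: "integrable lborel (\<lambda>z. 2 * ((norm (f z))\<^sup>2 * exp (- pi * (norm z)\<^sup>2))
        + 2 * ((norm (g z))\<^sup>2 * exp (- pi * (norm z)\<^sup>2)))"
    using assms fock_integrable by (intro Bochner_Integration.integrable_add) auto
  have "(norm (f z - g z))\<^sup>2 \<le> 2 * (norm (f z))\<^sup>2 + 2 * (norm (g z))\<^sup>2" for z
  proof -
    have "(norm (f z - g z))\<^sup>2 \<le> (norm (f z) + norm (g z))\<^sup>2"
      by (intro power_mono norm_triangle_ineq4) auto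
    also have "\<dots> \<le> 2 * (norm (f z))\<^sup>2 + 2 * (norm (g z))\<^sup>2"
      using sum_squares_bound[of "norm (f z)" "norm (g z)"] by (simp add: power2_sum)
    finally show ?thesis .
  qed
  then have "(norm (f z - g z))\<^sup>2 * exp (- pi * (norm z)\<^sup>2)
      \<le> (2 * (norm (f z))\<^sup>2 + 2 * (norm (g z))\<^sup>2) * exp (- pi * (norm z)\<^sup>2)" for z
    by (intro mult_right_mono) auto
  then have bound: "norm ((norm ((f - g) z))\<^sup>2 * exp (- pi * (norm z)\<^sup>2))
      \<le> norm (2 * ((norm (f z))\<^sup>2 * exp (- pi * (norm z)\<^sup>2))
        + 2 * ((norm (g z))\<^sup>2 * exp (- pi * (norm z)\<^sup>2)))" for z
    by (simp add: distrib_right mult.assoc)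
  have "integrable lborel (\<lambda>z. (norm ((f - g) z))\<^sup>2 * exp (- pi * (norm z)\<^sup>2))"
    by (rule Bochner_Integration.integrable_bound[OF dom _ AE_I2[OF bound]]) (simp add: fun_diff_def)
  moreover have "f - g \<in> entire"
    using assms[THEN fock_space_entire]
    by (simp add: entire_def fun_diff_def holomorphic_on_diff)
  ultimately show ?thesis by (simp add: fock_space_def)
qed

lemma fock_norm_nonneg: "0 \<le> fock_norm f"
  by (simp add: fock_norm_def)

lemma fock_norm_sq:
  "pi * (fock_norm f)\<^sup>2 = (\<integral>z. (norm (f z))\<^sup>2 * exp (- pi * (norm z)\<^sup>2) \<partial>lborel)"
  by (simp add: fock_norm_def)

lemma fock_norm_eq_0:
  assumes "f \<in> fock_space 1" "fock_norm f = 0"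
  shows "f = 0"
proof -
  have c: "continuous_on UNIV f"
    using assms fock_space_entire entire_continuous by blast
  have "(\<integral>z. (norm (f z))\<^sup>2 * exp (- pi * (norm z)\<^sup>2) \<partial>lborel) = 0"
    using fock_norm_sq[of f] assms(2) by simp
  then have "AE z in lborel. (norm (f z))\<^sup>2 * exp (- pi * (norm z)\<^sup>2) = 0"
    using integral_nonneg_eq_0_iff_AE[OF fock_integrable[OF assms(1)]] by simp
  then have "AE z in lborel. f z = 0" by simp
  moreover have op: "open {z. f z \<noteq> 0}"
    using c by (intro open_Collect_neq) auto
  ultimately have "{z. f z \<noteq> 0} \<in> null_sets lborel"
    by (subst AE_iff_null_sets) auto
  then have "negligible {z. f z \<noteq> 0}"
    by (simp add: negligible_iff_null_sets null_sets_completionI)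
  then have "{z. f z \<noteq> 0} = {}"
    using op open_not_negligible by blast
  then show ?thesis by (auto simp: fun_eq_iff)
qed

lemma fock_norm_minus_commute: "fock_norm (f - g) = fock_norm (g - f)"
  by (simp add: fock_norm_def norm_minus_commute)

lemma fock_norm_triangle:
  assumes f: "f \<in> fock_space 1" and g: "g \<in> fock_space 1"
  shows "fock_norm (f - g) \<le> fock_norm f + fock_norm g"
proof (cases "fock_norm f = 0 \<or> fock_norm g = 0")
  case True
  then show ?thesis
    using fock_norm_eq_0[OF f] fock_norm_eq_0[OF g] fock_norm_minus_commute[of 0 g]
    by (auto simp: fock_norm_nonneg)
next
  case False
  define a b t where "a = fock_norm f" and "b = fock_norm g" and "t = b / a"
  have pos: "a > 0" "b > 0" "t > 0"
    using False fock_norm_nonneg[of f] fock_norm_nonneg[of g] by (auto simp: a_def b_def t_def)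
  have pt: "(norm (f z - g z))\<^sup>2 \<le> (1 + t) * (norm (f z))\<^sup>2 + (1 + 1 / t) * (norm (g z))\<^sup>2" for z
  proof -
    define x y where "x = norm (f z)" and "y = norm (g z)"
    have "0 \<le> (t * x - y)\<^sup>2 / t" using pos by simp
    also have "\<dots> = t * x\<^sup>2 + y\<^sup>2 / t - 2 * x * y"
      using pos by (simp add: power2_eq_square field_simps)
    finally have "(x + y)\<^sup>2 \<le> (1 + t) * x\<^sup>2 + (1 + 1 / t) * y\<^sup>2"
      by (simp add: power2_sum algebra_simps)
    moreover have "(norm (f z - g z))\<^sup>2 \<le> (x + y)\<^sup>2"
      unfolding x_def y_def by (intro power_mono norm_triangle_ineq4) auto
    ultimately show ?thesis unfolding x_def y_def by (rule order_trans[rotated])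
  qed
  have "pi * (fock_norm (f - g))\<^sup>2
      \<le> (\<integral>z. (1 + t) * ((norm (f z))\<^sup>2 * exp (- pi * (norm z)\<^sup>2))
           + (1 + 1 / t) * ((norm (g z))\<^sup>2 * exp (- pi * (norm z)\<^sup>2)) \<partial>lborel)"
    unfolding fock_norm_sq
  proof (rule integral_mono)
    show "integrable lborel (\<lambda>z. (norm ((f - g) z))\<^sup>2 * exp (- pi * (norm z)\<^sup>2))"
      using fock_integrable[OF fock_space_diff[OF f g]] .
    show "integrable lborel (\<lambda>z. (1 + t) * ((norm (f z))\<^sup>2 * exp (- pi * (norm z)\<^sup>2))
           + (1 + 1 / t) * ((norm (g z))\<^sup>2 * exp (- pi * (norm z)\<^sup>2)))"
      using fock_integrable[OF f] fock_integrable[OF g]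
      by (intro Bochner_Integration.integrable_add integrable_mult_right)
    show "(norm ((f - g) z))\<^sup>2 * exp (- pi * (norm z)\<^sup>2)
      \<le> (1 + t) * ((norm (f z))\<^sup>2 * exp (- pi * (norm z)\<^sup>2))
           + (1 + 1 / t) * ((norm (g z))\<^sup>2 * exp (- pi * (norm z)\<^sup>2))" for z
      using mult_right_mono[OF pt[of z], of "exp (- pi * (norm z)\<^sup>2)"]
      by (simp only: fun_diff_def distrib_right mult.assoc exp_ge_zero)
  qed
  also have "\<dots> = (1 + t) * (pi * a\<^sup>2) + (1 + 1 / t) * (pi * b\<^sup>2)"
    unfolding a_def b_def fock_norm_sq
    using fock_integrable[OF f] fock_integrable[OF g]
    by (subst Bochner_Integration.integral_add) (auto intro!: integrable_mult_right simp del: mult_minus_left)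
  also have "\<dots> = pi * (a + b)\<^sup>2"
    using pos by (simp add: t_def power2_eq_square field_simps)
  finally have "(fock_norm (f - g))\<^sup>2 \<le> (a + b)\<^sup>2" by simp
  then show ?thesis
    using pos unfolding a_def b_def by (auto intro: power2_le_imp_le)
qed

interpretation fock: Metric_space "fock_space 1" "\<lambda>f g. fock_norm (f - g)"
proof
  fix f g h :: "complex \<Rightarrow> complex"
  show "0 \<le> fock_norm (f - g)" by (rule fock_norm_nonneg)
  show "fock_norm (f - g) = fock_norm (g - f)" by (rule fock_norm_minus_commute)
  assume f: "f \<in> fock_space 1" and g: "g \<in> fock_space 1"
  show "fock_norm (f - g) = 0 \<longleftrightarrow> f = g"
    using fock_norm_eq_0[OF fock_space_diff[OF f g]] by (auto simp: fock_norm_def)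
  assume h: "h \<in> fock_space 1"
  have "fock_norm (f - h) = fock_norm ((f - g) - (h - g))" by simp
  also have "\<dots> \<le> fock_norm (f - g) + fock_norm (h - g)"
    by (intro fock_norm_triangle fock_space_diff f g h)
  finally show "fock_norm (f - h) \<le> fock_norm (f - g) + fock_norm (g - h)"
    by (simp add: fock_norm_minus_commute[of g h])
qed

end

theory Submission
  imports Defs "HOL-Complex_Analysis.Complex_Analysis" "HOL-Real_Asymp.Real_Asymp"
begin

text \<open>The closure of the span of the \<open>e\<^sub>\<lambda> F\<close> stays inside the closed space \<open>\<E>F \<inter> \<F>\<close>
(\<open>fock_multiples_complete\<close>), and by orthogonal projection (\<open>fock_projection\<close>) the reverse
inclusion says: if \<open>f = g F\<close> lies in the Fock space and is orthogonal to every \<open>e\<^sub>\<lambda> F\<close>, then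
\<open>f = 0\<close>. Fix such an \<open>f\<close>, put \<open>u = F cnj f exp (- pi |z|^2)\<close>, a density that annihilates all
exponentials, and write \<open>C\<^sub>h\<close> for the Cauchy transform of \<open>h u\<close>.

The first step is \<open>C\<^sub>G = G C\<^sub>1\<close>, together with a sharp bound for \<open>G C\<^sub>1\<close>. For every entire \<open>h\<close>
the difference \<open>C\<^sub>h - h C\<^sub>1\<close> is an integral of divided differences of \<open>h\<close>, hence entire. If
\<open>C\<^sub>h = h C\<^sub>1\<close> for all \<open>h = e\<^sub>\<lambda> A\<close>, then taking \<open>\<lambda>\<close> proportional to \<open>cnj w\<close> makes
\<open>exp (\<lambda> z) u\<close> a Gaussian centred at \<open>w\<close>, and \<open>A C\<^sub>1\<close> decays as fast as the growth of \<open>A F\<close> leaves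
room below that of the Fock weight (\<open>transports_decay\<close>). By Liouville the identity then passes from
\<open>A\<close> to any \<open>A'\<close> for which \<open>A' / A\<close> has small Gaussian growth on a sequence of circles
(\<open>transports_step\<close>). Finitely many dilations \<open>G(r z)\<close> lead from \<open>1\<close> to \<open>G\<close>: regular growth controls
their quotients, and a positive indicator keeps \<open>G(r z) F\<close> below a fixed weight of type less than
one for all \<open>r \<le> 1\<close> (\<open>transports_regular_growth\<close>).

The second step applies this to \<open>h = g\<close>. The bound for \<open>G C\<^sub>1\<close> is exactly what puts \<open>(C\<^sub>g - g C\<^sub>1) F G\<close>
into \<open>\<F>\<^sub>(\<^sub>\<alpha>\<^sub>)\<close>, so \<open>C\<^sub>g - g C\<^sub>1\<close> is constant by hypothesis. A nonzero constant would force \<open>|g|\<close> to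
grow like a Gaussian in every direction, which no entire function does. Hence \<open>C\<^sub>g = g C\<^sub>1\<close>
(\<open>mass_transform_factorizes\<close>), where \<open>C\<^sub>g\<close> is the Cauchy transform of the positive measure
\<open>\<nu> = |f|^2 exp (- pi |z|^2) dm\<close>.

The third step shows that \<open>\<nu> = 0\<close> (\<open>zero_mass\<close>). Every zero \<open>t\<close> of \<open>g\<close> is a zero of the Cauchy
transform of \<open>\<nu>\<close>, so the integral of \<open>|z| / |z - t|\<close> against \<open>\<nu>\<close> is at least \<open>\<nu>(\<complex>)\<close>. Since \<open>f\<close> is tiny
wherever its zeros are much denser than area measure (\<open>amplitude_mult_zero_potential\<close>), summing
over the zeros in \<open>|z| \<le> s\<close> shows that there are only \<open>o(s^2)\<close> of them (\<open>zero_count_subquadratic\<close>).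
But on suitable circles of arbitrarily large radius the Cauchy transform of \<open>\<nu>\<close> is close to
\<open>- \<nu>(\<complex>) / w\<close> at all points (\<open>exists_quiet_circle\<close>), while \<open>C\<^sub>1\<close> is Gaussian small; there \<open>|g|\<close> is at
least \<open>exp (\<gamma> |w|^2)\<close> up to a power of \<open>|w|\<close>. After division by its few zeros, the minimum principle
makes \<open>g\<close> arbitrarily large at a fixed point, a contradiction unless \<open>\<nu>\<close> vanishes.\<close>

section \<open>Kernels and Gaussians in the plane\<close>

lemma emeasure_ball_complex:
  assumes "r \<ge> 0"
  shows "emeasure lborel (ball (w::complex) r) = ennreal (pi * r^2)"
  using emeasure_ball[OF assms, of w] by (simp add: unit_ball_vol_2)

text \<open>The kernel is compared with the dyadic sum of \<open>2^(i+1) / s\<close> over the discs of radius \<open>s / 2^i\<close>,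
whose areas decay like \<open>4^-i\<close>; the sum is \<open>4 pi s\<close>.\<close>

lemma nn_integral_inverse_dist_ball_le:
  fixes w :: complex
  assumes s: "s > 0"
  shows "(\<integral>\<^sup>+z. ennreal (1 / norm (z - w)) * indicator (ball w s) z \<partial>lborel) \<le> ennreal (16 * s)"
proof -
  define c where "c i = 2 ^ Suc i / s" for i :: nat
  define r where "r i = s / 2 ^ i" for i :: nat
  have cpos: "c i > 0" "r i > 0" for i using s by (auto simp: c_def r_def)
  have pt: "ennreal (1 / norm (z - w)) * indicator (ball w s) z
      \<le> (\<Sum>i. ennreal (c i) * indicator (ball w (r i)) z)" for z
  proof (cases "z \<in> ball w s \<and> z \<noteq> w")
    case False
    then show ?thesis by (auto simp: indicator_def)
  next
    case True
    define d where "d = norm (z - w)"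
    have d: "0 < d" "d < s" using True by (auto simp: d_def dist_norm norm_minus_commute)
    have "\<exists>i. r i \<le> d"
    proof -
      have "s / d \<ge> 0" using d by simp
      obtain i where "s / d < 2 ^ i" using real_arch_pow[of 2 "s / d"] by auto
      then show ?thesis using d by (auto simp: r_def field_simps intro!: exI[of _ i])
    qed
    define j where "j = (LEAST i. r i \<le> d)"
    have j: "r j \<le> d" unfolding j_def using \<open>\<exists>i. r i \<le> d\<close> by (rule LeastI_ex)
    have "j \<noteq> 0" using j d by (intro notI) (simp add: r_def)
    then obtain i where i: "j = Suc i" using not0_implies_Suc by blast
    have ri: "d < r i" using not_less_Least[of i "\<lambda>i. r i \<le> d"] i unfolding j_def by auto
    have zi: "z \<in> ball w (r i)" using ri by (simp add: d_def dist_norm norm_minus_commute)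
    have "1 / d \<le> c i" using j i s d by (simp add: r_def c_def field_simps)
    then have "ennreal (1 / d) * indicator (ball w s) z \<le> ennreal (c i) * indicator (ball w (r i)) z"
      using zi True by (simp add: ennreal_leI)
    also have "\<dots> = sum (\<lambda>i. ennreal (c i) * indicator (ball w (r i)) z) {i}" by (simp only: sum.insert sum.empty finite.emptyI empty_iff not_False_eq_True add_0_right)
    also have "\<dots> \<le> (\<Sum>i. ennreal (c i) * indicator (ball w (r i)) z)"
      by (rule sum_le_suminf) auto
    finally show ?thesis by (simp add: d_def)
  qed
  have "(\<integral>\<^sup>+z. ennreal (1 / norm (z - w)) * indicator (ball w s) z \<partial>lborel)
      \<le> (\<integral>\<^sup>+z. (\<Sum>i. ennreal (c i) * indicator (ball w (r i)) z) \<partial>lborel)"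
    by (intro nn_integral_mono pt)
  also have "\<dots> = (\<Sum>i. \<integral>\<^sup>+z. ennreal (c i) * indicator (ball w (r i)) z \<partial>lborel)"
    by (rule nn_integral_suminf) (intro borel_measurable_times_ennreal borel_measurable_const
        borel_measurable_indicator, simp)
  also have "\<dots> = (\<Sum>i. ennreal (2 * pi * s * (1/2) ^ i))"
  proof (rule suminf_cong)
    fix i
    have "(\<integral>\<^sup>+z. ennreal (c i) * indicator (ball w (r i)) z \<partial>lborel) = ennreal (c i) * ennreal (pi * (r i)^2)"
      using cpos[of i] by (subst nn_integral_cmult_indicator) (auto simp: emeasure_ball_complex)
    also have "\<dots> = ennreal (c i * (pi * (r i)^2))"
      using cpos[of i] by (subst ennreal_mult) auto
    also have "c i * (pi * (r i)^2) = 2 * pi * s * (1/2) ^ i"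
      using s by (simp add: c_def r_def power2_eq_square field_simps power_divide)
    finally show "(\<integral>\<^sup>+z. ennreal (c i) * indicator (ball w (r i)) z \<partial>lborel) = ennreal (2 * pi * s * (1/2) ^ i)" .
  qed
  also have "\<dots> = ennreal (\<Sum>i. 2 * pi * s * (1/2) ^ i)"
    by (rule suminf_ennreal2) (use s in \<open>auto intro!: summable_mult summable_geometric\<close>)
  also have "(\<Sum>i. 2 * pi * s * (1/2::real) ^ i) = 4 * pi * s"
    by (subst suminf_mult) (auto simp: suminf_geometric summable_geometric)
  also have "ennreal (4 * pi * s) \<le> ennreal (16 * s)"
    using pi_less_4 s by (intro ennreal_leI mult_right_mono) auto
  finally show ?thesis .
qed

text \<open>Within distance \<open>s\<close> of \<open>w\<close> the bound on \<open>u\<close> is used, beyond it the total mass. The free choice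
of \<open>s\<close> is what makes Cauchy transforms bounded, and small at infinity.\<close>

lemma cauchy_kernel_bound:
  fixes u :: "complex \<Rightarrow> complex" and w :: complex
  assumes u: "integrable lborel u" and B: "\<And>z. norm (u z) \<le> B" and s: "s > 0"
  shows "integrable lborel (\<lambda>z. u z / (z - w))"
    and "(LBINT z. norm (u z) / norm (z - w)) \<le> 16 * s * B + (LBINT z. norm (u z)) / s"
proof -
  have [measurable]: "u \<in> borel_measurable borel" using u by simp
  have B0: "B \<ge> 0" using B[of 0] norm_ge_zero[of "u 0"] by linarith
  have [measurable]: "(indicator (ball w s) :: complex \<Rightarrow> ennreal) \<in> borel_measurable borel"
    by (intro borel_measurable_indicator) simp
  have pt: "ennreal (norm (u z) / norm (z - w))
     \<le> ennreal B * (ennreal (1 / norm (z - w)) * indicator (ball w s) z) + ennreal (norm (u z) / s)" for z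
  proof (cases "z \<in> ball w s")
    case True
    have "norm (u z) / norm (z - w) \<le> B * (1 / norm (z - w))"
      using B[of z] by (simp add: divide_right_mono)
    then have "ennreal (norm (u z) / norm (z - w)) \<le> ennreal (B * (1 / norm (z - w)))" by (rule ennreal_leI)
    also have "\<dots> = ennreal B * (ennreal (1 / norm (z - w)) * indicator (ball w s) z)"
      using True B0 ennreal_mult'[of B "1 / norm (z - w)"] by simp
    also have "\<dots> \<le> \<dots> + ennreal (norm (u z) / s)" by simp
    finally show ?thesis .
  next
    case False
    then have "norm (z - w) \<ge> s" by (simp add: dist_norm norm_minus_commute)
    then have "norm (u z) / norm (z - w) \<le> norm (u z) / s" using s by (intro divide_left_mono mult_pos_pos) auto
    then show ?thesis using False by (simp add: ennreal_leI)
  qed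
  have "(\<integral>\<^sup>+z. ennreal (norm (u z) / norm (z - w)) \<partial>lborel) \<le>
     (\<integral>\<^sup>+z. ennreal B * (ennreal (1 / norm (z - w)) * indicator (ball w s) z) + ennreal (norm (u z) / s) \<partial>lborel)"
    by (intro nn_integral_mono pt)
  also have "\<dots> = ennreal B * (\<integral>\<^sup>+z. ennreal (1 / norm (z - w)) * indicator (ball w s) z \<partial>lborel)
      + (\<integral>\<^sup>+z. ennreal (norm (u z) / s) \<partial>lborel)"
    by (subst nn_integral_add) (auto simp: nn_integral_cmult)
  also have "(\<integral>\<^sup>+z. ennreal (norm (u z) / s) \<partial>lborel) = ennreal ((LBINT z. norm (u z)) / s)"
    using u s by (subst nn_integral_eq_integral) auto
  also have "ennreal B * (\<integral>\<^sup>+z. ennreal (1 / norm (z - w)) * indicator (ball w s) z \<partial>lborel)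
      \<le> ennreal B * ennreal (16 * s)"
    using nn_integral_inverse_dist_ball_le[OF s] by (intro mult_left_mono) auto
  also have "ennreal B * ennreal (16 * s) = ennreal (16 * s * B)"
    using B0 s by (simp add: ennreal_mult'[symmetric] mult.commute)
  finally have "(\<integral>\<^sup>+z. ennreal (norm (u z) / norm (z - w)) \<partial>lborel)
      \<le> ennreal (16 * s * B) + ennreal ((LBINT z. norm (u z)) / s)"
    by (simp add: add_right_mono)
  then have le: "(\<integral>\<^sup>+z. ennreal (norm (u z) / norm (z - w)) \<partial>lborel)
      \<le> ennreal (16 * s * B + (LBINT z. norm (u z)) / s)"
    using B0 s by (subst ennreal_plus) auto
  have fin: "(\<integral>\<^sup>+z. ennreal (norm (u z) / norm (z - w)) \<partial>lborel) < \<infinity>"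
    using le by (rule order.strict_trans1) simp
  show "integrable lborel (\<lambda>z. u z / (z - w))"
    using fin by (intro integrableI_bounded) (auto simp: norm_divide)
  have "(LBINT z. norm (u z) / norm (z - w))
      = enn2real (\<integral>\<^sup>+z. ennreal (norm (u z) / norm (z - w)) \<partial>lborel)"
    by (rule integral_eq_nn_integral) auto
  also have "\<dots> \<le> 16 * s * B + (LBINT z. norm (u z)) / s"
    using le B0 s by (intro enn2real_leI) auto
  finally show "(LBINT z. norm (u z) / norm (z - w)) \<le> 16 * s * B + (LBINT z. norm (u z)) / s" .
qed

lemma integrable_gauss:
  assumes c: "c > 0"
  shows "integrable lborel (\<lambda>z::complex. exp (- c * (norm z)^2))"
proof -
  define a where "a n = exp (- c * (real n)^2) * (pi * (real (Suc n))^2)" for n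
  have pt: "ennreal (exp (- c * (norm z)^2)) \<le> (\<Sum>n. ennreal (exp (- c * (real n)^2)) * indicator (ball 0 (real (Suc n))) z)"
    for z :: complex
  proof -
    define n where "n = nat \<lfloor>norm z\<rfloor>"
    have n: "real n \<le> norm z" "norm z < real (Suc n)"
      using floor_correct[of "norm z"] by (auto simp: n_def add.commute)
    have "ennreal (exp (- c * (norm z)^2)) \<le> ennreal (exp (- c * (real n)^2)) * indicator (ball 0 (real (Suc n))) z"
      using n c by (auto intro!: ennreal_leI)
    also have "\<dots> = sum (\<lambda>n. ennreal (exp (- c * (real n)^2)) * indicator (ball 0 (real (Suc n))) z) {n}"
      by (simp only: sum.insert sum.empty finite.emptyI empty_iff not_False_eq_True add_0_right)
    also have "\<dots> \<le> (\<Sum>n. ennreal (exp (- c * (real n)^2)) * indicator (ball 0 (real (Suc n))) z)"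
      by (rule sum_le_suminf) auto
    finally show ?thesis .
  qed
  have "summable a"
  proof (rule summable_comparison_test_ev)
    show "summable (\<lambda>n. inverse (real n ^ 2))" by (rule inverse_power_summable) simp
    have "((\<lambda>x. exp (- c * x^2) * (pi * (x + 1)^2) * x ^ 2) \<longlongrightarrow> 0) at_top"
      using c by real_asymp
    then have "\<forall>\<^sub>F x in at_top. exp (- c * x^2) * (pi * (x + 1)^2) * x ^ 2 < 1"
      by (rule order_tendstoD) simp
    then have "\<forall>\<^sub>F n in sequentially. exp (- c * (real n)^2) * (pi * (real n + 1)^2) * real n ^ 2 < 1"
      by (rule eventually_compose_filterlim) (rule filterlim_real_sequentially)
    then show "\<forall>\<^sub>F n in sequentially. norm (a n) \<le> inverse (real n ^ 2)"
      using eventually_gt_at_top[of 0]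
    proof eventually_elim
      case (elim n)
      then show ?case by (auto simp: a_def field_simps abs_mult)
    qed
  qed
  have "(\<integral>\<^sup>+z. ennreal (exp (- c * (norm (z::complex))^2)) \<partial>lborel)
     \<le> (\<integral>\<^sup>+z. (\<Sum>n. ennreal (exp (- c * (real n)^2)) * indicator (ball (0::complex) (real (Suc n))) z) \<partial>lborel)"
    by (intro nn_integral_mono pt)
  also have "\<dots> = (\<Sum>n. ennreal (a n))"
    by (subst nn_integral_suminf,
        (intro borel_measurable_times_ennreal borel_measurable_const borel_measurable_indicator, simp))
       (auto simp: nn_integral_cmult_indicator emeasure_ball_complex a_def ennreal_mult' intro!: suminf_cong)
  also have "\<dots> = ennreal (suminf a)"
    by (rule suminf_ennreal2) (use \<open>summable a\<close> in \<open>auto simp: a_def[abs_def]\<close>)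
  also have "\<dots> < \<infinity>" by simp
  finally show ?thesis by (intro integrableI_bounded) auto
qed

lemma integrable_gauss_linear:
  assumes c: "c > 0"
  shows "integrable lborel (\<lambda>z::complex. exp (a * norm z - c * (norm z)^2))"
proof (rule Bochner_Integration.integrable_bound)
  show "integrable lborel (\<lambda>z::complex. exp (a^2 / (2 * c)) * exp (- (c / 2) * (norm z)^2))"
    using integrable_gauss[of "c / 2"] c by (intro integrable_mult_right) auto
  have "a * x - c * x^2 \<le> a^2 / (2 * c) - c / 2 * x^2" for x :: real
  proof -
    have "0 \<le> (a - c * x)^2 / (2 * c)" using c by simp
    also have "\<dots> = a^2 / (2 * c) - c / 2 * x^2 - (a * x - c * x^2)"
      using c by (simp add: power2_eq_square field_simps)
    finally show ?thesis by simp
  qed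
  then show "AE z in lborel. norm (exp (a * norm z - c * (norm z)^2))
      \<le> norm (exp (a^2 / (2 * c)) * exp (- (c / 2) * (norm (z::complex))^2))"
    by (simp add: exp_add[symmetric])
qed simp

text \<open>Cauchy's estimate turns the bound on \<open>Q\<close> itself into the Lipschitz bound that dominated
convergence needs for the difference quotients.\<close>

lemma has_field_derivative_lebesgue_integral:
  fixes Q :: "'a \<Rightarrow> complex \<Rightarrow> complex"
  assumes hol: "\<And>z. Q z holomorphic_on ball w0 r"
    and meas: "\<And>w. w \<in> ball w0 r \<Longrightarrow> (\<lambda>z. Q z w) \<in> borel_measurable M"
    and bd: "\<And>z w. w \<in> ball w0 r \<Longrightarrow> norm (Q z w) \<le> D z"
    and D: "integrable M D" and r: "r > 0"
  shows "((\<lambda>w. \<integral>z. Q z w \<partial>M) has_field_derivative (\<integral>z. deriv (Q z) w0 \<partial>M)) (at w0)"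
  unfolding has_field_derivative_iff
proof (subst tendsto_at_iff_sequentially, intro allI impI)
  fix X :: "nat \<Rightarrow> complex"
  assume X: "\<forall>i. X i \<in> UNIV - {w0}" "X \<longlonglongrightarrow> w0"
  have int: "integrable M (\<lambda>z. Q z w)" if "w \<in> ball w0 r" for w
  proof (rule Bochner_Integration.integrable_bound[OF D meas[OF that]])
    show "AE z in M. norm (Q z w) \<le> norm (D z)"
      using bd[OF that] by (intro AE_I2) (simp, meson abs_ge_self order_trans)
  qed
  obtain K where K: "\<And>n. n \<ge> K \<Longrightarrow> dist (X n) w0 < r / 2"
    using metric_LIMSEQ_D[OF X(2), of "r / 2"] r by auto
  define Y where "Y n = X (n + K)" for n
  have Y: "Y n \<noteq> w0" "Y n \<in> ball w0 (r / 2)" "Y n \<in> ball w0 r" for n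
    using X(1) K[of "n + K"] r by (auto simp: Y_def dist_commute)
  have Ylim: "Y \<longlonglongrightarrow> w0" unfolding Y_def using X(2) by (rule LIMSEQ_ignore_initial_segment)
  have D0: "D z \<ge> 0" for z
    using bd[of w0 z] r order_trans[OF norm_ge_zero[of "Q z w0"]] by simp
  have derb: "norm (deriv (Q z) w) \<le> 4 * D z / r" if "w \<in> ball w0 (r/2)" for z w
  proof -
    have sub: "ball w (r / 2) \<subseteq> ball w0 r"
    proof
      fix x assume "x \<in> ball w (r / 2)"
      then show "x \<in> ball w0 r" using that dist_triangle[of w0 x w] unfolding mem_ball by linarith
    qed
    have "cball w (r / 4) \<subseteq> ball w (r / 2)" using r by auto
    then have cb: "cball w (r / 4) \<subseteq> ball w0 r" using sub by (rule order_trans)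
    have h: "Q z holomorphic_on cball w (r / 4)" using hol[of z] cb by (rule holomorphic_on_subset)
    then have c: "continuous_on (cball w (r / 4)) (Q z)" by (rule holomorphic_on_imp_continuous_on)
    have c2: "Q z holomorphic_on ball w (r / 4)" using h ball_subset_cball by (rule holomorphic_on_subset)
    have "norm ((deriv ^^ 1) (Q z) w) \<le> fact 1 * D z / (r / 4) ^ 1"
    proof (rule Cauchy_inequality[OF c2 c])
      fix x assume "norm (w - x) = r / 4"
      then have "x \<in> cball w (r / 4)" by (simp add: dist_norm)
      then show "norm (Q z x) \<le> D z" using cb bd by blast
    qed (use r in simp)
    then show ?thesis by (simp add: mult.commute)
  qed
  have lim: "(\<lambda>n. (Q z (Y n) - Q z w0) / (Y n - w0)) \<longlonglongrightarrow> deriv (Q z) w0" for z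
  proof -
    have "(Q z has_field_derivative deriv (Q z) w0) (at w0)"
      using hol[of z] r by (intro holomorphic_derivI[of _ "ball w0 r"]) auto
    then have "((\<lambda>y. (Q z y - Q z w0) / (y - w0)) \<longlongrightarrow> deriv (Q z) w0) (at w0)"
      unfolding has_field_derivative_iff .
    then show ?thesis
      unfolding tendsto_at_iff_sequentially using Y Ylim by (auto simp: o_def)
  qed
  have bnd: "norm ((Q z (Y n) - Q z w0) / (Y n - w0)) \<le> 4 * D z / r" for z n
  proof -
    have "norm (Q z (Y n) - Q z w0) \<le> 4 * D z / r * norm (Y n - w0)"
    proof -
      have conv: "convex (ball w0 (r/2))" by simp
      have der: "\<And>x. x \<in> ball w0 (r/2) \<Longrightarrow> (Q z has_field_derivative deriv (Q z) x) (at x within ball w0 (r / 2))"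
        using hol[of z] r
        by (intro has_field_derivative_at_within[OF holomorphic_derivI[of _ "ball w0 r"]]) auto
      have "w0 \<in> ball w0 (r/2)" using r by simp
      with field_differentiable_bound[OF conv der derb Y(2)[of n]] show ?thesis by blast
    qed
    then show ?thesis using Y(1)[of n] by (simp only: norm_divide pos_divide_le_eq zero_less_norm_iff right_minus_eq not_False_eq_True)
  qed
  have m: "(\<lambda>z. (Q z (Y n) - Q z w0) / (Y n - w0)) \<in> borel_measurable M" for n
    using meas[OF Y(3)[of n]] meas[of w0] r by (intro borel_measurable_divide borel_measurable_diff) auto
  have "(\<lambda>n. \<integral>z. (Q z (Y n) - Q z w0) / (Y n - w0) \<partial>M) \<longlonglongrightarrow> (\<integral>z. deriv (Q z) w0 \<partial>M)"
  proof (rule integral_dominated_convergence[where w="\<lambda>z. 4 * D z / r"])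
    show "(\<lambda>z. deriv (Q z) w0) \<in> borel_measurable M"
      by (rule borel_measurable_LIMSEQ_metric[OF m lim])
    show "integrable M (\<lambda>z. 4 * D z / r)" using D by simp
  qed (use m lim bnd in simp_all)
  moreover have "(\<integral>z. (Q z (Y n) - Q z w0) / (Y n - w0) \<partial>M) = ((\<integral>z. Q z (Y n) \<partial>M) - (\<integral>z. Q z w0 \<partial>M)) / (Y n - w0)" for n
  proof -
    have "(\<integral>z. (Q z (Y n) - Q z w0) / (Y n - w0) \<partial>M) = (\<integral>z. Q z (Y n) - Q z w0 \<partial>M) / (Y n - w0)"
      by (rule integral_divide_zero)
    also have "(\<integral>z. Q z (Y n) - Q z w0 \<partial>M) = (\<integral>z. Q z (Y n) \<partial>M) - (\<integral>z. Q z w0 \<partial>M)"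
      using int[OF Y(3)[of n]] int[of w0] r by (intro Bochner_Integration.integral_diff) simp_all
    finally show ?thesis .
  qed
  ultimately have "(\<lambda>n. ((\<integral>z. Q z (Y n) \<partial>M) - (\<integral>z. Q z w0 \<partial>M)) / (Y n - w0)) \<longlonglongrightarrow> (\<integral>z. deriv (Q z) w0 \<partial>M)" by (simp only:)
  then show "((\<lambda>y. ((\<integral>z. Q z y \<partial>M) - (\<integral>z. Q z w0 \<partial>M)) / (y - w0)) \<circ> X) \<longlonglongrightarrow> (\<integral>z. deriv (Q z) w0 \<partial>M)"
    unfolding Y_def o_def by (rule LIMSEQ_offset)
qed

section \<open>Area means and pointwise bounds in weighted spaces\<close>

lemma distr_lborel_Complex:
  "distr (lborel \<Otimes>\<^sub>M lborel) borel (\<lambda>(x, y). Complex x y) = (lborel :: complex measure)"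
proof (rule lborel_eqI[symmetric])
  have [measurable]: "(\<lambda>p. Complex (fst p) (snd p)) \<in> borel \<rightarrow>\<^sub>M borel"
    unfolding Complex_eq by (intro borel_measurable_continuous_onI continuous_intros)
  have m: "(\<lambda>(x, y). Complex x y) \<in> lborel \<Otimes>\<^sub>M lborel \<rightarrow>\<^sub>M borel"
    unfolding lborel_prod by (simp add: case_prod_beta)
  fix l u :: complex
  assume le: "\<And>b. b \<in> Basis \<Longrightarrow> l \<bullet> b \<le> u \<bullet> b"
  have le': "Re l \<le> Re u" "Im l \<le> Im u" using le[of 1] le[of \<i>] by (auto simp: Basis_complex_def)
  have "(\<lambda>(x, y). Complex x y) -` box l u = {Re l <..< Re u} \<times> {Im l <..< Im u}"
    by (auto simp: box_def Basis_complex_def)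
  then have "emeasure (distr (lborel \<Otimes>\<^sub>M lborel) borel (\<lambda>(x, y). Complex x y)) (box l u)
      = emeasure (lborel \<Otimes>\<^sub>M lborel) ({Re l <..< Re u} \<times> {Im l <..< Im u})"
    by (subst emeasure_distr[OF m]) (auto simp: space_pair_measure)
  also have "\<dots> = ennreal (Re u - Re l) * ennreal (Im u - Im l)"
    using le' by (subst lborel.emeasure_pair_measure_Times) auto
  also have "\<dots> = ennreal (\<Prod>b\<in>Basis. (u - l) \<bullet> b)"
    using le' by (simp add: Basis_complex_def ennreal_mult'[symmetric])
  finally show "emeasure (distr (lborel \<Otimes>\<^sub>M lborel) borel (\<lambda>(x, y). Complex x y)) (box l u)
      = ennreal (\<Prod>b\<in>Basis. (u - l) \<bullet> b)" .
qed simp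

lemma nn_integral_complex:
  fixes f :: "complex \<Rightarrow> ennreal"
  assumes [measurable]: "f \<in> borel_measurable borel"
  shows "(\<integral>\<^sup>+z. f z \<partial>lborel) = (\<integral>\<^sup>+y. (\<integral>\<^sup>+x. f (Complex x y) \<partial>lborel) \<partial>lborel)"
    and "(\<integral>\<^sup>+z. f z \<partial>lborel) = (\<integral>\<^sup>+x. (\<integral>\<^sup>+y. f (Complex x y) \<partial>lborel) \<partial>lborel)"
proof -
  have [measurable]: "(\<lambda>p. Complex (fst p) (snd p)) \<in> borel \<rightarrow>\<^sub>M borel"
    unfolding Complex_eq by (intro borel_measurable_continuous_onI continuous_intros)
  have m: "(\<lambda>(x, y). Complex x y) \<in> lborel \<Otimes>\<^sub>M lborel \<rightarrow>\<^sub>M borel"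
    unfolding lborel_prod by (simp add: case_prod_beta)
  have m2: "(\<lambda>(x, y). f (Complex x y)) \<in> borel_measurable (lborel \<Otimes>\<^sub>M lborel)"
    unfolding lborel_prod by (simp add: case_prod_beta)
  have "(\<integral>\<^sup>+z. f z \<partial>lborel) = (\<integral>\<^sup>+p. f (case p of (x, y) \<Rightarrow> Complex x y) \<partial>(lborel \<Otimes>\<^sub>M lborel))"
    unfolding distr_lborel_Complex[symmetric] by (rule nn_integral_distr[OF m]) simp
  also have "(\<lambda>p. f (case p of (x, y) \<Rightarrow> Complex x y)) = (\<lambda>(x, y). f (Complex x y))" by auto
  finally have eq: "(\<integral>\<^sup>+z. f z \<partial>lborel) = (\<integral>\<^sup>+p. (case p of (x, y) \<Rightarrow> f (Complex x y)) \<partial>(lborel \<Otimes>\<^sub>M lborel))" .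
  show "(\<integral>\<^sup>+z. f z \<partial>lborel) = (\<integral>\<^sup>+y. (\<integral>\<^sup>+x. f (Complex x y) \<partial>lborel) \<partial>lborel)"
    unfolding eq using lborel_pair.nn_integral_snd[OF m2] by simp
  show "(\<integral>\<^sup>+z. f z \<partial>lborel) = (\<integral>\<^sup>+x. (\<integral>\<^sup>+y. f (Complex x y) \<partial>lborel) \<partial>lborel)"
    unfolding eq using lborel.nn_integral_fst[OF m2] by simp
qed

lemma nn_integral_shear:
  fixes f :: "complex \<Rightarrow> ennreal"
  assumes [measurable]: "f \<in> borel_measurable borel"
  shows "(\<integral>\<^sup>+z. f (Complex (Re z + t * Im z) (Im z)) \<partial>lborel) = (\<integral>\<^sup>+z. f z \<partial>lborel)"
    and "(\<integral>\<^sup>+z. f (Complex (Re z) (Im z + t * Re z)) \<partial>lborel) = (\<integral>\<^sup>+z. f z \<partial>lborel)"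
proof -
  have [measurable]: "(\<lambda>z. Complex (Re z + t * Im z) (Im z)) \<in> borel \<rightarrow>\<^sub>M borel"
     "(\<lambda>z. Complex (Re z) (Im z + t * Re z)) \<in> borel \<rightarrow>\<^sub>M borel"
    unfolding Complex_eq by measurable
  have mx: "(\<lambda>x. f (Complex x y)) \<in> borel_measurable borel" for y unfolding Complex_eq by measurable
  have my: "(\<lambda>y. f (Complex x y)) \<in> borel_measurable borel" for x unfolding Complex_eq by measurable
  show "(\<integral>\<^sup>+z. f (Complex (Re z + t * Im z) (Im z)) \<partial>lborel) = (\<integral>\<^sup>+z. f z \<partial>lborel)"
  proof -
    have "(\<integral>\<^sup>+x. f (Complex x y) \<partial>lborel) = (\<integral>\<^sup>+x. f (Complex (x + t * y) y) \<partial>lborel)" for y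
      using nn_integral_real_affine[OF mx, of 1 y "t * y"] by (simp add: add.commute)
    then show ?thesis by (subst (1 2) nn_integral_complex(1)) simp_all
  qed
  show "(\<integral>\<^sup>+z. f (Complex (Re z) (Im z + t * Re z)) \<partial>lborel) = (\<integral>\<^sup>+z. f z \<partial>lborel)"
  proof -
    have "(\<integral>\<^sup>+y. f (Complex x y) \<partial>lborel) = (\<integral>\<^sup>+y. f (Complex x (y + t * x)) \<partial>lborel)" for x
      using nn_integral_real_affine[OF my, of 1 x "t * x"] by (simp add: add.commute)
    then show ?thesis by (subst (1 2) nn_integral_complex(2)) simp_all
  qed
qed

text \<open>A rotation is a product of a horizontal, a vertical and again the same horizontal shear, and a
shear preserves area by Fubini and translation invariance. The shear coefficient
\<open>t = (Re c - 1) / Im c\<close> explains why \<open>c\<close> must not be real.\<close>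

lemma distr_lborel_rotation:
  fixes c :: complex
  assumes c: "norm c = 1" "Im c \<noteq> 0"
  shows "distr lborel borel (\<lambda>z. c * z) = lborel"
proof (rule measure_eqI)
  fix A :: "complex set" assume "A \<in> sets (distr lborel borel (\<lambda>z. c * z))"
  then have A [measurable]: "A \<in> sets borel" by simp
  define t where "t = (Re c - 1) / Im c"
  define f :: "complex \<Rightarrow> ennreal" where "f = indicator A"
  have f [measurable]: "f \<in> borel_measurable borel" unfolding f_def by simp
  have [measurable]: "(\<lambda>z. Complex (Re z + t * Im z) (Im z)) \<in> borel \<rightarrow>\<^sub>M borel"
     "(\<lambda>z. Complex (Re z) (Im z + Im c * Re z)) \<in> borel \<rightarrow>\<^sub>M borel"
    unfolding Complex_eq by measurable
  have n: "Re c * Re c + Im c * Im c = 1" using c(1) by (simp add: cmod_def power2_eq_square)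
  have qt: "Im c * t = Re c - 1" "t * Im c = Re c - 1" using c by (auto simp: t_def)
  have tp: "t * (1 + Re c) = - Im c"
  proof -
    have "(Re c - 1) * (1 + Re c) = - Im c * Im c" using n by (simp add: algebra_simps)
    then show ?thesis using c by (simp add: t_def field_simps)
  qed
  define g1 where "g1 z = f (Complex (Re z + t * Im z) (Im z))" for z
  define g2 where "g2 z = g1 (Complex (Re z) (Im z + Im c * Re z))" for z
  have [measurable]: "g1 \<in> borel_measurable borel" unfolding g1_def by measurable
  have [measurable]: "g2 \<in> borel_measurable borel" unfolding g2_def by measurable
  have eq: "f (c * z) = g2 (Complex (Re z + t * Im z) (Im z))" for z
  proof -
    have 1: "Im z + Im c * (Re z + t * Im z) = Im c * Re z + Re c * Im z"
    proof -
      have "Im z + Im c * (Re z + t * Im z) = Im c * Re z + (1 + Im c * t) * Im z"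
        by (simp only: distrib_left distrib_right mult.assoc mult_1 add_ac)
      then show ?thesis unfolding qt by simp
    qed
    have "Re z + t * Im z + t * (Im c * Re z + Re c * Im z)
       = Re z * (1 + t * Im c) + (t * (1 + Re c)) * Im z" by (simp add: algebra_simps)
    also have "\<dots> = Re c * Re z - Im c * Im z" unfolding qt tp by (simp add: algebra_simps)
    finally have 2: "Re z + t * Im z + t * (Im c * Re z + Re c * Im z) = Re c * Re z - Im c * Im z" .
    have "c * z = Complex (Re c * Re z - Im c * Im z) (Im c * Re z + Re c * Im z)"
      by (simp add: complex_eq_iff)
    then show ?thesis
      unfolding g2_def g1_def complex.sel 1 2 by (simp only:)
  qed
  have "emeasure (distr lborel borel (\<lambda>z. c * z)) A = (\<integral>\<^sup>+z. f (c * z) \<partial>lborel)"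
  proof -
    have "emeasure (distr lborel borel (\<lambda>z. c * z)) A = (\<integral>\<^sup>+z. f z \<partial>distr lborel borel (\<lambda>z. c * z))"
      by (simp add: f_def)
    also have "\<dots> = (\<integral>\<^sup>+z. f (c * z) \<partial>lborel)" by (subst nn_integral_distr) auto
    finally show ?thesis .
  qed
  also have "\<dots> = (\<integral>\<^sup>+z. g2 z \<partial>lborel)" unfolding eq by (rule nn_integral_shear) simp
  also have "\<dots> = (\<integral>\<^sup>+z. g1 z \<partial>lborel)" unfolding g2_def by (rule nn_integral_shear) simp
  also have "\<dots> = (\<integral>\<^sup>+z. f z \<partial>lborel)" unfolding g1_def by (rule nn_integral_shear) simp
  finally show "emeasure (distr lborel borel (\<lambda>z. c * z)) A = emeasure lborel A" by (simp add: f_def)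
qed simp

text \<open>The integral of \<open>\<phi> (c z)\<close> over the unit disc is entire in \<open>c\<close>, and by rotation invariance it
takes one value for all \<open>c\<close> in a set of unit vectors that accumulates at \<open>1\<close>. It is therefore
constant, and its values at \<open>c = 1\<close> and \<open>c = 0\<close> are the two sides.\<close>

lemma area_mean_value:
  fixes \<phi> :: "complex \<Rightarrow> complex"
  assumes hol: "\<phi> holomorphic_on UNIV"
  shows "integrable lborel (\<lambda>z. indicator (ball 0 1) z *\<^sub>R \<phi> z)"
    and "(LBINT z. indicator (ball 0 1) z *\<^sub>R \<phi> z) = pi * \<phi> 0"
proof -
  define \<Psi> where "\<Psi> c = (LBINT z. indicator (ball 0 1) z *\<^sub>R \<phi> (c * z))" for c
  have cont: "continuous_on UNIV \<phi>" using hol by (rule holomorphic_on_imp_continuous_on)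
  have [measurable]: "\<phi> \<in> borel_measurable borel" using cont by (rule borel_measurable_continuous_onI)
  have fin: "emeasure lborel (ball (0::complex) 1) < \<infinity>" by (simp add: emeasure_ball_complex)
  have bex: "\<exists>B. \<forall>z\<in>cball 0 R. norm (\<phi> z) \<le> B" for R
  proof -
    have "compact (\<phi> ` cball 0 R)"
      by (intro compact_continuous_image continuous_on_subset[OF cont]) auto
    then have "bounded (\<phi> ` cball 0 R)" by (rule compact_imp_bounded)
    then show ?thesis unfolding bounded_iff by auto
  qed
  have der: "\<exists>d. (\<Psi> has_field_derivative d) (at w0)" for w0
  proof -
    obtain B where B: "\<And>z. z \<in> cball 0 (norm w0 + 1) \<Longrightarrow> norm (\<phi> z) \<le> B" using bex by blast
    have "((\<lambda>w. LBINT z. indicator (ball 0 1) z *\<^sub>R \<phi> (w * z)) has_field_derivative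
        (LBINT z. deriv (\<lambda>w. indicator (ball 0 1) z *\<^sub>R \<phi> (w * z)) w0)) (at w0)"
    proof (rule has_field_derivative_lebesgue_integral[where r=1 and D="\<lambda>z. indicator (ball 0 1) z * B"])
      show "(\<lambda>w. indicator (ball 0 1) z *\<^sub>R \<phi> (w * z)) holomorphic_on ball w0 1" for z
        by (intro holomorphic_intros holomorphic_on_compose_gen[OF _ hol, unfolded o_def]) auto
      show "integrable lborel (\<lambda>z::complex. indicator (ball 0 1) z * B)"
        using fin by (intro integrable_mult_left) (simp add: integrable_indicator_iff)
      fix w z :: complex assume w: "w \<in> ball w0 1"
      then have w1: "norm w \<le> norm w0 + 1"
        using norm_triangle_ineq2[of w w0] by (simp add: dist_norm norm_minus_commute)
      show "(\<lambda>z. indicator (ball 0 1) z *\<^sub>R \<phi> (w * z)) \<in> borel_measurable lborel"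
      proof -
        have "(\<lambda>z. \<phi> (w * z)) \<in> borel_measurable borel" by measurable
        then show ?thesis by (intro borel_measurable_scaleR borel_measurable_indicator) simp_all
      qed
      show "norm (indicator (ball 0 1) z *\<^sub>R \<phi> (w * z)) \<le> indicator (ball 0 1) z * B"
      proof (cases "z \<in> ball 0 1")
        case True
        then have "norm (w * z) \<le> (norm w0 + 1) * 1" unfolding norm_mult using w1 by (intro mult_mono) auto
        then show ?thesis using True B[of "w * z"] by simp
      qed simp
    qed simp
    then show ?thesis unfolding \<Psi>_def by blast
  qed
  then have hol\<Psi>: "\<Psi> holomorphic_on UNIV"
    by (auto simp: holomorphic_on_def field_differentiable_def)
  define U where "U = range (\<lambda>n::nat. cis (1 / real (Suc n)))"
  have small: "sin (1 / real (Suc n)) > 0" for n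
  proof (rule sin_gt_zero)
    have "1 / real (Suc n) \<le> 1" by simp
    also have "1 < pi" using pi_gt3 by simp
    finally show "1 / real (Suc n) < pi" .
  qed simp
  have inv: "\<Psi> c = \<Psi> 1" if "c \<in> U" for c
  proof -
    obtain n where n: "c = cis (1 / real (Suc n))" using \<open>c \<in> U\<close> by (auto simp: U_def)
    have "sin (1 / real (Suc n)) > 0"
      by (rule small)
    then have c: "norm c = 1" "Im c \<noteq> 0" using n by auto
    have [measurable]: "(\<lambda>z. indicator (ball 0 1) z *\<^sub>R \<phi> z) \<in> borel_measurable borel"
      by (intro borel_measurable_scaleR borel_measurable_indicator) simp_all
    have "\<Psi> 1 = (\<integral>z. indicator (ball 0 1) z *\<^sub>R \<phi> z \<partial>distr lborel borel (\<lambda>z. c * z))"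
      unfolding distr_lborel_rotation[OF c] by (simp add: \<Psi>_def)
    also have "\<dots> = (LBINT z. indicator (ball 0 1) (c * z) *\<^sub>R \<phi> (c * z))"
      by (rule integral_distr) auto
    also have "\<dots> = \<Psi> c" unfolding \<Psi>_def using c by (simp add: indicator_def norm_mult)
    finally show ?thesis ..
  qed
  have lim: "1 islimpt U"
    unfolding islimpt_sequential
  proof (intro exI conjI allI)
    show "cis (1 / real (Suc n)) \<in> U - {1}" for n
    proof -
      have "sin (1 / real (Suc n)) > 0"
        by (rule small)
      then show ?thesis by (auto simp: U_def complex_eq_iff)
    qed
    have "(\<lambda>n. cis (1 / real (Suc n))) \<longlonglongrightarrow> cis 0"
      by (intro tendsto_cis lim_1_over_n LIMSEQ_Suc[of "\<lambda>n. 1 / real n"])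
    then show "(\<lambda>n. cis (1 / real (Suc n))) \<longlonglongrightarrow> 1" by simp
  qed
  have "\<Psi> 0 - \<Psi> 1 = 0"
    by (rule analytic_continuation[of "\<lambda>c. \<Psi> c - \<Psi> 1" UNIV U 1])
       (use lim inv in \<open>auto intro!: holomorphic_intros hol\<Psi>\<close>)
  moreover have "\<Psi> 0 = pi * \<phi> 0"
    unfolding \<Psi>_def using fin
    by (simp add: measure_def emeasure_ball_complex scaleR_conv_of_real)
  ultimately show "(LBINT z. indicator (ball 0 1) z *\<^sub>R \<phi> z) = pi * \<phi> 0" by (simp add: \<Psi>_def)
  obtain B where B: "\<And>z. z \<in> cball 0 1 \<Longrightarrow> norm (\<phi> z) \<le> B" using bex by blast
  show "integrable lborel (\<lambda>z. indicator (ball 0 1) z *\<^sub>R \<phi> z)"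
  proof (rule Bochner_Integration.integrable_bound)
    show "integrable lborel (\<lambda>z::complex. indicator (ball 0 1) z * B)"
      using fin by (intro integrable_mult_left) (simp add: integrable_indicator_iff)
    show "(\<lambda>z. indicator (ball 0 1) z *\<^sub>R \<phi> z) \<in> borel_measurable lborel"
      by (intro borel_measurable_scaleR borel_measurable_indicator) simp_all
    have "norm (indicator (ball 0 1) z *\<^sub>R \<phi> z) \<le> norm (indicator (ball 0 1) z * B)" for z
      using B[of z] by (cases "z \<in> ball 0 1") auto
    then show "AE z in lborel. norm (indicator (ball 0 1) z *\<^sub>R \<phi> z) \<le> norm (indicator (ball 0 1) z * B)" by simp
  qed
qed

lemma lborel_integral_translation:
  fixes f :: "complex \<Rightarrow> 'a::{banach, second_countable_topology}"
  assumes [measurable]: "f \<in> borel_measurable borel"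
  shows "(LBINT z. f (w + z)) = (LBINT z. f z)"
    and "integrable lborel (\<lambda>z. f (w + z)) \<longleftrightarrow> integrable lborel f"
proof -
  show "(LBINT z. f (w + z)) = (LBINT z. f z)"
    by (subst lborel_distr_plus[symmetric, of w], subst integral_distr) auto
  show "integrable lborel (\<lambda>z. f (w + z)) \<longleftrightarrow> integrable lborel f"
    by (subst (2) lborel_distr_plus[symmetric, of w], subst integrable_distr_eq) auto
qed

text \<open>The mean value property is applied to the square of \<open>f (w + \<zeta>) exp (- \<alpha> pi cnj w \<zeta>)\<close>: this twist
carries the weight centred at \<open>w\<close> to the weight centred at \<open>0\<close>, up to the factor
\<open>exp (\<alpha> pi |\<zeta>|^2)\<close>, which is bounded on the unit disc.\<close>

lemma fock_pointwise_le:
  assumes f: "f \<in> fock_space \<alpha>"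
  defines "N \<equiv> (LBINT z. (norm (f z))^2 * exp (- \<alpha> * pi * (norm z)^2))"
  shows "(norm (f w))^2 * exp (- \<alpha> * pi * (norm w)^2) \<le> exp (\<bar>\<alpha>\<bar> * pi) / pi * N"
proof -
  define g where "g z = (norm (f z))^2 * exp (- \<alpha> * pi * (norm z)^2)" for z
  have gi: "integrable lborel g" using f by (simp add: fock_space_def g_def[abs_def])
  have holf: "f holomorphic_on UNIV" using f by (simp add: fock_space_def entire_def)
  define \<phi> where "\<phi> \<zeta> = (f (w + \<zeta>) * exp (- complex_of_real (\<alpha> * pi) * cnj w * \<zeta>))^2" for \<zeta>
  have hol: "\<phi> holomorphic_on UNIV" unfolding \<phi>_def
    by (intro holomorphic_intros holomorphic_on_compose_gen[OF _ holf, unfolded o_def]) auto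
  have [measurable]: "g \<in> borel_measurable borel" using gi by simp
  have gi': "integrable lborel (\<lambda>z. g (w + z))" using lborel_integral_translation(2)[of g w] gi by simp
  have pt: "norm (indicator (ball 0 1) \<zeta> *\<^sub>R \<phi> \<zeta>) \<le> exp (\<alpha> * pi * (norm w)^2) * exp (\<bar>\<alpha>\<bar> * pi) * g (w + \<zeta>)" for \<zeta>
  proof (cases "\<zeta> \<in> ball 0 1")
    case True
    have e: "(norm (w + \<zeta>))^2 = (norm w)^2 + 2 * Re (cnj w * \<zeta>) + (norm \<zeta>)^2"
      unfolding cmod_power2 by (simp add: power2_eq_square algebra_simps)
    have "norm (\<phi> \<zeta>) = (norm (f (w + \<zeta>)))^2 * exp (2 * (- (\<alpha> * pi) * Re (cnj w * \<zeta>)))"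
    proof -
      have "norm (\<phi> \<zeta>) = (norm (f (w + \<zeta>)))^2 * (exp (Re (- complex_of_real (\<alpha> * pi) * cnj w * \<zeta>)))^2"
        by (simp only: \<phi>_def norm_mult norm_power power_mult_distrib norm_exp_eq_Re)
      also have "Re (- complex_of_real (\<alpha> * pi) * cnj w * \<zeta>) = - (\<alpha> * pi) * Re (cnj w * \<zeta>)"
        by (simp add: algebra_simps)
      finally show ?thesis by (simp only: exp_double)
    qed
    also have "2 * (- (\<alpha> * pi) * Re (cnj w * \<zeta>))
        = \<alpha> * pi * (norm w)^2 + \<alpha> * pi * (norm \<zeta>)^2 + - \<alpha> * pi * (norm (w + \<zeta>))^2"
      unfolding e by (simp add: algebra_simps)
    also have "(norm (f (w + \<zeta>)))^2 * exp \<dots> = exp (\<alpha> * pi * (norm w)^2) * exp (\<alpha> * pi * (norm \<zeta>)^2) * g (w + \<zeta>)"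
      unfolding exp_add g_def by simp
    also have "\<dots> \<le> exp (\<alpha> * pi * (norm w)^2) * exp (\<bar>\<alpha>\<bar> * pi) * g (w + \<zeta>)"
    proof (intro mult_right_mono mult_left_mono)
      have "(norm \<zeta>)^2 \<le> 1" using True by (simp add: abs_square_le_1)
      then have "\<bar>\<alpha>\<bar> * (norm \<zeta>)^2 \<le> \<bar>\<alpha>\<bar> * 1" by (intro mult_left_mono) auto
      moreover have "\<alpha> * (norm \<zeta>)^2 \<le> \<bar>\<alpha>\<bar> * (norm \<zeta>)^2" by (intro mult_right_mono) auto
      ultimately have "\<alpha> * (norm \<zeta>)^2 \<le> \<bar>\<alpha>\<bar>" by simp
      from mult_right_mono[OF this, of pi] show "exp (\<alpha> * pi * (norm \<zeta>)^2) \<le> exp (\<bar>\<alpha>\<bar> * pi)"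
        by (simp add: mult.assoc mult.commute mult.left_commute)
    qed (auto simp: g_def)
    finally show ?thesis using True by simp
  qed (auto simp: g_def)
  have "pi * norm (\<phi> 0) = norm (\<integral>\<zeta>. indicator (ball 0 1) \<zeta> *\<^sub>R \<phi> \<zeta> \<partial>lborel)"
    unfolding area_mean_value(2)[OF hol] by (simp add: norm_mult)
  also have "\<dots> \<le> (\<integral>\<zeta>. exp (\<alpha> * pi * (norm w)^2) * exp (\<bar>\<alpha>\<bar> * pi) * g (w + \<zeta>) \<partial>lborel)"
    by (rule Bochner_Integration.integral_norm_bound_integral[OF area_mean_value(1)[OF hol] _ pt])
       (use gi' in simp)
  also have "\<dots> = exp (\<alpha> * pi * (norm w)^2) * exp (\<bar>\<alpha>\<bar> * pi) * N"
    using lborel_integral_translation(1)[OF \<open>g \<in> borel_measurable borel\<close>, of w]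
    unfolding N_def g_def[abs_def] by simp
  also have "norm (\<phi> 0) = (norm (f w))^2" by (simp add: \<phi>_def norm_power)
  finally have "(norm (f w))^2 \<le> exp (\<alpha> * pi * (norm w)^2) * (exp (\<bar>\<alpha>\<bar> * pi) / pi * N)"
    by (simp add: field_simps)
  then have "(norm (f w))^2 * exp (- \<alpha> * pi * (norm w)^2)
      \<le> exp (\<alpha> * pi * (norm w)^2) * (exp (\<bar>\<alpha>\<bar> * pi) / pi * N) * exp (- \<alpha> * pi * (norm w)^2)"
    by (intro mult_right_mono) auto
  also have "\<dots> = exp (\<bar>\<alpha>\<bar> * pi) / pi * N"
    by (simp add: exp_minus)
  finally show ?thesis .
qed

lemma fock_pointwise:
  assumes f: "f \<in> fock_space \<alpha>"
  obtains C where "C \<ge> 0" "\<And>z. norm (f z) \<le> C * exp (\<alpha> * pi / 2 * (norm z)^2)"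
proof -
  define N where "N = (LBINT z. (norm (f z))^2 * exp (- \<alpha> * pi * (norm z)^2))"
  define C where "C = sqrt (exp (\<bar>\<alpha>\<bar> * pi) / pi * N)"
  have "N \<ge> 0" unfolding N_def by (intro integral_nonneg_AE) auto
  then have C2: "C^2 = exp (\<bar>\<alpha>\<bar> * pi) / pi * N" "C \<ge> 0" unfolding C_def by auto
  have "norm (f z) \<le> C * exp (\<alpha> * pi / 2 * (norm z)^2)" for z
  proof (rule power2_le_imp_le)
    have "(norm (f z))^2 * exp (- \<alpha> * pi * (norm z)^2) \<le> C^2"
      using fock_pointwise_le[OF f, of z] C2 by (simp add: N_def)
    then have "(norm (f z))^2 \<le> C^2 * exp (\<alpha> * pi * (norm z)^2)"
      by (simp add: exp_minus field_simps)
    also have "\<dots> = (C * exp (\<alpha> * pi / 2 * (norm z)^2))^2"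
      by (simp add: power_mult_distrib flip: exp_double)
    finally show "(norm (f z))^2 \<le> (C * exp (\<alpha> * pi / 2 * (norm z)^2))^2" .
  qed (use C2 in auto)
  then show ?thesis using C2 that by blast
qed

section \<open>Cauchy transforms of bounded integrable densities\<close>

lemma integral_vanishing_weight:
  fixes \<phi> :: "real \<Rightarrow> complex \<Rightarrow> real" and f :: "complex \<Rightarrow> real"
  assumes f: "integrable lborel f"
    and m: "\<And>R. \<phi> R \<in> borel_measurable borel"
    and bd: "\<And>R z. R > 0 \<Longrightarrow> \<bar>\<phi> R z\<bar> \<le> K"
    and lim: "\<And>z. ((\<lambda>R. \<phi> R z) \<longlongrightarrow> 0) at_top"
  shows "((\<lambda>R. LBINT z. \<phi> R z * f z) \<longlongrightarrow> 0) at_top"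
proof -
  have "((\<lambda>R. LBINT z. \<phi> R z * f z) \<longlongrightarrow> (\<integral>z. (0::real) \<partial>(lborel :: complex measure))) at_top"
  proof (rule integral_dominated_convergence_at_top[where w="\<lambda>z. K * \<bar>f z\<bar>"])
    show "integrable lborel (\<lambda>z. K * \<bar>f z\<bar>)" using f by auto
    show "(\<lambda>z. \<phi> R z * f z) \<in> borel_measurable lborel" for R using m[of R] f by simp
    show "AE z in lborel. ((\<lambda>R. \<phi> R z * f z) \<longlongrightarrow> 0) at_top"
      using tendsto_mult_left_zero[OF lim] by simp
    show "\<forall>\<^sub>F R in at_top. AE z in lborel. norm (\<phi> R z * f z) \<le> K * \<bar>f z\<bar>"
      using eventually_gt_at_top[of 0]
      by eventually_elim (auto simp: abs_mult intro!: mult_right_mono bd)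
  qed simp
  then show ?thesis by simp
qed

lemma integral_tail_tendsto_0:
  fixes f :: "complex \<Rightarrow> real"
  assumes f: "integrable lborel f"
  shows "((\<lambda>R. LBINT z. indicator {z. norm z \<ge> R} z * f z) \<longlongrightarrow> 0) at_top"
proof (rule integral_vanishing_weight[OF f, where K=1])
  show "((\<lambda>R. indicator {z. norm z \<ge> R} z) \<longlongrightarrow> (0::real)) at_top" for z :: complex
  proof (rule tendsto_eventually)
    show "\<forall>\<^sub>F R in at_top. indicator {z. norm z \<ge> R} z = (0::real)"
      using eventually_gt_at_top[of "norm z"] by eventually_elim simp
  qed
qed (auto simp: indicator_def)

definition cauchy_transform :: "(complex \<Rightarrow> complex) \<Rightarrow> complex \<Rightarrow> complex" where
  "cauchy_transform u w = (LBINT z. u z / (z - w))"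

lemma norm_cauchy_transform_le:
  "norm (cauchy_transform u w) \<le> (LBINT z. norm (u z) / norm (z - w))"
proof -
  have "norm (cauchy_transform u w) \<le> (LBINT z. norm (u z / (z - w)))"
    unfolding cauchy_transform_def by (rule integral_norm_bound)
  then show ?thesis by (simp add: norm_divide)
qed

lemma cauchy_transform_bounded:
  assumes u: "integrable lborel u" and B: "\<And>z. norm (u z) \<le> B"
  shows "norm (cauchy_transform u w) \<le> 16 * B + (LBINT z. norm (u z))"
  using order_trans[OF norm_cauchy_transform_le cauchy_kernel_bound(2)[OF u B, of 1 w]] by simp

text \<open>Very close to \<open>w\<close> the bound on \<open>u\<close> wins; elsewhere either \<open>|z| \<ge> |w| / 2\<close>, where little mass is
left, or the kernel is at most \<open>2 / |w|\<close>.\<close>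

lemma cauchy_transform_tendsto_0:
  assumes u: "integrable lborel u" and B: "\<And>z. norm (u z) \<le> B"
  shows "(cauchy_transform u \<longlongrightarrow> 0) at_infinity"
proof (rule tendstoI)
  fix e :: real assume e: "e > 0"
  have [measurable]: "u \<in> borel_measurable borel" using u by simp
  define T where "T R = (LBINT z. indicator {z. norm z \<ge> R} z * norm (u z))" for R
  define N where "N = (LBINT z. norm (u z))"
  have B0: "B \<ge> 0" using B[of 0] norm_ge_zero[of "u 0"] by linarith
  define s where "s = e / (64 * (B + 1))"
  have s: "s > 0" "16 * s * B < e / 3" using e B0 by (auto simp: s_def field_simps intro!: add_nonneg_pos)
  have T: "(T \<longlongrightarrow> 0) at_top"
    unfolding T_def by (rule integral_tail_tendsto_0) (use u in simp)
  have bound: "norm (cauchy_transform u w) \<le> 16 * s * B + T (norm w / 2) / s + 2 * N / norm w" if w: "w \<noteq> 0" for w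
  proof -
    define v where "v z = indicator {z. norm z \<ge> norm w / 2} z *\<^sub>R u z" for z
    have vm [measurable]: "v \<in> borel_measurable borel" unfolding v_def by measurable
    have v: "integrable lborel v"
      by (rule Bochner_Integration.integrable_bound[OF u]) (auto simp: v_def indicator_def)
    have vB: "norm (v z) \<le> B" for z using B[of z] B0 by (auto simp: v_def indicator_def)
    have pt: "norm (u z) / norm (z - w) \<le> norm (v z) / norm (z - w) + 2 / norm w * norm (u z)" for z
    proof (cases "norm z \<ge> norm w / 2")
      case True
      then show ?thesis by (simp add: v_def)
    next
      case False
      then have "norm (z - w) \<ge> norm w / 2" using norm_triangle_ineq3[of z w] by linarith
      moreover have "norm (u z) \<ge> 0" by simp
      moreover have "norm w / 2 > 0" using w by simp
      ultimately have "norm (u z) / norm (z - w) \<le> norm (u z) / (norm w / 2)"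
        by (intro divide_left_mono mult_pos_pos) linarith+
      moreover have "norm (u z) / (norm w / 2) = 2 / norm w * norm (u z)" by simp
      moreover have "0 \<le> norm (v z) / norm (z - w)" by simp
      ultimately show ?thesis by linarith
    qed
    have iv: "integrable lborel (\<lambda>z. norm (v z) / norm (z - w))"
      using integrable_norm[OF cauchy_kernel_bound(1)[OF v vB s(1), of w]] by (simp add: norm_divide)
    have "norm (cauchy_transform u w) \<le> (LBINT z. norm (u z) / norm (z - w))"
      by (rule norm_cauchy_transform_le)
    also have "\<dots> \<le> (LBINT z. norm (v z) / norm (z - w) + 2 / norm w * norm (u z))"
    proof (rule integral_mono[OF _ _ pt])
      show "integrable lborel (\<lambda>z. norm (u z) / norm (z - w))"
        using integrable_norm[OF cauchy_kernel_bound(1)[OF u B s(1), of w]] by (simp add: norm_divide)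
      show "integrable lborel (\<lambda>z. norm (v z) / norm (z - w) + 2 / norm w * norm (u z))"
        using iv u by (intro Bochner_Integration.integrable_add integrable_mult_right) auto
    qed
    also have "\<dots> = (LBINT z. norm (v z) / norm (z - w)) + 2 / norm w * N"
      unfolding N_def using iv u by (subst Bochner_Integration.integral_add) auto
    also have "(LBINT z. norm (v z) / norm (z - w)) \<le> 16 * s * B + (LBINT z. norm (v z)) / s"
      by (rule cauchy_kernel_bound(2)[OF v vB s(1)])
    also have "(LBINT z. norm (v z)) = T (norm w / 2)"
      unfolding T_def by (intro Bochner_Integration.integral_cong) (auto simp: v_def)
    finally show ?thesis by simp
  qed
  have nt: "filterlim (\<lambda>w::complex. norm w) at_top at_infinity"
    by (rule filterlim_norm_at_top)
  have nt2: "filterlim (\<lambda>w::complex. norm w / 2) at_top at_infinity"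
    using filterlim_tendsto_pos_mult_at_top[OF tendsto_const _ nt, of "1/2"] by simp
  have "((\<lambda>w::complex. T (norm w / 2)) \<longlongrightarrow> 0) at_infinity"
    using T nt2 by (rule filterlim_compose)
  then have e1: "\<forall>\<^sub>F w::complex in at_infinity. T (norm w / 2) < s * e / 3"
    using s e by (intro order_tendstoD(2)) auto
  have "((\<lambda>w::complex. 2 * N / norm w) \<longlongrightarrow> 0) at_infinity"
    by (rule tendsto_divide_0[OF tendsto_const]) (rule filterlim_mono[OF nt at_top_le_at_infinity order_refl])
  then have e2: "\<forall>\<^sub>F w::complex in at_infinity. 2 * N / norm w < e / 3"
    using e by (intro order_tendstoD(2)) auto
  have e3: "\<forall>\<^sub>F w::complex in at_infinity. w \<noteq> 0"
    by (auto simp: eventually_at_infinity intro!: exI[of _ 1])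
  from e1 e2 e3 show "\<forall>\<^sub>F w in at_infinity. dist (cauchy_transform u w) 0 < e"
  proof eventually_elim
    case (elim w)
    have "T (norm w / 2) / s < e / 3" using elim(1) s by (simp add: field_simps)
    then have "norm (cauchy_transform u w) < e" using bound[OF elim(3)] s(2) elim(2) by linarith
    then show ?case by simp
  qed
qed

definition divided_difference :: "(complex \<Rightarrow> complex) \<Rightarrow> complex \<Rightarrow> complex \<Rightarrow> complex" where
  "divided_difference h z w = (if w = z then deriv h z else (h w - h z) / (w - z))"

lemma divided_difference_commute: "divided_difference h z w = divided_difference h w z"
  using minus_divide_divide[of "h w - h z" "w - z"] by (auto simp: divided_difference_def)

lemma divided_difference_holomorphic:
  "h holomorphic_on UNIV \<Longrightarrow> divided_difference h z holomorphic_on UNIV"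
  unfolding divided_difference_def by (rule pole_lemma_open) auto

lemma divided_difference_borel [measurable]:
  assumes "h holomorphic_on UNIV"
  shows "(\<lambda>z. divided_difference h z w) \<in> borel_measurable borel"
  unfolding divided_difference_commute[of h _ w]
  using divided_difference_holomorphic[OF assms]
  by (intro borel_measurable_continuous_onI holomorphic_on_imp_continuous_on)

lemma continuous_bounded_on_cball:
  fixes f :: "complex \<Rightarrow> complex"
  assumes "continuous_on UNIV f"
  obtains B where "B \<ge> 0" "\<And>z. z \<in> cball a R \<Longrightarrow> norm (f z) \<le> B"
proof -
  have "compact (f ` cball a R)"
    by (intro compact_continuous_image continuous_on_subset[OF assms]) auto
  then have "bounded (f ` cball a R)" by (rule compact_imp_bounded)
  then obtain B where "\<And>z. z \<in> cball a R \<Longrightarrow> norm (f z) \<le> B" unfolding bounded_iff by blast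
  then show ?thesis using that[of "max B 0"] by (meson max.cobounded2 max.coboundedI1)
qed

text \<open>Together with the next lemma this says that \<open>C\<^sub>h - h C\<^sub>1\<close> is entire: the singular kernel cancels
in the divided difference \<open>(h z - h w) / (z - w)\<close>.\<close>

lemma divided_difference_transform_entire:
  assumes h: "h holomorphic_on UNIV"
    and u: "integrable lborel u" and hu: "integrable lborel (\<lambda>z. h z * u z)"
  shows "(\<lambda>w. LBINT z. divided_difference h z w * u z) holomorphic_on UNIV"
proof -
  have "\<exists>d. ((\<lambda>w. LBINT z. divided_difference h z w * u z) has_field_derivative d) (at w0)" for w0
  proof -
    have ch: "continuous_on UNIV h" using h by (rule holomorphic_on_imp_continuous_on)
    have cd: "continuous_on UNIV (deriv h)"
      using h by (intro holomorphic_on_imp_continuous_on holomorphic_deriv) auto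
    obtain S1 where S1: "S1 \<ge> 0" "\<And>z. z \<in> cball w0 3 \<Longrightarrow> norm (deriv h z) \<le> S1"
      using continuous_bounded_on_cball[OF cd] by metis
    obtain S2 where S2: "S2 \<ge> 0" "\<And>z. z \<in> cball w0 1 \<Longrightarrow> norm (h z) \<le> S2"
      using continuous_bounded_on_cball[OF ch] by metis
    have bd: "norm (divided_difference h z w) \<le> S1 + S2 + norm (h z)" if w: "w \<in> ball w0 1" for z w
    proof (cases "z \<in> cball w0 2")
      case True
      have "norm (divided_difference h z w) \<le> S1"
      proof (cases "w = z")
        case True
        then show ?thesis using S1(2)[of z] \<open>z \<in> cball w0 2\<close> by (simp add: divided_difference_def)
      next
        case False
        have "norm (h w - h z) \<le> S1 * norm (w - z)"
        proof (rule field_differentiable_bound[of "cball w0 3"])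
          fix x assume x: "x \<in> cball w0 3"
          show "(h has_field_derivative deriv h x) (at x within cball w0 3)"
            by (rule has_field_derivative_at_within[OF holomorphic_derivI[OF h]]) auto
          show "norm (deriv h x) \<le> S1" using S1(2)[OF x] .
        qed (use w True in auto)
        then show ?thesis using False by (simp add: divided_difference_def norm_divide pos_divide_le_eq)
      qed
      then show ?thesis using S2(1) norm_ge_zero[of "h z"] by linarith
    next
      case False
      have d: "dist z w \<ge> 1"
        using False w dist_triangle[of w0 z w] by (simp add: dist_commute)
      then have "w \<noteq> z" by auto
      then have "norm (divided_difference h z w) = norm (h w - h z) / norm (w - z)"
        by (simp add: divided_difference_def norm_divide)
      also have "\<dots> \<le> norm (h w - h z)"
        using d divide_left_mono[of 1 "norm (w - z)" "norm (h w - h z)"] \<open>w \<noteq> z\<close>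
        by (simp add: dist_norm norm_minus_commute)
      also have "\<dots> \<le> norm (h w) + norm (h z)" by (rule norm_triangle_ineq4)
      also have "norm (h w) \<le> S2" using w S2(2)[of w] by simp
      finally show ?thesis using S1(1) by simp
    qed
    have "((\<lambda>w. LBINT z. divided_difference h z w * u z) has_field_derivative
        (LBINT z. deriv (\<lambda>w. divided_difference h z w * u z) w0)) (at w0)"
    proof (rule has_field_derivative_lebesgue_integral[where r=1
          and D="\<lambda>z. (S1 + S2) * norm (u z) + norm (h z * u z)"])
      show "(\<lambda>w. divided_difference h z w * u z) holomorphic_on ball w0 1" for z
        by (intro holomorphic_intros holomorphic_on_subset[OF divided_difference_holomorphic[OF h]]) auto
      show "(\<lambda>z. divided_difference h z w * u z) \<in> borel_measurable lborel" for w
        using divided_difference_borel[OF h, of w] u by simp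
      show "integrable lborel (\<lambda>z. (S1 + S2) * norm (u z) + norm (h z * u z))"
        using u hu by (intro Bochner_Integration.integrable_add integrable_mult_right integrable_norm)
      show "norm (divided_difference h z w * u z) \<le> (S1 + S2) * norm (u z) + norm (h z * u z)"
        if "w \<in> ball w0 1" for z w
        using mult_right_mono[OF bd[OF that, of z] norm_ge_zero[of "u z"]]
        by (simp add: norm_mult distrib_right)
    qed simp
    then show ?thesis by blast
  qed
  then show ?thesis by (auto simp: holomorphic_on_def field_differentiable_def)
qed

lemma divided_difference_transform_eq:
  assumes h: "h holomorphic_on UNIV"
    and u: "integrable lborel u" "\<And>z. norm (u z) \<le> B"
    and hu: "integrable lborel (\<lambda>z. h z * u z)" "\<And>z. norm (h z * u z) \<le> B'"
  shows "(LBINT z. divided_difference h z w * u z)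
    = cauchy_transform (\<lambda>z. h z * u z) w - h w * cauchy_transform u w"
proof -
  have i1: "integrable lborel (\<lambda>z. h z * u z / (z - w))" by (rule cauchy_kernel_bound(1)[OF hu, of 1]) simp
  have i2: "integrable lborel (\<lambda>z. u z / (z - w))" by (rule cauchy_kernel_bound(1)[OF u, of 1]) simp
  have "(LBINT z. divided_difference h z w * u z)
      = (LBINT z. h z * u z / (z - w) - h w * (u z / (z - w)))"
  proof (rule integral_cong_AE)
    have "AE z in lborel. z \<noteq> w" by (rule AE_lborel_singleton)
    then show "AE z in lborel. divided_difference h z w * u z = h z * u z / (z - w) - h w * (u z / (z - w))"
    proof eventually_elim
      case (elim z)
      then have "divided_difference h z w = (h z - h w) / (z - w)"
        unfolding divided_difference_commute[of h z w] by (simp add: divided_difference_def)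
      then show ?case by (simp add: diff_divide_distrib left_diff_distrib)
    qed
  qed (use divided_difference_borel[OF h, of w] u(1) hu(1) i1 i2 in auto)
  also have "\<dots> = cauchy_transform (\<lambda>z. h z * u z) w - h w * cauchy_transform u w"
    unfolding cauchy_transform_def
    by (simp only: Bochner_Integration.integral_diff[OF i1 integrable_mult_right[OF i2]] integral_mult_right_zero)
  finally show ?thesis .
qed

section \<open>Completely regular growth\<close>

lemma measure_scaled_preimage:
  assumes E: "E \<in> sets lebesgue" and a: "a > (0::real)"
  shows "(\<lambda>x. a * x) -` (E \<inter> {0..a * T}) \<in> lmeasurable"
    and "measure lebesgue ((\<lambda>x. a * x) -` (E \<inter> {0..a * T})) = measure lebesgue (E \<inter> {0..a * T}) / a"
proof -
  define A where "A = (\<lambda>x. a * x) -` (E \<inter> {0..a * T})"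
  have "A \<in> sets lebesgue"
  proof -
    have "E \<inter> {0..a * T} \<in> sets lebesgue" using E by auto
    from measurable_sets[OF lebesgue_measurable_scaling[of a] this]
    show ?thesis by (simp add: A_def vimage_def)
  qed
  moreover have "bounded A"
    by (rule bounded_subset[of "{0..T}"]) (use a in \<open>auto simp: A_def zero_le_mult_iff\<close>)
  ultimately show "A \<in> lmeasurable" unfolding A_def[symmetric] by (rule bounded_set_imp_lmeasurable[rotated])
  have "(\<lambda>x. a *\<^sub>R x + 0) ` A = E \<inter> {0..a * T}"
  proof safe
    fix y assume "y \<in> E" "y \<in> {0..a * T}"
    then show "y \<in> (\<lambda>x. a *\<^sub>R x + 0) ` A"
      using a by (intro image_eqI[of _ _ "y / a"]) (auto simp: A_def)
  qed (auto simp: A_def)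
  then show "measure lebesgue A = measure lebesgue (E \<inter> {0..a * T}) / a"
    using measure_lebesgue_affine[of a 0 A] a by simp
qed

text \<open>Otherwise \<open>[R, (1 + \<eta>) R]\<close> would be covered by rescaled copies of two initial parts of \<open>E\<close>, whose
total length is \<open>o(R)\<close>. Two scales at once are required in order to compare two dilations of the
same function on one circle.\<close>

lemma zero_relative_measure_avoid:
  assumes E: "zero_relative_measure E" and a: "a > 0" and b: "b > 0" and \<eta>: "\<eta> > 0"
  shows "\<exists>R0>0. \<forall>R\<ge>R0. \<exists>\<rho>. R \<le> \<rho> \<and> \<rho> \<le> (1 + \<eta>) * R \<and> a * \<rho> \<notin> E \<and> b * \<rho> \<notin> E"
proof -
  have Em: "E \<in> sets lebesgue" and lim: "((\<lambda>R. measure lebesgue (E \<inter> {0..R}) / R) \<longlongrightarrow> 0) at_top"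
    using E by (auto simp: zero_relative_measure_def)
  define \<kappa> where "\<kappa> = \<eta> / 4 / (1 + \<eta>)"
  have \<kappa>: "\<kappa> > 0" using \<eta> by (simp add: \<kappa>_def)
  from order_tendstoD(2)[OF lim \<kappa>] obtain T0
    where T0: "\<And>T. T \<ge> T0 \<Longrightarrow> measure lebesgue (E \<inter> {0..T}) / T < \<kappa>"
    by (auto simp: eventually_at_top_linorder)
  define R0 where "R0 = max 1 (max (T0 / a) (T0 / b))"
  have "\<exists>\<rho>. R \<le> \<rho> \<and> \<rho> \<le> (1 + \<eta>) * R \<and> a * \<rho> \<notin> E \<and> b * \<rho> \<notin> E" if R: "R \<ge> R0" for R
  proof (rule ccontr)
    assume neg: "\<not> ?thesis"
    have R1: "R \<ge> 1" "T0 \<le> a * R" "T0 \<le> b * R" using R a b by (auto simp: R0_def field_simps)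
    define T where "T = (1 + \<eta>) * R"
    have T: "T > 0" "R \<le> T" using R1 \<eta> by (auto simp: T_def)
    have m: "measure lebesgue ((\<lambda>x. c * x) -` (E \<inter> {0..c * T})) \<le> \<kappa> * T" if c: "c > 0" "T0 \<le> c * R" for c
    proof -
      have "T0 \<le> c * T" using c T by (meson mult_left_mono order_trans less_imp_le)
      then have "measure lebesgue (E \<inter> {0..c * T}) / (c * T) < \<kappa>" by (rule T0)
      then show ?thesis using c T unfolding measure_scaled_preimage(2)[OF Em c(1)] by (simp add: field_simps)
    qed
    let ?A = "(\<lambda>x. a * x) -` (E \<inter> {0..a * T})" and ?B = "(\<lambda>x. b * x) -` (E \<inter> {0..b * T})"
    have "{R..T} \<subseteq> ?A \<union> ?B"
    proof
      fix \<rho> assume \<rho>: "\<rho> \<in> {R..T}"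
      then have "a * \<rho> \<in> E \<or> b * \<rho> \<in> E" using neg by (auto simp: T_def)
      then show "\<rho> \<in> ?A \<union> ?B" using \<rho> a b R1 by auto
    qed
    then have "measure lebesgue {R..T} \<le> measure lebesgue (?A \<union> ?B)"
      using measure_scaled_preimage(1)[OF Em] a b by (intro measure_mono_fmeasurable fmeasurable.Un) auto
    also have "\<dots> \<le> measure lebesgue ?A + measure lebesgue ?B"
      using measure_scaled_preimage(1)[OF Em] a b by (intro measure_Un_le) (auto simp: fmeasurable_def)
    also have "\<dots> \<le> \<kappa> * T + \<kappa> * T" by (rule add_mono[OF m[OF a R1(2)] m[OF b R1(3)]])
    also have "\<kappa> * T = \<eta> / 4 * R"
    proof -
      have "\<kappa> * (1 + \<eta>) = \<eta> / 4" using \<eta> by (simp add: \<kappa>_def del: distrib_left_numeral)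
      then show ?thesis unfolding T_def mult.assoc[symmetric] by (simp only:)
    qed
    also have "\<eta> / 4 * R + \<eta> / 4 * R = \<eta> / 2 * R" by (simp add: field_simps)
    finally have "T - R \<le> \<eta> / 2 * R" using T by simp
    then show False using \<eta> R1 by (simp add: T_def algebra_simps)
  qed
  then show ?thesis by (intro exI[of _ R0]) (auto simp: R0_def)
qed

lemma maximum_modulus_disc:
  assumes f: "f holomorphic_on UNIV" and B: "\<And>z. norm (z - a) = \<rho> \<Longrightarrow> norm (f z) \<le> B" and w: "norm (w - a) \<le> \<rho>"
  shows "norm (f w) \<le> B"
proof (cases "\<rho> > 0")
  case True
  show ?thesis
  proof (rule maximum_modulus_frontier[of f "cball a \<rho>"])
    show "norm (f z) \<le> B" if "z \<in> frontier (cball a \<rho>)" for z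
      using that True B by (simp add: frontier_cball dist_norm norm_minus_commute)
  qed (use w in \<open>auto intro: holomorphic_on_subset[OF f] holomorphic_on_imp_continuous_on simp: dist_norm norm_minus_commute\<close>)
next
  case False
  then have n: "norm (w - a) = 0" "\<rho> = 0" using w norm_ge_zero[of "w - a"] by linarith+
  then have "w = a" by simp
  then show ?thesis using B[of w] n by simp
qed

lemma entire_zero_if_small_on_circles:
  assumes f: "f holomorphic_on UNIV"
    and small: "\<And>e R. e > 0 \<Longrightarrow> \<exists>\<rho>\<ge>R. \<forall>z. norm z = \<rho> \<longrightarrow> norm (f z) \<le> e"
  shows "f z = 0"
proof -
  have "norm (f z) \<le> e" if e: "e > 0" for e
  proof -
    obtain \<rho> where "\<rho> \<ge> norm z" "\<forall>z. norm z = \<rho> \<longrightarrow> norm (f z) \<le> e" using small[OF e, of "norm z"] by blast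
    then show ?thesis using maximum_modulus_disc[OF f, of 0 \<rho> e z] by simp
  qed
  then have "norm (f z) \<le> 0" by (rule field_le_epsilon[of _ 0, simplified])
  then show ?thesis by simp
qed

text \<open>By the maximum principle a point inherits the bound of the next good circle; the ratio of the
radii costs the factor \<open>(1 + \<eta>)^2\<close> in the type.\<close>

lemma gauss_growth_from_circles:
  assumes f: "f holomorphic_on UNIV" and c: "c \<ge> 0" and C: "C \<ge> 0" and \<eta>: "\<eta> > 0"
    and circ: "\<And>R. R \<ge> R0 \<Longrightarrow> \<exists>\<rho>. R \<le> \<rho> \<and> \<rho> \<le> (1 + \<eta>) * R \<and>
       (\<forall>z. norm z = \<rho> \<longrightarrow> norm (f z) \<le> C * exp (c * \<rho>^2))"
  obtains C' where "C' \<ge> 0" "\<And>z. norm (f z) \<le> C' * exp (c * (1 + \<eta>)^2 * (norm z)^2)"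
proof -
  have "continuous_on UNIV f" using f by (rule holomorphic_on_imp_continuous_on)
  then obtain B where B: "B \<ge> 0" "\<And>z. z \<in> cball 0 R0 \<Longrightarrow> norm (f z) \<le> B"
    using continuous_bounded_on_cball by metis
  have "norm (f z) \<le> (B + C) * exp (c * (1 + \<eta>)^2 * (norm z)^2)" for z
  proof (cases "norm z \<ge> R0")
    case True
    then obtain \<rho> where \<rho>: "norm z \<le> \<rho>" "\<rho> \<le> (1 + \<eta>) * norm z"
      "\<And>w. norm w = \<rho> \<Longrightarrow> norm (f w) \<le> C * exp (c * \<rho>^2)" using circ[OF True] by blast
    have "norm (f z) \<le> C * exp (c * \<rho>^2)"
      using maximum_modulus_disc[OF f, of 0 \<rho> _ z] \<rho> by simp
    also have "\<dots> \<le> (B + C) * exp (c * (1 + \<eta>)^2 * (norm z)^2)"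
    proof (intro mult_mono)
      have "\<rho>^2 \<le> ((1 + \<eta>) * norm z)^2" using \<rho> order_trans[OF norm_ge_zero \<rho>(1)] by (intro power_mono)
      then show "exp (c * \<rho>^2) \<le> exp (c * (1 + \<eta>)^2 * (norm z)^2)"
        using mult_left_mono[OF _ c] by (simp add: power_mult_distrib mult.assoc)
    qed (use B C in auto)
    finally show ?thesis .
  next
    case False
    then have "norm (f z) \<le> B * 1" using B(2)[of z] by simp
    also have "\<dots> \<le> (B + C) * exp (c * (1 + \<eta>)^2 * (norm z)^2)"
      using B(1) C c by (intro mult_mono) auto
    finally show ?thesis .
  qed
  then show ?thesis using B(1) C that[of "B + C"] by auto
qed

text \<open>Completely regular growth with a positive indicator, in the form in which it is used: \<open>H\<close> is the
indicator as a function of the point rather than of the angle, real-valued, and bounded above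
and away from zero.\<close>

locale regular_growth =
  fixes G :: "complex \<Rightarrow> complex" and E :: "real set" and H :: "complex \<Rightarrow> real" and \<delta> \<Lambda> :: real
  assumes G_entire: "G holomorphic_on UNIV"
    and E_thin: "zero_relative_measure E"
    and H_ray: "\<And>c z. c > 0 \<Longrightarrow> H (of_real c * z) = H z"
    and H_lower: "\<And>z. \<delta> \<le> H z" and \<delta>_pos: "\<delta> > 0" and H_upper: "\<And>z. H z \<le> \<Lambda>"
    and asymptotics: "\<And>\<epsilon>. \<epsilon> > 0 \<Longrightarrow> \<exists>R. \<forall>z. norm z \<ge> R \<longrightarrow> norm z \<notin> E \<longrightarrow>
      G z \<noteq> 0 \<and> \<bar>ln (norm (G z)) - H z * (norm z)^2\<bar> \<le> \<epsilon> * (norm z)^2"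

text \<open>One circle outside the exceptional set already shows that the indicator is finite, and bounded
above by compactness of the circle.\<close>

lemma regular_growthI:
  assumes G: "G \<in> entire" and crg: "completely_regular_growth G"
    and pos: "(INF \<theta>\<in>{0..2*pi}. growth_indicator G \<theta>) > 0"
  obtains E H \<delta> \<Lambda> where "regular_growth G E H \<delta> \<Lambda>"
proof -
  obtain E where E: "zero_relative_measure E" and ev: "\<And>\<epsilon>. \<epsilon> > 0 \<Longrightarrow> \<forall>\<^sub>F r in at_top. r \<notin> E \<longrightarrow>
          (\<forall>\<theta>\<in>{0..2*pi}.
             \<bar>log_norm (G (of_real r * cis \<theta>)) / ereal (r^2) - growth_indicator G \<theta>\<bar> < ereal \<epsilon>)"
    using crg unfolding completely_regular_growth_def by auto
  define h where "h \<theta> = real_of_ereal (growth_indicator G \<theta>)" for \<theta>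
  define H where "H z = h (Arg2pi z)" for z
  have polar: "z = of_real (norm z) * cis (Arg2pi z)" "Arg2pi z \<in> {0..2*pi}" for z :: complex
    using Arg2pi_eq[of z] Arg2pi_ge_0[of z] Arg2pi_lt_2pi[of z] by (auto simp: cis_conv_exp)
  have fin: "growth_indicator G \<theta> = ereal (h \<theta>) \<and> G (of_real r * cis \<theta>) \<noteq> 0 \<and>
      \<bar>ln (norm (G (of_real r * cis \<theta>))) - h \<theta> * r^2\<bar> \<le> \<epsilon> * r^2"
    if r: "r > 0" and less: "\<bar>log_norm (G (of_real r * cis \<theta>)) / ereal (r^2) - growth_indicator G \<theta>\<bar> < ereal \<epsilon>"
    for r \<theta> \<epsilon>
  proof -
    have nz: "G (of_real r * cis \<theta>) \<noteq> 0"
    proof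
      assume "G (of_real r * cis \<theta>) = 0"
      then have "log_norm (G (of_real r * cis \<theta>)) / ereal (r^2) = -\<infinity>"
        using r by (simp add: log_norm_def)
      then show False using less by (cases "growth_indicator G \<theta>") auto
    qed
    then have q: "log_norm (G (of_real r * cis \<theta>)) / ereal (r^2) = ereal (ln (norm (G (of_real r * cis \<theta>))) / r^2)"
      using r by (simp add: log_norm_def)
    obtain x where x: "growth_indicator G \<theta> = ereal x"
      using less unfolding q by (cases "growth_indicator G \<theta>") auto
    then have "\<bar>ln (norm (G (of_real r * cis \<theta>))) / r^2 - h \<theta>\<bar> < \<epsilon>" using less unfolding q by (simp add: h_def)
    then have "\<bar>ln (norm (G (of_real r * cis \<theta>))) / r^2 - h \<theta>\<bar> * r^2 \<le> \<epsilon> * r^2"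
      by (intro mult_right_mono) auto
    also have "\<bar>ln (norm (G (of_real r * cis \<theta>))) / r^2 - h \<theta>\<bar> * r^2
       = \<bar>(ln (norm (G (of_real r * cis \<theta>))) / r^2 - h \<theta>) * r^2\<bar>" by (simp add: abs_mult)
    also have "(ln (norm (G (of_real r * cis \<theta>))) / r^2 - h \<theta>) * r^2 = ln (norm (G (of_real r * cis \<theta>))) - h \<theta> * r^2"
      using r by (simp add: field_simps)
    finally show ?thesis using nz x by (simp add: h_def)
  qed
  have asym: "\<exists>R. \<forall>r\<ge>R. r \<notin> E \<longrightarrow> r > 0 \<and> (\<forall>\<theta>\<in>{0..2*pi}. growth_indicator G \<theta> = ereal (h \<theta>) \<and> G (of_real r * cis \<theta>) \<noteq> 0 \<and>
      \<bar>ln (norm (G (of_real r * cis \<theta>))) - h \<theta> * r^2\<bar> \<le> \<epsilon> * r^2)" if \<epsilon>: "\<epsilon> > 0" for \<epsilon>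
  proof -
    obtain R where R: "\<And>r. r \<ge> R \<Longrightarrow> r \<notin> E \<Longrightarrow>
          (\<forall>\<theta>\<in>{0..2*pi}.
             \<bar>log_norm (G (of_real r * cis \<theta>)) / ereal (r^2) - growth_indicator G \<theta>\<bar> < ereal \<epsilon>)"
      using ev[OF \<epsilon>] unfolding eventually_at_top_linorder by blast
    show ?thesis
    proof (intro exI[of _ "max R 1"] allI impI conjI ballI)
      fix r \<theta> assume r: "r \<ge> max R 1" "r \<notin> E" "\<theta> \<in> {0..2*pi}"
      then have "\<bar>log_norm (G (of_real r * cis \<theta>)) / ereal (r^2) - growth_indicator G \<theta>\<bar> < ereal \<epsilon>"
        using R by auto
      from fin[OF _ this] r show "growth_indicator G \<theta> = ereal (h \<theta>)" "G (of_real r * cis \<theta>) \<noteq> 0"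
        "\<bar>ln (norm (G (of_real r * cis \<theta>))) - h \<theta> * r^2\<bar> \<le> \<epsilon> * r^2" by auto
    qed auto
  qed
  obtain R1 where R1: "\<And>r. r \<ge> R1 \<Longrightarrow> r \<notin> E \<Longrightarrow> r > 0 \<and> (\<forall>\<theta>\<in>{0..2*pi}. growth_indicator G \<theta> = ereal (h \<theta>) \<and> G (of_real r * cis \<theta>) \<noteq> 0 \<and>
      \<bar>ln (norm (G (of_real r * cis \<theta>))) - h \<theta> * r^2\<bar> \<le> 1 * r^2)" using asym[of 1] by auto
  obtain r0 where r0: "r0 \<ge> R1" "r0 \<notin> E"
  proof -
    obtain R0 where R0: "\<And>R. R \<ge> R0 \<Longrightarrow> \<exists>\<rho>. R \<le> \<rho> \<and> \<rho> \<notin> E"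
      using zero_relative_measure_avoid[OF E, of 1 1 1] zero_less_one mult_1 by metis
    from R0[OF max.cobounded1, of R1] show ?thesis using that by (meson max.boundedE)
  qed
  note R1r = R1[OF r0]
  obtain \<delta> where \<delta>: "0 < ereal \<delta>" "ereal \<delta> < (INF \<theta>\<in>{0..2*pi}. growth_indicator G \<theta>)"
    using ereal_dense2[OF pos] by auto
  have hl: "\<delta> \<le> h \<theta>" if "\<theta> \<in> {0..2*pi}" for \<theta>
  proof -
    have "ereal \<delta> < growth_indicator G \<theta>" using \<delta>(2) INF_lower[OF that] by (rule less_le_trans)
    then show ?thesis using R1r that by auto
  qed
  have "continuous_on UNIV G" using G by (rule entire_continuous)
  then obtain B where B: "B \<ge> 0" "\<And>z. z \<in> cball 0 r0 \<Longrightarrow> norm (G z) \<le> B"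
    using continuous_bounded_on_cball by metis
  have hu: "h \<theta> \<le> ln (B + 1) / r0^2 + 1" if "\<theta> \<in> {0..2*pi}" for \<theta>
  proof -
    have a: "r0 > 0" "G (of_real r0 * cis \<theta>) \<noteq> 0" "\<bar>ln (norm (G (of_real r0 * cis \<theta>))) - h \<theta> * r0^2\<bar> \<le> 1 * r0^2"
      using R1r that by auto
    have "norm (G (of_real r0 * cis \<theta>)) \<le> B" using a(1) by (intro B(2)) (simp add: norm_mult)
    then have "ln (norm (G (of_real r0 * cis \<theta>))) \<le> ln (B + 1)" using a(2) B(1) by (subst ln_le_cancel_iff) auto
    then have "h \<theta> * r0^2 \<le> ln (B + 1) + r0^2" using a(3) by linarith
    then show ?thesis using a(1) by (simp add: field_simps)
  qed
  have "regular_growth G E H \<delta> (ln (B + 1) / r0^2 + 1)"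
  proof
    show "G holomorphic_on UNIV" using G by (simp add: entire_def)
    show "zero_relative_measure E" by (rule E)
    show "H (of_real c * z) = H z" if "c > 0" for c z using that by (simp add: H_def)
    show "\<delta> \<le> H z" "H z \<le> ln (B + 1) / r0^2 + 1" for z using hl hu polar(2) by (auto simp: H_def)
    show "\<delta> > 0" using \<delta> by simp
    fix \<epsilon> :: real assume "\<epsilon> > 0"
    from asym[OF this] obtain R where R: "\<And>r. r \<ge> R \<Longrightarrow> r \<notin> E \<Longrightarrow> r > 0 \<and> (\<forall>\<theta>\<in>{0..2*pi}. growth_indicator G \<theta> = ereal (h \<theta>) \<and> G (of_real r * cis \<theta>) \<noteq> 0 \<and>
      \<bar>ln (norm (G (of_real r * cis \<theta>))) - h \<theta> * r^2\<bar> \<le> \<epsilon> * r^2)" by blast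
    show "\<exists>R. \<forall>z. norm z \<ge> R \<longrightarrow> norm z \<notin> E \<longrightarrow>
      G z \<noteq> 0 \<and> \<bar>ln (norm (G z)) - H z * (norm z)^2\<bar> \<le> \<epsilon> * (norm z)^2"
    proof (intro exI[of _ R] allI impI)
      fix z :: complex assume z: "norm z \<ge> R" "norm z \<notin> E"
      have "G (of_real (norm z) * cis (Arg2pi z)) \<noteq> 0 \<and>
          \<bar>ln (norm (G (of_real (norm z) * cis (Arg2pi z)))) - h (Arg2pi z) * (norm z)^2\<bar> \<le> \<epsilon> * (norm z)^2"
        using R[OF z] polar(2)[of z] by blast
      then show "G z \<noteq> 0 \<and> \<bar>ln (norm (G z)) - H z * (norm z)^2\<bar> \<le> \<epsilon> * (norm z)^2"
        unfolding polar(1)[symmetric] H_def .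
    qed
  qed
  then show ?thesis by (rule that)
qed

context regular_growth
begin

lemma dilation_bounds:
  assumes "\<epsilon> > 0" "r > 0"
  shows "\<exists>R. \<forall>z. norm z \<ge> R \<longrightarrow> r * norm z \<notin> E \<longrightarrow> G (of_real r * z) \<noteq> 0 \<and>
    norm (G (of_real r * z)) \<le> exp (r^2 * (H z + \<epsilon>) * (norm z)^2) \<and>
    exp (r^2 * (H z - \<epsilon>) * (norm z)^2) \<le> norm (G (of_real r * z))"
proof -
  obtain R where R: "\<And>z. norm z \<ge> R \<Longrightarrow> norm z \<notin> E \<Longrightarrow>
      G z \<noteq> 0 \<and> \<bar>ln (norm (G z)) - H z * (norm z)^2\<bar> \<le> \<epsilon> * (norm z)^2"
    using asymptotics[OF assms(1)] by blast
  show ?thesis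
  proof (intro exI[of _ "R / r"] allI impI)
    fix z :: complex assume z: "norm z \<ge> R / r" "r * norm z \<notin> E"
    have n: "norm (of_real r * z) = r * norm z" using assms by (simp add: norm_mult)
    have a: "G (of_real r * z) \<noteq> 0" "\<bar>ln (norm (G (of_real r * z))) - H z * (r * norm z)^2\<bar> \<le> \<epsilon> * (r * norm z)^2"
      using R[of "of_real r * z"] z assms unfolding n H_ray[OF assms(2)] by (auto simp: field_simps)
    have e: "norm (G (of_real r * z)) = exp (ln (norm (G (of_real r * z))))" using a(1) by simp
    have "ln (norm (G (of_real r * z))) \<le> r^2 * (H z + \<epsilon>) * (norm z)^2"
         "r^2 * (H z - \<epsilon>) * (norm z)^2 \<le> ln (norm (G (of_real r * z)))"
      using a(2) by (auto simp: abs_le_iff power_mult_distrib algebra_simps)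
    then show "G (of_real r * z) \<noteq> 0 \<and>
    norm (G (of_real r * z)) \<le> exp (r^2 * (H z + \<epsilon>) * (norm z)^2) \<and>
    exp (r^2 * (H z - \<epsilon>) * (norm z)^2) \<le> norm (G (of_real r * z))"
      using a(1) e by (metis exp_le_cancel_iff)
  qed
qed

text \<open>Along a ray the logarithms of \<open>|G (s z)|\<close> and \<open>|G (r z)|\<close> differ by about \<open>(s^2 - r^2) H z |z|^2\<close>.
The value \<open>r = 0\<close> stands for the constant function \<open>1\<close>, because \<open>G 0\<close> may vanish.\<close>

lemma dilation_quotient_circles:
  assumes r: "0 \<le> r" "r < s" "s \<le> 1" and \<kappa>: "(s^2 - r^2) * \<Lambda> < \<kappa>"
  defines "A \<equiv> (\<lambda>z. if r = 0 then 1 else G (of_real r * z))"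
  shows "\<exists>\<rho>\<ge>R. \<forall>z. norm z = \<rho> \<longrightarrow> A z \<noteq> 0 \<and> norm (G (of_real s * z)) \<le> norm (A z) * exp (\<kappa> * \<rho>^2)"
proof -
  define \<epsilon> where "\<epsilon> = (\<kappa> - (s^2 - r^2) * \<Lambda>) / 2"
  have \<epsilon>: "\<epsilon> > 0" using \<kappa> by (simp add: \<epsilon>_def)
  have s: "s > 0" using r by simp
  define r' where "r' = (if r = 0 then s else r)"
  have r': "r' > 0" using r s by (auto simp: r'_def)
  obtain R1 where R1: "\<And>z. norm z \<ge> R1 \<Longrightarrow> s * norm z \<notin> E \<Longrightarrow>
    norm (G (of_real s * z)) \<le> exp (s^2 * (H z + \<epsilon>) * (norm z)^2)"
    using dilation_bounds[OF \<epsilon> s] by blast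
  obtain R2 where R2: "\<And>z. norm z \<ge> R2 \<Longrightarrow> r' * norm z \<notin> E \<Longrightarrow> G (of_real r' * z) \<noteq> 0 \<and>
    exp (r'^2 * (H z - \<epsilon>) * (norm z)^2) \<le> norm (G (of_real r' * z))"
    using dilation_bounds[OF \<epsilon> r'] by blast
  obtain R0 where R0: "\<And>R. R \<ge> R0 \<Longrightarrow> \<exists>\<rho>. R \<le> \<rho> \<and> s * \<rho> \<notin> E \<and> r' * \<rho> \<notin> E"
    using zero_relative_measure_avoid[OF E_thin s r', of 1] zero_less_one by meson
  obtain \<rho> where \<rho>: "\<rho> \<ge> max (max R0 R) (max R1 R2)" "s * \<rho> \<notin> E" "r' * \<rho> \<notin> E"
    using R0[OF max.coboundedI1[OF max.cobounded1]] by blast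
  have "A z \<noteq> 0 \<and> norm (G (of_real s * z)) \<le> norm (A z) * exp (\<kappa> * \<rho>^2)" if z: "norm z = \<rho>" for z
  proof -
    have up: "norm (G (of_real s * z)) \<le> exp (s^2 * (H z + \<epsilon>) * \<rho>^2)"
      using R1[of z] \<rho> z by auto
    have lo: "A z \<noteq> 0 \<and> exp (r^2 * (H z - \<epsilon>) * \<rho>^2) \<le> norm (A z)"
      using R2[of z] \<rho> z by (auto simp: A_def r'_def)
    have sq: "s^2 \<le> 1" "r^2 \<le> 1" "r^2 \<le> s^2" using r by (auto simp: power_le_one intro: power_mono)
    have "s^2 * (H z + \<epsilon>) = r^2 * (H z - \<epsilon>) + ((s^2 - r^2) * H z + (s^2 + r^2) * \<epsilon>)"
      by (simp add: algebra_simps)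
    also have "(s^2 - r^2) * H z + (s^2 + r^2) * \<epsilon> \<le> (s^2 - r^2) * \<Lambda> + 2 * \<epsilon>"
      using sq \<epsilon> H_upper[of z] by (intro add_mono mult_left_mono mult_right_mono) auto
    also have "\<dots> = \<kappa>" by (simp add: \<epsilon>_def field_simps)
    finally have "s^2 * (H z + \<epsilon>) * \<rho>^2 \<le> r^2 * (H z - \<epsilon>) * \<rho>^2 + \<kappa> * \<rho>^2"
      using mult_right_mono[of _ _ "\<rho>^2"] by (fastforce simp: distrib_right[symmetric])
    then have "exp (s^2 * (H z + \<epsilon>) * \<rho>^2) \<le> exp (r^2 * (H z - \<epsilon>) * \<rho>^2) * exp (\<kappa> * \<rho>^2)"
      by (simp add: exp_add[symmetric])
    also have "\<dots> \<le> norm (A z) * exp (\<kappa> * \<rho>^2)" using lo by (intro mult_right_mono) auto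
    finally show ?thesis using up lo by auto
  qed
  then show ?thesis using \<rho>(1) by (intro exI[of _ \<rho>]) auto
qed

lemma shrink_margin:
  fixes m b :: real
  assumes "0 \<le> m" "m < b"
  obtains \<eta> where "\<eta> > 0" "m * (1 + \<eta>)^2 \<le> b"
proof -
  define \<eta> where "\<eta> = min 1 ((b - m) / (3 * b))"
  have \<eta>: "\<eta> > 0" "\<eta> \<le> 1" "3 * b * \<eta> \<le> b - m" using assms by (auto simp: \<eta>_def min_def field_simps)
  have "m * (1 + \<eta>)^2 = m + m * (2 * \<eta> + \<eta> * \<eta>)" by (simp add: power2_eq_square algebra_simps)
  also have "\<dots> \<le> m + b * (3 * \<eta>)"
  proof (intro add_left_mono mult_mono)
    have "\<eta> * \<eta> \<le> \<eta> * 1" using \<eta> by (intro mult_left_mono) auto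
    then show "2 * \<eta> + \<eta> * \<eta> \<le> 3 * \<eta>" by simp
  qed (use assms \<eta> in auto)
  also have "\<dots> \<le> b" using \<eta> by (simp add: algebra_simps)
  finally show ?thesis using that \<eta> by blast
qed

context
  fixes F :: "complex \<Rightarrow> complex" and a C :: real
  assumes F_entire: "F holomorphic_on UNIV"
    and FG_bound: "\<And>z. norm (F z * G z) \<le> C * exp (a * (norm z)^2)" and C_nonneg: "C \<ge> 0"
begin

text \<open>On a good circle \<open>|G (r z) / G z|\<close> is about \<open>exp (- (1 - r^2) H z |z|^2)\<close>, and \<open>H \<ge> \<delta>\<close>. So passing
from \<open>F G\<close> to \<open>G (r z) F\<close> does not increase the type: this is where the indicator has to be
positive.\<close>

lemma factor_dilation_circle:
  assumes \<epsilon>: "\<epsilon> > 0" and \<eta>: "\<eta> > 0" and r: "0 \<le> r" "r \<le> 1"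
  defines "A \<equiv> (\<lambda>z. if r = 0 then 1 else G (of_real r * z))"
  shows "\<exists>R0. \<forall>R\<ge>R0. \<exists>\<rho>. R \<le> \<rho> \<and> \<rho> \<le> (1 + \<eta>) * R \<and>
    (\<forall>z. norm z = \<rho> \<longrightarrow> norm (A z * F z) \<le> C * exp ((a + 2 * \<epsilon> - (1 - r^2) * \<delta>) * \<rho>^2))"
proof -
  define r' where "r' = (if r = 0 then 1 else r)"
  have r': "r' > 0" using r by (auto simp: r'_def)
  obtain R1 where R1: "\<And>z. norm z \<ge> R1 \<Longrightarrow> r' * norm z \<notin> E \<Longrightarrow>
    norm (G (of_real r' * z)) \<le> exp (r'^2 * (H z + \<epsilon>) * (norm z)^2)"
    using dilation_bounds[OF \<epsilon> r'] by blast
  obtain R2 where R2: "\<And>z. norm z \<ge> R2 \<Longrightarrow> norm z \<notin> E \<Longrightarrow>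
    exp ((H z - \<epsilon>) * (norm z)^2) \<le> norm (G z)"
    using dilation_bounds[OF \<epsilon>, of 1] by auto
  obtain R0 where R0: "\<And>R. R \<ge> R0 \<Longrightarrow> \<exists>\<rho>. R \<le> \<rho> \<and> \<rho> \<le> (1 + \<eta>) * R \<and> \<rho> \<notin> E \<and> r' * \<rho> \<notin> E"
    using zero_relative_measure_avoid[OF E_thin zero_less_one r' \<eta>] unfolding mult_1 by meson
  have "\<exists>\<rho>. R \<le> \<rho> \<and> \<rho> \<le> (1 + \<eta>) * R \<and>
    (\<forall>z. norm z = \<rho> \<longrightarrow> norm (A z * F z) \<le> C * exp ((a + 2 * \<epsilon> - (1 - r^2) * \<delta>) * \<rho>^2))"
    if R: "R \<ge> max R0 (max R1 R2)" for R
  proof -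
    obtain \<rho> where \<rho>: "R \<le> \<rho>" "\<rho> \<le> (1 + \<eta>) * R" "\<rho> \<notin> E" "r' * \<rho> \<notin> E" using R0[of R] R by auto
    have "norm (A z * F z) \<le> C * exp ((a + 2 * \<epsilon> - (1 - r^2) * \<delta>) * \<rho>^2)" if z: "norm z = \<rho>" for z
    proof -
      have up: "norm (A z) \<le> exp (r^2 * (H z + \<epsilon>) * \<rho>^2)"
        using R1[of z] \<rho> R z by (auto simp: A_def r'_def)
      have lo: "exp ((H z - \<epsilon>) * \<rho>^2) \<le> norm (G z)" using R2[of z] \<rho> R z by auto
      have sq: "r^2 \<le> 1" using r by (auto simp: power_le_one)
      have "norm (F z) * exp ((H z - \<epsilon>) * \<rho>^2) \<le> norm (F z) * norm (G z)" using lo by (intro mult_left_mono) auto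
      also have "\<dots> \<le> C * exp (a * \<rho>^2)" using FG_bound[of z] z by (simp add: norm_mult)
      finally have "norm (F z) \<le> C * exp (a * \<rho>^2) / exp ((H z - \<epsilon>) * \<rho>^2)"
        by (simp add: pos_le_divide_eq)
      also have "\<dots> = C * exp ((a - (H z - \<epsilon>)) * \<rho>^2)"
        by (simp add: exp_diff[symmetric] left_diff_distrib flip: times_divide_eq_right)
      finally have Fb: "norm (F z) \<le> C * exp ((a - (H z - \<epsilon>)) * \<rho>^2)" .
      have "norm (A z * F z) \<le> exp (r^2 * (H z + \<epsilon>) * \<rho>^2) * (C * exp ((a - (H z - \<epsilon>)) * \<rho>^2))"
        unfolding norm_mult using up Fb by (intro mult_mono) auto
      also have "\<dots> = C * exp ((r^2 * (H z + \<epsilon>) + (a - (H z - \<epsilon>))) * \<rho>^2)"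
        by (simp add: exp_add distrib_right)
      also have "\<dots> \<le> C * exp ((a + 2 * \<epsilon> - (1 - r^2) * \<delta>) * \<rho>^2)"
      proof (intro mult_left_mono)
        have "(1 - r^2) * \<delta> \<le> (1 - r^2) * H z" using sq H_lower[of z] by (intro mult_left_mono) auto
        moreover have "r^2 * \<epsilon> \<le> 1 * \<epsilon>" using sq \<epsilon> by (intro mult_right_mono) auto
        ultimately have "r^2 * (H z + \<epsilon>) + (a - (H z - \<epsilon>)) \<le> a + 2 * \<epsilon> - (1 - r^2) * \<delta>"
          by (simp add: algebra_simps)
        then show "exp ((r^2 * (H z + \<epsilon>) + (a - (H z - \<epsilon>))) * \<rho>^2) \<le> exp ((a + 2 * \<epsilon> - (1 - r^2) * \<delta>) * \<rho>^2)"
          by (simp add: mult_right_mono)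
      qed (rule C_nonneg)
      finally show ?thesis .
    qed
    then show ?thesis using \<rho> by blast
  qed
  then show ?thesis by blast
qed

text \<open>The type of \<open>F\<close> is strictly smaller than that of \<open>F G\<close>. A negative type on circles would make
\<open>F\<close> vanish, which is why \<open>a\<close> must be positive.\<close>

lemma factor_growth:
  assumes nz: "\<exists>z. F z \<noteq> 0"
  obtains C' where "C' \<ge> 0" "\<And>z. norm (F z) \<le> C' * exp ((a - \<delta> / 4) * (norm z)^2)" and "a > 0"
proof -
  define c where "c = a - \<delta> / 2"
  have circ: "\<exists>R0. \<forall>R\<ge>R0. \<exists>\<rho>. R \<le> \<rho> \<and> \<rho> \<le> (1 + \<eta>) * R \<and>
    (\<forall>z. norm z = \<rho> \<longrightarrow> norm (F z) \<le> C * exp (c * \<rho>^2))" if "\<eta> > 0" for \<eta>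
    using factor_dilation_circle[of "\<delta> / 4" \<eta> 0] \<delta>_pos that by (simp add: c_def algebra_simps)
  have c0: "c \<ge> 0"
  proof (rule ccontr)
    assume "\<not> c \<ge> 0"
    then have c: "c < 0" by simp
    obtain R0 where R0: "\<And>R. R \<ge> R0 \<Longrightarrow> \<exists>\<rho>. R \<le> \<rho> \<and> (\<forall>z. norm z = \<rho> \<longrightarrow> norm (F z) \<le> C * exp (c * \<rho>^2))"
      using circ[of 1] zero_less_one by meson
    have "F z = 0" for z
    proof (rule entire_zero_if_small_on_circles[OF F_entire])
      fix e R :: real assume e: "e > 0"
      have "((\<lambda>x. C * exp (c * x^2)) \<longlongrightarrow> 0) at_top" using c by real_asymp
      from order_tendstoD(2)[OF this e] obtain X where X: "\<And>x. x \<ge> X \<Longrightarrow> C * exp (c * x^2) < e"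
        by (auto simp: eventually_at_top_linorder)
      obtain \<rho> where "max (max R R0) X \<le> \<rho>" "\<forall>z. norm z = \<rho> \<longrightarrow> norm (F z) \<le> C * exp (c * \<rho>^2)"
        using R0[OF max.coboundedI1[OF max.cobounded2]] by blast
      then show "\<exists>\<rho>\<ge>R. \<forall>z. norm z = \<rho> \<longrightarrow> norm (F z) \<le> e"
        using X[of \<rho>] by (intro exI[of _ \<rho>]) (auto intro: order_trans)
    qed
    then show False using nz by simp
  qed
  have "c < a - \<delta> / 4" using \<delta>_pos by (simp add: c_def)
  then obtain \<eta> where \<eta>: "\<eta> > 0" "c * (1 + \<eta>)^2 \<le> a - \<delta> / 4" using shrink_margin[OF c0] by blast
  obtain R0 where R0: "\<And>R. R \<ge> R0 \<Longrightarrow> \<exists>\<rho>. R \<le> \<rho> \<and> \<rho> \<le> (1 + \<eta>) * R \<and>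
    (\<forall>z. norm z = \<rho> \<longrightarrow> norm (F z) \<le> C * exp (c * \<rho>^2))" using circ[OF \<eta>(1)] by blast
  obtain C' where C': "C' \<ge> 0" "\<And>z. norm (F z) \<le> C' * exp (c * (1 + \<eta>)^2 * (norm z)^2)"
    using gauss_growth_from_circles[OF F_entire c0 C_nonneg \<eta>(1) R0] by blast
  have "norm (F z) \<le> C' * exp ((a - \<delta> / 4) * (norm z)^2)" for z
    using C'(2)[of z] C'(1) \<eta>(2)
    by (elim order_trans) (intro mult_left_mono iffD2[OF exp_le_cancel_iff] mult_right_mono, auto)
  moreover have "a > 0" using c0 \<delta>_pos by (simp add: c_def)
  ultimately show ?thesis using that C'(1) by blast
qed

lemma factor_dilation_growth:
  assumes a: "a \<ge> 0" "a < b" and r: "0 < r" "r \<le> 1"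
  obtains C' where "C' \<ge> 0" "\<And>z. norm (G (of_real r * z) * F z) \<le> C' * exp (b * (norm z)^2)"
proof -
  define \<epsilon> where "\<epsilon> = (b - a) / 4"
  have \<epsilon>: "\<epsilon> > 0" using a by (simp add: \<epsilon>_def)
  have "0 \<le> a + 2 * \<epsilon>" "a + 2 * \<epsilon> < b" using a by (auto simp: \<epsilon>_def field_simps)
  then obtain \<eta> where \<eta>: "\<eta> > 0" "(a + 2 * \<epsilon>) * (1 + \<eta>)^2 \<le> b" using shrink_margin by blast
  have sq: "r^2 \<le> 1" using r by (auto simp: power_le_one)
  obtain R0 where R0: "\<And>R. R \<ge> R0 \<Longrightarrow> \<exists>\<rho>. R \<le> \<rho> \<and> \<rho> \<le> (1 + \<eta>) * R \<and>
    (\<forall>z. norm z = \<rho> \<longrightarrow> norm (G (of_real r * z) * F z) \<le> C * exp ((a + 2 * \<epsilon> - (1 - r^2) * \<delta>) * \<rho>^2))"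
    using factor_dilation_circle[OF \<epsilon> \<eta>(1), of r] r by auto
  have circ: "\<exists>\<rho>. R \<le> \<rho> \<and> \<rho> \<le> (1 + \<eta>) * R \<and>
    (\<forall>z. norm z = \<rho> \<longrightarrow> norm (G (of_real r * z) * F z) \<le> C * exp ((a + 2 * \<epsilon>) * \<rho>^2))" if "R \<ge> R0" for R
  proof -
    have le: "C * exp ((a + 2 * \<epsilon> - (1 - r^2) * \<delta>) * \<rho>^2) \<le> C * exp ((a + 2 * \<epsilon>) * \<rho>^2)" for \<rho>
      using sq \<delta>_pos C_nonneg by (intro mult_left_mono iffD2[OF exp_le_cancel_iff] mult_right_mono) auto
    show ?thesis using R0[OF that] le by (meson order_trans)
  qed
  have hol: "(\<lambda>z. G (of_real r * z) * F z) holomorphic_on UNIV"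
    by (intro holomorphic_intros F_entire holomorphic_on_compose_gen[OF _ G_entire, unfolded o_def]) auto
  have "0 \<le> a + 2 * \<epsilon>" using a \<epsilon> by simp
  then obtain C' where C': "C' \<ge> 0"
    "\<And>z. norm (G (of_real r * z) * F z) \<le> C' * exp ((a + 2 * \<epsilon>) * (1 + \<eta>)^2 * (norm z)^2)"
    using gauss_growth_from_circles[OF hol _ C_nonneg \<eta>(1) circ] by blast
  have "norm (G (of_real r * z) * F z) \<le> C' * exp (b * (norm z)^2)" for z
    using C'(2)[of z] C'(1) \<eta>(2)
    by (elim order_trans) (intro mult_left_mono iffD2[OF exp_le_cancel_iff] mult_right_mono, auto)
  then show ?thesis using that C'(1) by blast
qed

end

end

section \<open>The closed subspace of entire multiples\<close>

lemma fock_space_scale: "f \<in> fock_space \<alpha> \<Longrightarrow> (\<lambda>z. c * f z) \<in> fock_space \<alpha>"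
  by (auto simp: fock_space_def entire_def norm_mult power_mult_distrib mult.assoc
      intro!: holomorphic_intros integrable_mult_right)

lemma fock_space_0: "0 \<in> fock_space \<alpha>"
  by (simp add: fock_space_def entire_def zero_fun_def)

lemma fock_space_add: "f \<in> fock_space 1 \<Longrightarrow> g \<in> fock_space 1 \<Longrightarrow> f + g \<in> fock_space 1"
  using fock_space_diff[of f "\<lambda>z. (-1) * g z"] fock_space_scale[of g 1 "-1"]
  by (simp add: fun_diff_def plus_fun_def)

lemma entire_multiples_fock_subspace: "cfun.subspace (entire_multiples F \<inter> fock_space 1)"
proof (rule cfun.subspaceI)
  have "0 = (0::complex \<Rightarrow> complex) * F" by simp
  moreover have "(0::complex \<Rightarrow> complex) \<in> entire" by (simp add: entire_def zero_fun_def)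
  ultimately show "0 \<in> entire_multiples F \<inter> fock_space 1"
    using fock_space_0 unfolding entire_multiples_def by blast
next
  fix f g assume fg: "f \<in> entire_multiples F \<inter> fock_space 1" "g \<in> entire_multiples F \<inter> fock_space 1"
  then obtain h k where hk: "f = h * F" "g = k * F" "h \<in> entire" "k \<in> entire"
    by (auto simp: entire_multiples_def)
  then have "f + g = (h + k) * F" "h + k \<in> entire"
    by (auto simp: distrib_right entire_def plus_fun_def intro!: holomorphic_intros)
  then show "f + g \<in> entire_multiples F \<inter> fock_space 1"
    using fg fock_space_add unfolding entire_multiples_def by blast
next
  fix c f assume f: "f \<in> entire_multiples F \<inter> fock_space 1"
  then obtain h where h: "f = h * F" "h \<in> entire" by (auto simp: entire_multiples_def)
  then have "(\<lambda>z. c * f z) = (\<lambda>z. c * h z) * F" "(\<lambda>z. c * h z) \<in> entire"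
    by (auto simp: entire_def times_fun_def mult.assoc intro!: holomorphic_intros)
  then show "(\<lambda>z. c * f z) \<in> entire_multiples F \<inter> fock_space 1"
    using f fock_space_scale[of f 1 c] unfolding entire_multiples_def by blast
qed

lemma fock_space_borel: "f \<in> fock_space \<alpha> \<Longrightarrow> f \<in> borel_measurable borel"
  by (intro borel_measurable_continuous_onI entire_continuous fock_space_entire)

lemma fock_norm_pointwise:
  assumes f: "f \<in> fock_space 1"
  shows "norm (f z) \<le> exp (pi / 2) * exp (pi / 2 * (norm z)^2) * fock_norm f"
proof (rule power2_le_imp_le)
  have "(norm (f z))^2 * exp (- pi * (norm z)^2) \<le> exp pi * (fock_norm f)^2"
  proof -
    have I: "(LBINT z. (norm (f z))^2 * exp (- 1 * pi * (norm z)^2)) = pi * (fock_norm f)^2"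
      using fock_norm_sq[of f] by simp
    show ?thesis using fock_pointwise_le[OF f, of z] unfolding I by simp
  qed
  then have "(norm (f z))^2 \<le> exp pi * (fock_norm f)^2 * exp (pi * (norm z)^2)"
    by (simp add: exp_minus field_simps)
  also have "\<dots> = (exp (pi / 2) * exp (pi / 2 * (norm z)^2) * fock_norm f)^2"
    by (simp add: power_mult_distrib flip: exp_double)
  finally show "(norm (f z))^2 \<le> (exp (pi / 2) * exp (pi / 2 * (norm z)^2) * fock_norm f)^2" .
qed (simp add: fock_norm_nonneg)

lemma finite_zeros_cball:
  assumes F: "F holomorphic_on UNIV" and nz: "\<exists>z. F z \<noteq> 0"
  shows "finite {z \<in> cball 0 R. F z = 0}"
proof (cases "F constant_on UNIV")
  case True
  then show ?thesis using nz by (auto simp: constant_on_def)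
next
  case False
  then show ?thesis by (intro holomorphic_compact_finite_zeros[OF F]) auto
qed

lemma zero_free_circle:
  assumes F: "F holomorphic_on UNIV" and nz: "\<exists>z. F z \<noteq> 0"
  obtains \<rho> where "\<rho> > R" "\<And>z. norm z = \<rho> \<Longrightarrow> F z \<noteq> 0"
proof -
  have fin: "finite {z \<in> cball 0 (R + 1). F z = 0}" by (rule finite_zeros_cball[OF F nz])
  have "\<not> {R<..<R+1} \<subseteq> norm ` {z \<in> cball 0 (R + 1). F z = 0}"
  proof
    assume "{R<..<R+1} \<subseteq> norm ` {z \<in> cball 0 (R + 1). F z = 0}"
    from finite_subset[OF this finite_imageI[OF fin]] show False using infinite_Ioo[of R "R + 1"] by simp
  qed
  then obtain \<rho> where \<rho>: "R < \<rho>" "\<rho> < R + 1" "\<rho> \<notin> norm ` {z \<in> cball 0 (R + 1). F z = 0}"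
    unfolding subset_iff greaterThanLessThan_iff by blast
  then have "F z \<noteq> 0" if "norm z = \<rho>" for z using that by auto
  then show ?thesis using that \<rho>(1) by blast
qed

text \<open>On a circle without zeros of \<open>F\<close> the quotient is controlled by the pointwise bound for the Fock
space, and inside by the maximum principle.\<close>

lemma fock_multiples_quotient_bound:
  assumes F: "F holomorphic_on UNIV" and nz: "\<exists>z. F z \<noteq> 0"
  shows "\<exists>K\<ge>0. \<forall>h. h holomorphic_on UNIV \<longrightarrow> h * F \<in> fock_space 1 \<longrightarrow>
     (\<forall>z\<in>cball 0 R. norm (h z) \<le> K * fock_norm (h * F))"
proof -
  obtain \<rho> where \<rho>: "\<rho> > max R 0" "\<And>z. norm z = \<rho> \<Longrightarrow> F z \<noteq> 0" using zero_free_circle[OF F nz] by blast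
  have cF: "continuous_on (sphere 0 \<rho>) (\<lambda>z. norm (F z))"
    by (intro continuous_on_norm holomorphic_on_imp_continuous_on holomorphic_on_subset[OF F]) auto
  have "compact (sphere (0::complex) \<rho>)" "sphere (0::complex) \<rho> \<noteq> {}" using \<rho>(1) by auto
  from continuous_attains_inf[OF this cF] obtain z0 where z0: "z0 \<in> sphere 0 \<rho>"
    "\<And>z. z \<in> sphere 0 \<rho> \<Longrightarrow> norm (F z0) \<le> norm (F z)" by blast
  define \<mu> where "\<mu> = norm (F z0)"
  have \<mu>: "\<mu> > 0" using \<rho>(2)[of z0] z0(1) by (simp add: \<mu>_def)
  define K where "K = exp (pi / 2) * exp (pi / 2 * \<rho>^2) / \<mu>"
  have "norm (h z) \<le> K * fock_norm (h * F)" if h: "h holomorphic_on UNIV" "h * F \<in> fock_space 1" and z: "z \<in> cball 0 R" for h z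
  proof (rule maximum_modulus_disc[OF h(1), of 0 \<rho>])
    show "norm (z - 0) \<le> \<rho>" using z \<rho>(1) by simp
    fix w :: complex assume w: "norm (w - 0) = \<rho>"
    have "norm (h w) * \<mu> \<le> norm (h w) * norm (F w)"
      using z0(2)[of w] w by (intro mult_left_mono) (auto simp: \<mu>_def)
    also have "\<dots> = norm ((h * F) w)" by (simp add: norm_mult)
    also have "\<dots> \<le> exp (pi / 2) * exp (pi / 2 * \<rho>^2) * fock_norm (h * F)"
      using fock_norm_pointwise[OF h(2), of w] w by simp
    finally show "norm (h w) \<le> K * fock_norm (h * F)" using \<mu> by (simp add: K_def field_simps)
  qed
  then show ?thesis using \<mu> by (intro exI[of _ K]) (auto simp: K_def)
qed

text \<open>The quotients converge locally uniformly, so the limit is again a multiple of \<open>F\<close>; Fatou's lemma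
gives convergence in norm.\<close>

lemma fock_multiples_complete:
  assumes F: "F holomorphic_on UNIV" and nz: "\<exists>z. F z \<noteq> 0"
    and h: "\<And>n::nat. h n holomorphic_on UNIV" "\<And>n. h n * F \<in> fock_space 1"
    and Cauchy: "\<And>e. e > 0 \<Longrightarrow> \<exists>N. \<forall>m\<ge>N. \<forall>n\<ge>N. fock_norm (h m * F - h n * F) < e"
  obtains g where "g holomorphic_on UNIV" "g * F \<in> fock_space 1"
    "(\<lambda>n. fock_norm (h n * F - g * F)) \<longlonglongrightarrow> 0"
proof -
  have uC: "uniformly_convergent_on (cball 0 R) h" for R
  proof (rule Cauchy_uniformly_convergent, rule uniformly_Cauchy_onI)
    fix e :: real assume e: "e > 0"
    obtain K where K: "K \<ge> 0" "\<And>h z. h holomorphic_on UNIV \<Longrightarrow> h * F \<in> fock_space 1 \<Longrightarrow> z \<in> cball 0 R \<Longrightarrow>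
        norm (h z) \<le> K * fock_norm (h * F)" using fock_multiples_quotient_bound[OF F nz, of R] by blast
    have "e / (K + 1) > 0" using e K(1) by simp
    from Cauchy[OF this] obtain N where N: "\<And>m n. m \<ge> N \<Longrightarrow> n \<ge> N \<Longrightarrow> fock_norm (h m * F - h n * F) < e / (K + 1)" by blast
    show "\<exists>M. \<forall>x\<in>cball 0 R. \<forall>m\<ge>M. \<forall>n\<ge>M. dist (h m x) (h n x) < e"
    proof (intro exI[of _ N] ballI allI impI)
      fix x :: complex and m n assume x: "x \<in> cball 0 R" and mn: "m \<ge> N" "n \<ge> N"
      have eq: "(h m - h n) * F = h m * F - h n * F" by (simp add: left_diff_distrib)
      have "(h m - h n) holomorphic_on UNIV" using h(1) by (simp add: fun_diff_def holomorphic_on_diff)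
      moreover have "(h m - h n) * F \<in> fock_space 1" unfolding eq by (intro fock_space_diff h(2))
      ultimately have "norm ((h m - h n) x) \<le> K * fock_norm ((h m - h n) * F)" using x by (rule K(2))
      also have "\<dots> \<le> K * (e / (K + 1))" unfolding eq using N[OF mn] K(1) by (intro mult_left_mono) auto
      also have "\<dots> < e" using e K(1) by (simp add: field_simps)
      finally show "dist (h m x) (h n x) < e" by (simp add: dist_norm)
    qed
  qed
  define g where "g z = lim (\<lambda>n. h n z)" for z
  have ug: "uniform_limit (cball 0 R) h g sequentially" for R
    using uC[of R] unfolding uniformly_convergent_uniform_limit_iff g_def[abs_def] .
  have g: "g holomorphic_on UNIV"
  proof (rule holomorphic_uniform_sequence[of UNIV h])
    fix x :: complex
    have "cball x 1 \<subseteq> cball 0 (norm x + 1)"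
    proof
      fix y assume "y \<in> cball x 1"
      then show "y \<in> cball 0 (norm x + 1)"
        using norm_triangle_ineq2[of y x] by (simp add: dist_norm norm_minus_commute)
    qed
    then show "\<exists>d>0. cball x d \<subseteq> UNIV \<and> uniform_limit (cball x d) h g sequentially"
      using uniform_limit_on_subset[OF ug] by (intro exI[of _ 1]) auto
  qed (use h in auto)
  have lim: "(\<lambda>n. h n z) \<longlonglongrightarrow> g z" for z
    using tendsto_uniform_limitI[OF ug[of "norm z"], of z] by simp
  have Fm [measurable]: "F \<in> borel_measurable borel"
    using F by (intro borel_measurable_continuous_onI holomorphic_on_imp_continuous_on)
  have gm [measurable]: "g \<in> borel_measurable borel"
    using g by (intro borel_measurable_continuous_onI holomorphic_on_imp_continuous_on)
  have hm [measurable]: "h n \<in> borel_measurable borel" for n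
    using h(1) by (intro borel_measurable_continuous_onI holomorphic_on_imp_continuous_on)
  define q where "q f z = (norm (f z))^2 * exp (- pi * (norm z)^2)" for f :: "complex \<Rightarrow> complex" and z
  have tail: "integrable lborel (q (h n * F - g * F)) \<and> fock_norm (h n * F - g * F) \<le> e"
    if e: "e > 0" and N: "\<And>m. m \<ge> N \<Longrightarrow> fock_norm (h n * F - h m * F) < e" for n N e
  proof -
    have qm: "q (h n * F - h m * F) \<in> borel_measurable lborel" for m
      unfolding q_def[abs_def] fun_diff_def times_fun_def by measurable
    have qg: "q (h n * F - g * F) \<in> borel_measurable lborel"
      unfolding q_def[abs_def] fun_diff_def times_fun_def by measurable
    have li: "liminf (\<lambda>m. ennreal (q (h n * F - h m * F) z)) = ennreal (q (h n * F - g * F) z)" for z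
    proof (rule lim_imp_Liminf)
      have "(\<lambda>m. q (h n * F - h m * F) z) \<longlonglongrightarrow> q (h n * F - g * F) z"
        unfolding q_def by (simp, intro tendsto_intros lim)
      then show "(\<lambda>m. ennreal (q (h n * F - h m * F) z)) \<longlonglongrightarrow> ennreal (q (h n * F - g * F) z)"
        by (rule tendsto_ennrealI)
    qed simp
    have each: "(\<integral>\<^sup>+z. ennreal (q (h n * F - h m * F) z) \<partial>lborel) \<le> ennreal (pi * e^2)" if "m \<ge> N" for m
    proof -
      have i: "integrable lborel (q (h n * F - h m * F))"
        unfolding q_def[abs_def] by (intro fock_integrable fock_space_diff h(2))
      have "(\<integral>\<^sup>+z. ennreal (q (h n * F - h m * F) z) \<partial>lborel) = ennreal (LBINT z. q (h n * F - h m * F) z)"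
        by (rule nn_integral_eq_integral[OF i]) (simp add: q_def)
      also have "(LBINT z. q (h n * F - h m * F) z) = pi * (fock_norm (h n * F - h m * F))^2"
        unfolding q_def fock_norm_sq ..
      also have "ennreal \<dots> \<le> ennreal (pi * e^2)"
        using N[OF that] by (intro ennreal_leI mult_left_mono power_mono) (auto simp: fock_norm_nonneg)
      finally show ?thesis .
    qed
    have "(\<integral>\<^sup>+z. ennreal (q (h n * F - g * F) z) \<partial>lborel)
        = (\<integral>\<^sup>+z. liminf (\<lambda>m. ennreal (q (h n * F - h m * F) z)) \<partial>lborel)" unfolding li ..
    also have "\<dots> \<le> liminf (\<lambda>m. \<integral>\<^sup>+z. ennreal (q (h n * F - h m * F) z) \<partial>lborel)"
      by (rule nn_integral_liminf) (use qm in simp)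
    also have "\<dots> \<le> ennreal (pi * e^2)"
    proof (rule Liminf_le)
      show "\<forall>\<^sub>F m in sequentially. (\<integral>\<^sup>+z. ennreal (q (h n * F - h m * F) z) \<partial>lborel) \<le> ennreal (pi * e^2)"
        using eventually_ge_at_top[of N] by eventually_elim (rule each)
    qed simp
    finally have le: "(\<integral>\<^sup>+z. ennreal (q (h n * F - g * F) z) \<partial>lborel) \<le> ennreal (pi * e^2)" .
    have i: "integrable lborel (q (h n * F - g * F))"
      by (rule integrableI_bounded[OF qg]) (use le_less_trans[OF le] in \<open>auto simp: q_def\<close>)
    have "pi * (fock_norm (h n * F - g * F))^2 = (LBINT z. q (h n * F - g * F) z)"
      unfolding q_def fock_norm_sq ..
    also have "\<dots> \<le> pi * e^2"
    proof -
      have "ennreal (LBINT z. q (h n * F - g * F) z) \<le> ennreal (pi * e^2)"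
        using le by (subst nn_integral_eq_integral[OF i, symmetric]) (auto simp: q_def)
      then show ?thesis by (subst (asm) ennreal_le_iff) auto
    qed
    finally have "(fock_norm (h n * F - g * F))^2 \<le> e^2" by simp
    then have "fock_norm (h n * F - g * F) \<le> e" using e by (auto intro: power2_le_imp_le)
    with i show ?thesis by blast
  qed
  have ent: "(h n * F - g * F) \<in> entire" for n
    using h(1) g F by (auto simp: entire_def fun_diff_def times_fun_def intro!: holomorphic_intros)
  have mem: "\<exists>N. h N * F - g * F \<in> fock_space 1"
  proof -
    obtain N where N: "\<And>m n. m \<ge> N \<Longrightarrow> n \<ge> N \<Longrightarrow> fock_norm (h m * F - h n * F) < 1"
      using Cauchy[of 1] by auto
    have "integrable lborel (q (h N * F - g * F))" using tail[of 1 N N] N by auto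
    then have "h N * F - g * F \<in> fock_space 1" using ent[of N] by (simp add: fock_space_def q_def[abs_def])
    then show ?thesis ..
  qed
  then obtain N where "h N * F - g * F \<in> fock_space 1" ..
  from fock_space_diff[OF h(2)[of N] this] have gF: "g * F \<in> fock_space 1" by simp
  have "(\<lambda>n. fock_norm (h n * F - g * F)) \<longlonglongrightarrow> 0"
  proof (rule LIMSEQ_I)
    fix e :: real assume e: "e > 0"
    obtain N where N: "\<And>m n. m \<ge> N \<Longrightarrow> n \<ge> N \<Longrightarrow> fock_norm (h m * F - h n * F) < e / 2"
      using Cauchy[of "e / 2"] e by auto
    have "fock_norm (h n * F - g * F) \<le> e / 2" if "n \<ge> N" for n using tail[of "e / 2" N n] N[OF that] e by auto
    then show "\<exists>no. \<forall>n\<ge>no. norm (fock_norm (h n * F - g * F) - 0) < e"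
      using e by (intro exI[of _ N]) (auto simp: fock_norm_nonneg intro: le_less_trans[of _ "e / 2"])
  qed
  then show ?thesis using that g gF by blast
qed

definition fock_inner :: "(complex \<Rightarrow> complex) \<Rightarrow> (complex \<Rightarrow> complex) \<Rightarrow> complex" where
  "fock_inner f g = (LBINT z. f z * cnj (g z) * exp (- pi * (norm z)^2))"

lemma fock_inner_integrable:
  assumes f: "f \<in> fock_space 1" and g: "g \<in> fock_space 1"
  shows "integrable lborel (\<lambda>z. f z * cnj (g z) * exp (- pi * (norm z)^2))"
proof (rule Bochner_Integration.integrable_bound)
  have [measurable]: "f \<in> borel_measurable borel" "g \<in> borel_measurable borel"
    using f g by (auto intro: fock_space_borel)
  show "integrable lborel (\<lambda>z. (norm (f z))^2 * exp (- pi * (norm z)^2) + (norm (g z))^2 * exp (- pi * (norm z)^2))"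
    using f g by (intro Bochner_Integration.integrable_add fock_integrable)
  have "continuous_on UNIV (\<lambda>z. f z * cnj (g z) * complex_of_real (exp (- pi * (norm z)^2)))"
    using f g by (intro continuous_intros entire_continuous fock_space_entire)
  then show "(\<lambda>z. f z * cnj (g z) * complex_of_real (exp (- pi * (norm z)^2))) \<in> borel_measurable lborel"
    using borel_measurable_continuous_onI by simp
  show "AE z in lborel. norm (f z * cnj (g z) * exp (- pi * (norm z)^2)) \<le>
     norm ((norm (f z))^2 * exp (- pi * (norm z)^2) + (norm (g z))^2 * exp (- pi * (norm z)^2))"
  proof (rule AE_I2)
    fix z
    have "norm (f z) * norm (g z) \<le> (norm (f z))^2 + (norm (g z))^2"
      using sum_squares_bound[of "norm (f z)" "norm (g z)"]
        mult_nonneg_nonneg[OF norm_ge_zero[of "f z"] norm_ge_zero[of "g z"]] by linarith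
    from mult_right_mono[OF this, of "exp (- pi * (norm z)^2)"]
    show "norm (f z * cnj (g z) * exp (- pi * (norm z)^2)) \<le>
      norm ((norm (f z))^2 * exp (- pi * (norm z)^2) + (norm (g z))^2 * exp (- pi * (norm z)^2))"
      by (simp add: norm_mult distrib_right norm_exp_eq_Re flip: of_real_power of_real_minus of_real_mult exp_of_real)
  qed
qed

lemma fock_norm_diff_scale:
  assumes f: "f \<in> fock_space 1" and g: "g \<in> fock_space 1"
  shows "pi * (fock_norm (f - (\<lambda>z. c * g z)))^2
     = pi * (fock_norm f)^2 - 2 * Re (cnj c * fock_inner f g) + (norm c)^2 * (pi * (fock_norm g)^2)"
proof -
  let ?e = "\<lambda>z::complex. exp (- pi * (norm z)^2)"
  have fi: "integrable lborel (\<lambda>z. (norm (f z))^2 * ?e z)" and gi: "integrable lborel (\<lambda>z. (norm (g z))^2 * ?e z)"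
    using f g by (simp_all only: fock_integrable)
  have ii: "integrable lborel (\<lambda>z. cnj c * (f z * cnj (g z) * ?e z))"
    using fock_inner_integrable[OF f g] by (intro integrable_mult_right)
  have pt: "(norm ((f - (\<lambda>z. c * g z)) z))^2 * ?e z
     = (norm (f z))^2 * ?e z - 2 * Re (cnj c * (f z * cnj (g z) * ?e z)) + (norm c)^2 * ((norm (g z))^2 * ?e z)" for z
  proof -
    have "(norm (f z - c * g z))^2 = (norm (f z))^2 - 2 * Re (cnj c * (f z * cnj (g z))) + (norm c)^2 * (norm (g z))^2"
      unfolding cmod_power2 by (simp add: power2_eq_square algebra_simps)
    moreover have "Re (cnj c * (f z * cnj (g z) * complex_of_real (?e z))) = Re (cnj c * (f z * cnj (g z))) * ?e z"
      by (simp add: algebra_simps)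
    ultimately show ?thesis unfolding fun_diff_def by (simp only: left_diff_distrib distrib_right mult.assoc)
  qed
  have "pi * (fock_norm (f - (\<lambda>z. c * g z)))^2 = (LBINT z. (norm ((f - (\<lambda>z. c * g z)) z))^2 * ?e z)"
    by (rule fock_norm_sq)
  also have "\<dots> = (LBINT z. (norm (f z))^2 * ?e z - 2 * Re (cnj c * (f z * cnj (g z) * ?e z)) + (norm c)^2 * ((norm (g z))^2 * ?e z))"
    by (intro Bochner_Integration.integral_cong pt refl)
  also have "\<dots> = (LBINT z. (norm (f z))^2 * ?e z) - 2 * Re (LBINT z. cnj c * (f z * cnj (g z) * ?e z))
      + (norm c)^2 * (LBINT z. (norm (g z))^2 * ?e z)"
    using fi gi ii integrable_Re[OF ii]
    by (simp only: Bochner_Integration.integral_add Bochner_Integration.integral_diff integral_mult_right_zero integral_Re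
        Bochner_Integration.integrable_diff integrable_mult_right)
  finally show ?thesis unfolding fock_norm_sq fock_inner_def integral_mult_right_zero .
qed

lemma fock_norm_le_diff:
  assumes "f \<in> fock_space 1" "g \<in> fock_space 1"
  shows "fock_norm f \<le> fock_norm g + fock_norm (f - g)"
  using fock_norm_triangle[OF fock_space_diff[OF assms(1,2)] fock_space_diff[OF fock_space_0 assms(2)]]
    fock_norm_minus_commute[of 0 g] by simp

lemma fock_parallelogram:
  assumes f: "f \<in> fock_space 1" and g: "g \<in> fock_space 1"
  shows "(fock_norm (f - g))^2 + (fock_norm (f + g))^2 = 2 * (fock_norm f)^2 + 2 * (fock_norm g)^2"
proof -
  have e: "f - (\<lambda>z. 1 * g z) = f - g" "f - (\<lambda>z. (-1) * g z) = f + g" by (auto simp: fun_eq_iff)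
  have "pi * ((fock_norm (f - g))^2 + (fock_norm (f + g))^2) = pi * (2 * (fock_norm f)^2 + 2 * (fock_norm g)^2)"
    using fock_norm_diff_scale[OF f g, of 1] fock_norm_diff_scale[OF f g, of "-1"] unfolding e
    by (simp add: algebra_simps)
  then show ?thesis by simp
qed

lemma fock_norm_scale: "fock_norm (\<lambda>z. c * f z) = norm c * fock_norm f"
proof -
  have "pi * (fock_norm (\<lambda>z. c * f z))^2 = (LBINT z. (norm c)^2 * ((norm (f z))^2 * exp (- pi * (norm z)^2)))"
    unfolding fock_norm_sq by (simp add: norm_mult power_mult_distrib mult.assoc)
  also have "\<dots> = (norm c)^2 * (pi * (fock_norm f)^2)"
    unfolding fock_norm_sq by (rule integral_mult_right_zero)
  finally have "(fock_norm (\<lambda>z. c * f z))^2 = (norm c * fock_norm f)^2" by (simp add: power_mult_distrib)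
  then show ?thesis by (simp add: power2_eq_iff_nonneg fock_norm_nonneg)
qed

text \<open>The classical projection argument: by the parallelogram law a minimising sequence is Cauchy, and
minimality of its limit \<open>g * F\<close> forces orthogonality to \<open>S\<close>.\<close>

lemma fock_projection:
  assumes F: "F holomorphic_on UNIV" "\<exists>z. F z \<noteq> 0"
    and S: "cfun.subspace S" "S \<subseteq> entire_multiples F \<inter> fock_space 1"
    and f: "f \<in> entire_multiples F \<inter> fock_space 1"
  obtains g where "g holomorphic_on UNIV" "g * F \<in> fock_space 1"
    "\<And>s. s \<in> S \<Longrightarrow> fock_inner (g * F) s = 0"
    "\<And>e. e > 0 \<Longrightarrow> \<exists>s\<in>S. fock_norm (f - g * F - s) < e"
proof -
  define D where "D = (\<lambda>s. fock_norm (f - s)) ` S"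
  define d where "d = Inf D"
  have S0: "0 \<in> S" using S(1) by (rule cfun.subspace_0)
  have bdd: "bdd_below D" unfolding D_def by (rule bdd_belowI[of _ 0]) (auto simp: fock_norm_nonneg)
  have dle: "d \<le> fock_norm (f - s)" if "s \<in> S" for s
    unfolding d_def by (rule cInf_lower[OF _ bdd]) (use that in \<open>auto simp: D_def\<close>)
  have d0: "d \<ge> 0" unfolding d_def by (rule cInf_greatest) (use S0 in \<open>auto simp: D_def fock_norm_nonneg\<close>)
  have "\<exists>s\<in>S. fock_norm (f - s) < d + 1 / real (Suc n)" for n
  proof -
    have "Inf D < d + 1 / real (Suc n)" by (simp add: d_def)
    moreover have "D \<noteq> {}" using S0 by (auto simp: D_def)
    ultimately obtain x where "x \<in> D" "x < d + 1 / real (Suc n)" using cInf_lessD by blast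
    then show ?thesis by (auto simp: D_def)
  qed
  then obtain s where s: "\<And>n. s n \<in> S" "\<And>n. fock_norm (f - s n) < d + 1 / real (Suc n)" by metis
  have fm: "f - s n \<in> entire_multiples F \<inter> fock_space 1" for n
    using cfun.subspace_diff[OF entire_multiples_fock_subspace f] s(1)[of n] S(2) by blast
  then have "\<exists>h. h holomorphic_on UNIV \<and> f - s n = h * F" for n
    by (force simp: entire_multiples_def entire_def)
  then obtain h where h: "\<And>n. h n holomorphic_on UNIV" "\<And>n. f - s n = h n * F" by metis
  have hF: "h n * F \<in> fock_space 1" for n using fm[of n] h(2)[of n] by simp
  have Fk: "t \<in> fock_space 1" if "t \<in> S" for t using S(2) that by blast
  have near: "(fock_norm (h m * F - h n * F))^2 \<le> 2 * (fock_norm (h m * F))^2 + 2 * (fock_norm (h n * F))^2 - 4 * d^2" for m n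
  proof -
    define t where "t = (\<lambda>z. (1/2) * (s m + s n) z)"
    have t: "t \<in> S" unfolding t_def by (intro cfun.subspace_scale[OF S(1)] cfun.subspace_add[OF S(1)] s)
    have "h m * F + h n * F = (\<lambda>z. 2 * (f - t) z)"
      unfolding h(2)[symmetric] by (auto simp: fun_eq_iff t_def field_simps)
    then have "fock_norm (h m * F + h n * F) = 2 * fock_norm (f - t)" using fock_norm_scale[of 2 "f - t"] by simp
    then have "(fock_norm (h m * F + h n * F))^2 \<ge> 4 * d^2"
      using dle[OF t] d0 by (simp add: power_mult_distrib power_mono)
    then show ?thesis using fock_parallelogram[OF hF[of m] hF[of n]] by linarith
  qed
  have hb: "fock_norm (h n * F) < d + 1 / real (Suc n)" for n using s(2)[of n] h(2)[of n] by simp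
  have Cauchy: "\<exists>N. \<forall>m\<ge>N. \<forall>n\<ge>N. fock_norm (h m * F - h n * F) < e" if e: "e > 0" for e
  proof -
    have "(\<lambda>n. 4 * (d + 1 / real (Suc n))^2 - 4 * d^2) \<longlonglongrightarrow> 4 * (d + 0)^2 - 4 * d^2"
      by (intro tendsto_intros LIMSEQ_Suc[OF lim_1_over_n])
    then have "\<forall>\<^sub>F n in sequentially. 4 * (d + 1 / real (Suc n))^2 - 4 * d^2 < e^2"
      using e by (intro order_tendstoD(2)) auto
    then obtain N where N: "4 * (d + 1 / real (Suc N))^2 - 4 * d^2 < e^2"
      by (auto simp: eventually_sequentially)
    have le: "(fock_norm (h n * F))^2 \<le> (d + 1 / real (Suc N))^2" if "n \<ge> N" for n
    proof (rule power_mono)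
      have "1 / real (Suc n) \<le> 1 / real (Suc N)" using that by (intro divide_left_mono) auto
      then show "fock_norm (h n * F) \<le> d + 1 / real (Suc N)" using hb[of n] by linarith
    qed (rule fock_norm_nonneg)
    have "fock_norm (h m * F - h n * F) < e" if "m \<ge> N" "n \<ge> N" for m n
    proof (rule power_less_imp_less_base)
      show "(fock_norm (h m * F - h n * F))^2 < e^2"
        using near[of m n] le[OF that(1)] le[OF that(2)] N by linarith
    qed (use e in simp)
    then show ?thesis by blast
  qed
  obtain g where g: "g holomorphic_on UNIV" "g * F \<in> fock_space 1"
    "(\<lambda>n. fock_norm (h n * F - g * F)) \<longlonglongrightarrow> 0"
    using fock_multiples_complete[OF F h(1) hF Cauchy] by blast
  have gd: "fock_norm (g * F) \<le> d"
  proof (rule LIMSEQ_le_const)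
    have "(\<lambda>n. d + 1 / real (Suc n) + fock_norm (h n * F - g * F)) \<longlonglongrightarrow> d + 0 + 0"
      by (intro tendsto_intros LIMSEQ_Suc[OF lim_1_over_n] g(3))
    then show "(\<lambda>n. d + 1 / real (Suc n) + fock_norm (h n * F - g * F)) \<longlonglongrightarrow> d" by simp
    have "fock_norm (g * F) \<le> d + 1 / real (Suc n) + fock_norm (h n * F - g * F)" for n
      using fock_norm_le_diff[OF g(2) hF[of n]] hb[of n] fock_norm_minus_commute[of "g * F" "h n * F"] by linarith
    then show "\<exists>N. \<forall>n\<ge>N. fock_norm (g * F) \<le> d + 1 / real (Suc n) + fock_norm (h n * F - g * F)" by blast
  qed
  have dg: "d \<le> fock_norm (g * F - t)" if t: "t \<in> S" for t
  proof (rule LIMSEQ_le_const)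
    have "(\<lambda>n. fock_norm (g * F - t) + fock_norm (h n * F - g * F)) \<longlonglongrightarrow> fock_norm (g * F - t) + 0"
      by (intro tendsto_intros g(3))
    then show "(\<lambda>n. fock_norm (g * F - t) + fock_norm (h n * F - g * F)) \<longlonglongrightarrow> fock_norm (g * F - t)" by simp
    have "d \<le> fock_norm (g * F - t) + fock_norm (h n * F - g * F)" for n
    proof -
      have "s n + t \<in> S" by (intro cfun.subspace_add[OF S(1)] s t)
      from dle[OF this] have "d \<le> fock_norm (h n * F - t)" by (simp add: h(2)[symmetric] diff_diff_eq)
      also have "\<dots> \<le> fock_norm (g * F - t) + fock_norm ((h n * F - t) - (g * F - t))"
        by (intro fock_norm_le_diff fock_space_diff hF g(2) Fk t)
      finally show ?thesis by simp
    qed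
    then show "\<exists>N. \<forall>n\<ge>N. d \<le> fock_norm (g * F - t) + fock_norm (h n * F - g * F)" by blast
  qed
  have orth: "fock_inner (g * F) t = 0" if t: "t \<in> S" for t
  proof (rule ccontr)
    assume ne: "fock_inner (g * F) t \<noteq> 0"
    define p where "p = fock_inner (g * F) t"
    define q where "q = pi * (fock_norm t)^2"
    define x where "x = 1 / (q + 1)"
    have q: "q \<ge> 0" by (simp add: q_def)
    have x: "x > 0" "x * q \<le> 1" using q by (auto simp: x_def field_simps)
    have "(\<lambda>z. (of_real x * p) * t z) \<in> S" by (rule cfun.subspace_scale[OF S(1) t])
    from dg[OF this] gd have "fock_norm (g * F) \<le> fock_norm (g * F - (\<lambda>z. (of_real x * p) * t z))" by linarith
    then have "pi * (fock_norm (g * F))^2 \<le> pi * (fock_norm (g * F - (\<lambda>z. (of_real x * p) * t z)))^2"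
      by (intro mult_left_mono power_mono) (auto simp: fock_norm_nonneg)
    also have "\<dots> = pi * (fock_norm (g * F))^2 - 2 * Re (cnj (of_real x * p) * p) + (norm (of_real x * p))^2 * q"
      unfolding p_def q_def by (rule fock_norm_diff_scale[OF g(2) Fk[OF t]])
    also have "Re (cnj (of_real x * p) * p) = x * (norm p)^2"
      unfolding cmod_power2 by (simp add: power2_eq_square algebra_simps)
    also have "(norm (of_real x * p))^2 * q = x * (norm p)^2 * (x * q)"
      using x by (simp add: norm_mult power_mult_distrib power2_eq_square)
    also have "\<dots> \<le> x * (norm p)^2 * 1" using x by (intro mult_left_mono) auto
    finally have "x * (norm p)^2 \<le> 0" by simp
    then show False using x(1) ne by (simp add: p_def mult_le_0_iff)
  qed
  have appr: "\<exists>t\<in>S. fock_norm (f - g * F - t) < e" if e: "e > 0" for e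
  proof -
    obtain n where n: "fock_norm (h n * F - g * F) < e"
      using order_tendstoD(2)[OF g(3) e] by (auto simp: eventually_sequentially)
    have "f - g * F - s n = (f - s n) - g * F" by (simp add: algebra_simps)
    also have "\<dots> = h n * F - g * F" by (simp only: h(2))
    finally have "f - g * F - s n = h n * F - g * F" .
    then show ?thesis using n s(1)[of n] by metis
  qed
  show ?thesis by (rule that[OF g(1,2) orth appr])
qed

section \<open>Cauchy transforms of an annihilating density\<close>

locale orthogonal_multiple =
  fixes F g :: "complex \<Rightarrow> complex"
  assumes F: "F holomorphic_on UNIV" and F_nz: "\<exists>z. F z \<noteq> 0"
    and g: "g holomorphic_on UNIV" and gF: "g * F \<in> fock_space 1"
    and orth: "\<And>\<mu>. fock_inner (exp_fun \<mu> * F) (g * F) = 0"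
begin

text \<open>The density \<open>u = F cnj f exp (- pi |z|^2)\<close> with \<open>f = g F\<close>. Orthogonality says that \<open>u\<close> integrates
every exponential to zero.\<close>

definition density :: "complex \<Rightarrow> complex" where
  "density z = F z * cnj (g z * F z) * exp (- pi * (norm z)^2)"

text \<open>Some constant with \<open>|f z| \<le> B exp (pi / 2 |z|^2)\<close>.\<close>

definition B :: real where
  "B = (SOME C. C \<ge> 0 \<and> (\<forall>z. norm (g z * F z) \<le> C * exp (pi / 2 * (norm z)^2)))"

lemma B: "B \<ge> 0" "norm (g z * F z) \<le> B * exp (pi / 2 * (norm z)^2)"
proof -
  obtain C where "C \<ge> 0 \<and> (\<forall>z. norm (g z * F z) \<le> C * exp (pi / 2 * (norm z)^2))"
    using fock_pointwise[OF gF] by (metis mult_1 times_fun_apply)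
  then have "B \<ge> 0 \<and> (\<forall>z. norm (g z * F z) \<le> B * exp (pi / 2 * (norm z)^2))"
    unfolding B_def by (rule someI)
  then show "B \<ge> 0" "norm (g z * F z) \<le> B * exp (pi / 2 * (norm z)^2)" by auto
qed

lemma density_continuous: "continuous_on UNIV density"
  unfolding density_def
  using F g by (intro continuous_intros holomorphic_on_imp_continuous_on)

lemma density_borel [measurable]: "density \<in> borel_measurable borel"
  by (intro borel_measurable_continuous_onI density_continuous)

lemma density_bound:
  assumes "norm (A z * F z) \<le> C * exp (c * (norm z)^2)"
  shows "norm (A z * density z) \<le> C * B * exp (- (pi / 2 - c) * (norm z)^2)"
proof -
  have "norm (A z * density z) = norm (A z * F z) * norm (g z * F z) * exp (- pi * (norm z)^2)"
    by (simp add: density_def norm_mult)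
  also have "\<dots> \<le> (C * exp (c * (norm z)^2)) * (B * exp (pi / 2 * (norm z)^2)) * exp (- pi * (norm z)^2)"
    using assms B(2)[of z] order_trans[OF norm_ge_zero assms] by (intro mult_right_mono mult_mono) auto
  also have "\<dots> = C * B * exp (c * (norm z)^2 + pi / 2 * (norm z)^2 + - pi * (norm z)^2)"
    by (simp only: exp_add mult_ac)
  also have "c * (norm z)^2 + pi / 2 * (norm z)^2 + - pi * (norm z)^2 = - (pi / 2 - c) * (norm z)^2"
    by (simp add: field_simps)
  finally show ?thesis .
qed

lemma twisted_density:
  assumes A: "A holomorphic_on UNIV"
    and bd: "\<And>z. norm (A z * F z) \<le> C * exp (c * (norm z)^2)" and c: "c < pi / 2" and C: "C \<ge> 0"
  shows "integrable lborel (\<lambda>z. exp (\<mu> * z) * A z * density z)"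
    and "\<exists>K. \<forall>z. norm (exp (\<mu> * z) * A z * density z) \<le> K"
    and "integrable lborel (\<lambda>z. exp (a * norm z) * norm (A z * density z))"
    and "\<exists>K. \<forall>z. exp (a * norm z) * norm (A z * density z) \<le> K"
proof -
  define \<gamma> where "\<gamma> = pi / 2 - c"
  have \<gamma>: "\<gamma> > 0" using c by (simp add: \<gamma>_def)
  have [measurable]: "A \<in> borel_measurable borel"
    using A by (intro borel_measurable_continuous_onI holomorphic_on_imp_continuous_on)
  have le: "exp (x * norm z) * norm (A z * density z) \<le> C * B * exp (x * norm z - \<gamma> * (norm z)^2)" for z x
  proof -
    have "exp (x * norm z) * norm (A z * density z) \<le> exp (x * norm z) * (C * B * exp (- \<gamma> * (norm z)^2))"
      using density_bound[where A=A, OF bd] unfolding \<gamma>_def by (intro mult_left_mono) auto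
    also have "\<dots> = C * B * exp (x * norm z - \<gamma> * (norm z)^2)"
      by (simp add: exp_diff exp_minus field_simps)
    finally show ?thesis .
  qed
  have gi: "integrable lborel (\<lambda>z::complex. C * B * exp (x * norm z - \<gamma> * (norm z)^2))" for x
    by (intro integrable_mult_right integrable_gauss_linear \<gamma>)
  have gb: "C * B * exp (x * norm z - \<gamma> * (norm z)^2) \<le> C * B * exp (x^2 / (4 * \<gamma>))" for z :: complex and x
  proof (intro mult_left_mono)
    have "0 \<le> (x - 2 * \<gamma> * norm z)^2 / (4 * \<gamma>)" using \<gamma> by simp
    also have "\<dots> = x^2 / (4 * \<gamma>) - (x * norm z - \<gamma> * (norm z)^2)"
      using \<gamma> by (simp add: power2_eq_square field_simps)
    finally show "exp (x * norm z - \<gamma> * (norm z)^2) \<le> exp (x^2 / (4 * \<gamma>))" by simp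
  qed (use B C in auto)
  have tw: "norm (exp (\<mu> * z) * A z * density z) \<le> exp (norm \<mu> * norm z) * norm (A z * density z)" for z
  proof -
    have "norm (exp (\<mu> * z)) \<le> exp (norm \<mu> * norm z)"
      by (metis norm_exp norm_mult)
    from mult_right_mono[OF this, of "norm (A z * density z)"]
    show ?thesis by (simp add: norm_mult mult.assoc)
  qed
  show "integrable lborel (\<lambda>z. exp (\<mu> * z) * A z * density z)"
  proof (rule Bochner_Integration.integrable_bound[OF gi[of "norm \<mu>"]])
    show "AE z in lborel. norm (exp (\<mu> * z) * A z * density z) \<le> norm (C * B * exp (norm \<mu> * norm z - \<gamma> * (norm z)^2))"
    proof (rule AE_I2)
      fix z
      have "norm (exp (\<mu> * z) * A z * density z) \<le> C * B * exp (norm \<mu> * norm z - \<gamma> * (norm z)^2)"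
        using order_trans[OF tw le] .
      then show "norm (exp (\<mu> * z) * A z * density z) \<le> norm (C * B * exp (norm \<mu> * norm z - \<gamma> * (norm z)^2))"
        using B(1) C by simp
    qed
    have "(\<lambda>z. exp (\<mu> * z)) \<in> borel_measurable borel"
      by (intro borel_measurable_continuous_onI continuous_intros)
    then show "(\<lambda>z. exp (\<mu> * z) * A z * density z) \<in> borel_measurable lborel" by simp
  qed
  show "\<exists>K. \<forall>z. norm (exp (\<mu> * z) * A z * density z) \<le> K"
    using order_trans[OF order_trans[OF tw le] gb] by blast
  show "\<exists>K. \<forall>z. exp (a * norm z) * norm (A z * density z) \<le> K"
    using order_trans[OF le gb] by blast
  show "integrable lborel (\<lambda>z. exp (a * norm z) * norm (A z * density z))"
  proof (rule Bochner_Integration.integrable_bound[OF gi[of a]])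
    show "AE z in lborel. norm (exp (a * norm z) * norm (A z * density z)) \<le> norm (C * B * exp (a * norm z - \<gamma> * (norm z)^2))"
      using le[of a] B(1) C by (intro AE_I2) simp
  qed measurable
qed

text \<open>\<open>A\<close> transports if multiplying the density by any \<open>e\<^sub>\<mu> A\<close> just multiplies its Cauchy transform by
\<open>e\<^sub>\<mu> A\<close>. This would follow if \<open>e\<^sub>\<mu> A F\<close> belonged to the closed span of the \<open>e\<^sub>\<lambda> F\<close>; unlike
membership, it can be verified by growth estimates.\<close>

definition transports :: "(complex \<Rightarrow> complex) \<Rightarrow> bool" where
  "transports A \<longleftrightarrow> (\<forall>\<mu> w. cauchy_transform (\<lambda>z. exp (\<mu> * z) * A z * density z) w
     = exp (\<mu> * w) * A w * cauchy_transform density w)"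

text \<open>The left side of the identity for \<open>e\<^sub>\<mu> A\<close> is estimated with a parameter \<open>\<mu>\<close> that depends on \<open>w\<close>.\<close>

lemma transports_decay:
  assumes A: "A holomorphic_on UNIV" "transports A"
    and bd: "\<And>z. norm (A z * F z) \<le> C * exp (c * (norm z)^2)" and c: "c < pi / 2" and C: "C \<ge> 0"
  shows "\<exists>K\<ge>0. \<forall>w. norm (A w * cauchy_transform density w) \<le> K * exp (- (pi / 2 - c) * (norm w)^2)"
proof -
  define \<gamma> where "\<gamma> = pi / 2 - c"
  have \<gamma>: "\<gamma> > 0" using c by (simp add: \<gamma>_def)
  define \<Gamma> where "\<Gamma> = (\<integral>z. exp (- \<gamma> * (norm z)^2) \<partial>(lborel :: complex measure))"
  have \<Gamma>0: "\<Gamma> \<ge> 0" unfolding \<Gamma>_def by (intro integral_nonneg_AE) auto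
  have "norm (A w * cauchy_transform density w) \<le> C * B * (16 + \<Gamma>) * exp (- \<gamma> * (norm w)^2)" for w
  proof -
    \<comment> \<open>With this choice, completing the square turns the Gaussian centred at 0 into one centred at w.\<close>
    define \<mu> where "\<mu> = 2 * of_real \<gamma> * cnj w"
    define u where "u z = exp (\<mu> * z) * A z * density z" for z
    have ui: "integrable lborel u" unfolding u_def by (rule twisted_density(1)[OF A(1) bd c C])
    have ub: "norm (u z) \<le> C * B * exp (\<gamma> * (norm w)^2) * exp (- \<gamma> * (norm (- w + z))^2)" for z
    proof -
      have "norm (u z) = exp (Re (\<mu> * z)) * norm (A z * density z)" by (simp add: u_def norm_mult)
      also have "\<dots> \<le> exp (Re (\<mu> * z)) * (C * B * exp (- \<gamma> * (norm z)^2))"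
        using density_bound[where A=A, OF bd] unfolding \<gamma>_def by (intro mult_left_mono) auto
      also have "\<dots> = C * B * exp (Re (\<mu> * z) + - \<gamma> * (norm z)^2)" by (simp only: exp_add mult_ac)
      also have "Re (\<mu> * z) + - \<gamma> * (norm z)^2 = \<gamma> * (norm w)^2 + - \<gamma> * (norm (- w + z))^2"
        unfolding cmod_power2 \<mu>_def by (simp add: power2_eq_square algebra_simps)
      finally show ?thesis by (simp only: exp_add mult_ac)
    qed
    have gi: "integrable lborel (\<lambda>z. exp (- \<gamma> * (norm (- w + z))^2))"
      using lborel_integral_translation(2)[of "\<lambda>z. exp (- \<gamma> * (norm z)^2)" "- w"] integrable_gauss[OF \<gamma>] by simp
    have ub': "norm (u z) \<le> C * B * exp (\<gamma> * (norm w)^2)" for z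
    proof -
      have "C * B * exp (\<gamma> * (norm w)^2) * exp (- \<gamma> * (norm (- w + z))^2) \<le> C * B * exp (\<gamma> * (norm w)^2) * 1"
        using \<gamma> B(1) C by (intro mult_left_mono) auto
      then show ?thesis using ub[of z] by simp
    qed
    have "(LBINT z. norm (u z)) \<le> (LBINT z. C * B * exp (\<gamma> * (norm w)^2) * exp (- \<gamma> * (norm (- w + z))^2))"
      using ui gi ub by (intro integral_mono) auto
    also have "\<dots> = C * B * exp (\<gamma> * (norm w)^2) * \<Gamma>"
      using lborel_integral_translation(1)[of "\<lambda>z. exp (- \<gamma> * (norm z)^2)" "- w"] by (simp add: \<Gamma>_def)
    finally have ul: "(LBINT z. norm (u z)) \<le> C * B * exp (\<gamma> * (norm w)^2) * \<Gamma>" .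
    have "norm (cauchy_transform u w) \<le> 16 * (C * B * exp (\<gamma> * (norm w)^2)) + (LBINT z. norm (u z))"
      by (rule cauchy_transform_bounded[OF ui ub'])
    also have "\<dots> \<le> C * B * (16 + \<Gamma>) * exp (\<gamma> * (norm w)^2)" using ul by (simp add: algebra_simps)
    finally have cu: "norm (cauchy_transform u w) \<le> C * B * (16 + \<Gamma>) * exp (\<gamma> * (norm w)^2)" .
    have "cauchy_transform u w = exp (\<mu> * w) * A w * cauchy_transform density w"
      using A(2) unfolding transports_def u_def by blast
    then have "norm (A w * cauchy_transform density w) = norm (cauchy_transform u w) * exp (- Re (\<mu> * w))"
      by (simp only: norm_mult norm_exp_eq_Re exp_minus mult_ac exp_not_eq_zero right_inverse mult_1_right
          not_False_eq_True field_class.field_inverse)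
        (simp add: field_simps)
    also have "\<dots> \<le> (C * B * (16 + \<Gamma>) * exp (\<gamma> * (norm w)^2)) * exp (- Re (\<mu> * w))"
      using cu by (intro mult_right_mono) auto
    also have "\<dots> = C * B * (16 + \<Gamma>) * exp (\<gamma> * (norm w)^2 + - Re (\<mu> * w))" by (simp only: exp_add mult_ac)
    also have "\<gamma> * (norm w)^2 + - Re (\<mu> * w) = - \<gamma> * (norm w)^2"
      unfolding cmod_power2 \<mu>_def by (simp add: power2_eq_square algebra_simps)
    finally show ?thesis .
  qed
  then show ?thesis using \<Gamma>0 B(1) C unfolding \<gamma>_def by (intro exI[of _ "C * B * (16 + \<Gamma>)"]) auto
qed

end

context orthogonal_multiple
begin

text \<open>The function \<open>exp (- m w) C\<^sub>h w\<close> with \<open>h = e\<^sub>m\<close> has derivative \<open>\<integral> exp (m (z - w)) u = 0\<close> in \<open>m\<close>, because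
differentiation cancels the kernel; so it equals its value at \<open>m = 0\<close>.\<close>

lemma transports_one:
  assumes bd: "\<And>z. norm (F z) \<le> C * exp (c * (norm z)^2)" and c: "c < pi / 2" and C: "C \<ge> 0"
  shows "transports (\<lambda>_. 1)"
  unfolding transports_def
proof (intro allI)
  fix \<mu> w :: complex
  have bd1: "norm ((\<lambda>_. 1) z * F z) \<le> C * exp (c * (norm z)^2)" for z using bd by simp
  note tw = twisted_density[OF holomorphic_on_const bd1 c C]
  define Q where "Q z m = exp (m * (z - w)) * (density z / (z - w))" for z m :: complex
  define \<psi> where "\<psi> m = (LBINT z. Q z m)" for m
  have zero: "(LBINT z. exp (m * z) * density z) = 0" for m
    using orth[of m] by (simp add: fock_inner_def exp_fun_def density_def mult.assoc)
  have der: "(\<psi> has_field_derivative 0) (at m0)" for m0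
  proof -
    define a where "a = norm m0 + 1"
    obtain K where K: "\<And>z. exp (a * norm z) * norm (density z) \<le> K"
      using tw(4)[of a] by auto
    define u where "u z = complex_of_real (exp (a * norm z) * norm (density z))" for z
    have ui: "integrable lborel u" unfolding u_def using tw(3)[of a] by (intro integrable_of_real) simp
    have ub: "norm (u z) \<le> K" for z using K[of z] by (simp add: u_def norm_mult)
    have D: "integrable lborel (\<lambda>z. exp (a * norm w) * norm (u z / (z - w)))"
      by (intro integrable_mult_right integrable_norm cauchy_kernel_bound(1)[OF ui ub, of 1]) simp
    have "(\<psi> has_field_derivative (LBINT z. deriv (Q z) m0)) (at m0)"
      unfolding \<psi>_def
    proof (rule has_field_derivative_lebesgue_integral[OF _ _ _ D, where r=1])
      show "Q z holomorphic_on ball m0 1" for z unfolding Q_def by (intro holomorphic_intros)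
      fix m assume m: "m \<in> ball m0 1"
      have "continuous_on UNIV (\<lambda>z. exp (m * (z - w)))" by (intro continuous_intros)
      then have [measurable]: "(\<lambda>z. exp (m * (z - w))) \<in> borel_measurable borel"
        by (rule borel_measurable_continuous_onI)
      show "(\<lambda>z. Q z m) \<in> borel_measurable lborel" unfolding Q_def by simp
      fix z
      have ma: "norm m \<le> a" using m norm_triangle_ineq2[of m m0] by (simp add: a_def dist_norm norm_minus_commute)
      have "norm (exp (m * (z - w))) \<le> exp (norm (m * (z - w)))" by (rule norm_exp)
      also have "norm (m * (z - w)) \<le> a * (norm z + norm w)"
        unfolding norm_mult using ma norm_triangle_ineq4[of z w] by (intro mult_mono) (auto simp: a_def)
      finally have "norm (exp (m * (z - w))) \<le> exp (a * norm z) * exp (a * norm w)"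
        by (simp add: exp_add[symmetric] distrib_left)
      from mult_right_mono[OF this, of "norm (density z / (z - w))"]
      show "norm (Q z m) \<le> exp (a * norm w) * norm (u z / (z - w))"
        by (simp add: Q_def u_def norm_mult norm_divide mult_ac)
    qed simp
    also have "(LBINT z. deriv (Q z) m0) = (LBINT z. exp (- m0 * w) * (exp (m0 * z) * density z))"
    proof (rule integral_cong_AE)
      have dq: "deriv (Q z) m0 = (z - w) * exp (m0 * (z - w)) * (density z / (z - w))" for z
        unfolding Q_def by (rule DERIV_imp_deriv) (auto intro!: derivative_eq_intros)
      have ce: "continuous_on UNIV (\<lambda>z. exp (m0 * (z - w)))" "continuous_on UNIV (\<lambda>z. exp (m0 * z))"
        by (intro continuous_intros)+
      note [measurable] = ce[THEN borel_measurable_continuous_onI]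
      show "(\<lambda>z. deriv (Q z) m0) \<in> borel_measurable lborel" unfolding dq by simp
      show "(\<lambda>z. exp (- m0 * w) * (exp (m0 * z) * density z)) \<in> borel_measurable lborel" by simp
      have "AE z in lborel. z \<noteq> w" by (rule AE_lborel_singleton)
      then show "AE z in lborel. deriv (Q z) m0 = exp (- m0 * w) * (exp (m0 * z) * density z)"
      proof eventually_elim
        case (elim z)
        have "exp (m0 * (z - w)) = exp (- m0 * w) * exp (m0 * z)" by (simp add: exp_add[symmetric] algebra_simps)
        then show ?case unfolding dq using elim by simp
      qed
    qed
    also have "\<dots> = 0" by (simp only: integral_mult_right_zero zero mult_zero_right)
    finally show ?thesis .
  qed
  obtain k where k: "\<And>m. \<psi> m = k"
    using has_field_derivative_zero_constant[of UNIV \<psi>] der by auto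
  have "cauchy_transform (\<lambda>z. exp (\<mu> * z) * 1 * density z) w = (LBINT z. exp (\<mu> * w) * Q z \<mu>)"
    unfolding cauchy_transform_def
  proof (intro Bochner_Integration.integral_cong refl)
    fix z
    have "exp (\<mu> * z) = exp (\<mu> * w) * exp (\<mu> * (z - w))" by (simp add: exp_add[symmetric] algebra_simps)
    then show "exp (\<mu> * z) * 1 * density z / (z - w) = exp (\<mu> * w) * Q z \<mu>" by (simp add: Q_def)
  qed
  also have "\<dots> = exp (\<mu> * w) * \<psi> \<mu>" unfolding \<psi>_def by (rule integral_mult_right_zero)
  also have "\<psi> \<mu> = \<psi> 0" using k by simp
  also have "\<psi> 0 = cauchy_transform density w" by (simp add: \<psi>_def Q_def cauchy_transform_def)
  finally show "cauchy_transform (\<lambda>z. exp (\<mu> * z) * 1 * density z) w = exp (\<mu> * w) * 1 * cauchy_transform density w"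
    by simp
qed

text \<open>The difference of the two sides is entire in \<open>w\<close>. On the given circles it tends to zero, because
the decay of \<open>A C\<^sub>1\<close> beats the growth of \<open>e\<^sub>\<mu> A' / A\<close>.\<close>

lemma transports_step:
  assumes A: "A holomorphic_on UNIV" "transports A"
    and bA: "\<And>z. norm (A z * F z) \<le> C * exp (c * (norm z)^2)" "C \<ge> 0"
    and A': "A' holomorphic_on UNIV"
    and bA': "\<And>z. norm (A' z * F z) \<le> C' * exp (c * (norm z)^2)" "C' \<ge> 0"
    and bF: "\<And>z. norm (F z) \<le> C'' * exp (c * (norm z)^2)" "C'' \<ge> 0"
    and c: "c < pi / 2" and \<kappa>: "\<kappa> < pi / 2 - c"
    and circ: "\<And>R. \<exists>\<rho>\<ge>R. \<forall>z. norm z = \<rho> \<longrightarrow> norm (A' z) \<le> norm (A z) * exp (\<kappa> * \<rho>^2)"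
  shows "transports A'"
  unfolding transports_def
proof (intro allI)
  fix \<mu> w0 :: complex
  define h where "h z = exp (\<mu> * z) * A' z" for z
  have h: "h holomorphic_on UNIV" unfolding h_def by (intro holomorphic_intros A')
  define J where "J w = (LBINT z. divided_difference h z w * density z)" for w
  have bF1: "norm ((\<lambda>_. 1) z * F z) \<le> C'' * exp (c * (norm z)^2)" for z using bF by simp
  note tw1 = twisted_density[OF holomorphic_on_const bF1 c bF(2)]
  note twA = twisted_density[OF A' bA'(1) c bA'(2)]
  have ui: "integrable lborel density" using tw1(1)[of 0] by simp
  obtain K1 where ub: "\<And>z. norm (density z) \<le> K1" using tw1(2)[of 0] by auto
  have hi: "integrable lborel (\<lambda>z. h z * density z)" unfolding h_def by (rule twA(1))
  obtain K2 where hb: "\<And>z. norm (h z * density z) \<le> K2" using twA(2)[of \<mu>] unfolding h_def by auto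
  have J: "J w = cauchy_transform (\<lambda>z. h z * density z) w - h w * cauchy_transform density w" for w
    unfolding J_def by (rule divided_difference_transform_eq[OF h ui ub hi hb])
  have Jh: "J holomorphic_on UNIV"
    unfolding J_def by (rule divided_difference_transform_entire[OF h ui hi])
  obtain K where K: "K \<ge> 0" "\<And>w. norm (A w * cauchy_transform density w) \<le> K * exp (- (pi / 2 - c) * (norm w)^2)"
    using transports_decay[OF A bA(1) c bA(2)] by blast
  have "J w0 = 0"
  proof (rule entire_zero_if_small_on_circles[OF Jh])
    fix e R :: real assume e: "e > 0"
    have "(cauchy_transform (\<lambda>z. h z * density z) \<longlongrightarrow> 0) at_infinity"
      by (rule cauchy_transform_tendsto_0[OF hi hb])
    from tendstoD[OF this, of "e / 2"] obtain R1 where R1: "\<And>w. norm w \<ge> R1 \<Longrightarrow> norm (cauchy_transform (\<lambda>z. h z * density z) w) < e / 2"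
      using e by (auto simp: eventually_at_infinity)
    define \<gamma> where "\<gamma> = pi / 2 - c - \<kappa>"
    have \<gamma>: "\<gamma> > 0" using \<kappa> by (simp add: \<gamma>_def)
    have "((\<lambda>x. K * exp (norm \<mu> * x - \<gamma> * x^2)) \<longlongrightarrow> 0) at_top" using \<gamma> by real_asymp
    from order_tendstoD(2)[OF this, of "e / 2"] obtain R2 where R2: "\<And>x. x \<ge> R2 \<Longrightarrow> K * exp (norm \<mu> * x - \<gamma> * x^2) < e / 2"
      using e by (auto simp: eventually_at_top_linorder)
    obtain \<rho> where \<rho>: "\<rho> \<ge> max R (max R1 R2)" "\<And>z. norm z = \<rho> \<Longrightarrow> norm (A' z) \<le> norm (A z) * exp (\<kappa> * \<rho>^2)"
      using circ by blast
    have "norm (J w) \<le> e" if w: "norm w = \<rho>" for w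
    proof -
      have "norm (h w * cauchy_transform density w) = norm (exp (\<mu> * w)) * (norm (A' w) * norm (cauchy_transform density w))"
        by (simp add: h_def norm_mult)
      also have "\<dots> \<le> exp (norm \<mu> * \<rho>) * ((norm (A w) * exp (\<kappa> * \<rho>^2)) * norm (cauchy_transform density w))"
        using \<rho>(2)[OF w] norm_exp[of "\<mu> * w"] w by (intro mult_mono) (auto simp: norm_mult)
      also have "\<dots> = exp (norm \<mu> * \<rho>) * exp (\<kappa> * \<rho>^2) * norm (A w * cauchy_transform density w)"
        by (simp add: norm_mult)
      also have "\<dots> \<le> exp (norm \<mu> * \<rho>) * exp (\<kappa> * \<rho>^2) * (K * exp (- (pi / 2 - c) * \<rho>^2))"
        using K(2)[of w] w by (intro mult_left_mono) auto
      also have "\<dots> = K * exp (norm \<mu> * \<rho> + \<kappa> * \<rho>^2 + - (pi / 2 - c) * \<rho>^2)"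
        by (simp only: exp_add mult_ac)
      also have "norm \<mu> * \<rho> + \<kappa> * \<rho>^2 + - (pi / 2 - c) * \<rho>^2 = norm \<mu> * \<rho> - \<gamma> * \<rho>^2"
        by (simp add: \<gamma>_def algebra_simps)
      also have "K * exp \<dots> < e / 2" using R2[of \<rho>] \<rho>(1) by auto
      finally have "norm (h w * cauchy_transform density w) < e / 2" .
      moreover have "norm (cauchy_transform (\<lambda>z. h z * density z) w) < e / 2" using R1[of w] w \<rho>(1) by auto
      ultimately show ?thesis unfolding J using norm_triangle_ineq4 by (smt (verit) field_sum_of_halves)
    qed
    then show "\<exists>\<rho>\<ge>R. \<forall>z. norm z = \<rho> \<longrightarrow> norm (J z) \<le> e" using \<rho>(1) by (intro exI[of _ \<rho>]) auto
  qed
  then show "cauchy_transform (\<lambda>z. exp (\<mu> * z) * A' z * density z) w0 = exp (\<mu> * w0) * A' w0 * cauchy_transform density w0"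
    unfolding J h_def by simp
qed

text \<open>The dilations \<open>G (r\<^sub>i z)\<close> with \<open>r\<^sub>i^2 = i / N\<close> join \<open>1\<close> to \<open>G\<close>, and consecutive quotients have type
about \<open>\<Lambda> / N\<close>, less than the gain in \<open>transports_decay\<close> when \<open>N\<close> is large. All of them, multiplied
by \<open>F\<close>, obey one common bound of type \<open>c < pi / 2\<close>.\<close>

lemma transports_regular_growth:
  assumes "regular_growth G E H \<delta> \<Lambda>"
    and FG: "\<And>z. norm (F z * G z) \<le> C * exp (a * (norm z)^2)" "C \<ge> 0" and a: "a < pi / 2"
  shows "transports G"
proof -
  interpret regular_growth G E H \<delta> \<Lambda> by fact
  obtain C1 where C1: "C1 \<ge> 0" "\<And>z. norm (F z) \<le> C1 * exp ((a - \<delta> / 4) * (norm z)^2)" and a0: "a > 0"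
    using factor_growth[OF F FG F_nz] by blast
  define c where "c = (a + pi / 2) / 2"
  have c: "a < c" "c < pi / 2" using a by (auto simp: c_def)
  define \<kappa> where "\<kappa> = (pi / 2 - c) / 2"
  have \<kappa>: "0 < \<kappa>" "\<kappa> < pi / 2 - c" using c by (auto simp: \<kappa>_def)
  have L0: "\<Lambda> > 0" using \<delta>_pos H_lower[of 0] H_upper[of 0] by linarith
  obtain N :: nat where N: "N > 0" "\<Lambda> / N < \<kappa>"
  proof -
    obtain N :: nat where "\<Lambda> / \<kappa> < N" using reals_Archimedean2 by blast
    moreover from this have "N > 0" using L0 \<kappa> by (metis divide_pos_pos less_trans of_nat_0_less_iff)
    ultimately show ?thesis using that \<kappa> by (simp add: field_simps)
  qed
  define r where "r i = sqrt (real i / real N)" for i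
  define A where "A i = (\<lambda>z. if i = 0 then 1 else G (of_real (r i) * z))" for i :: nat
  have r: "0 \<le> r i" "i > 0 \<Longrightarrow> r i > 0" "i \<le> N \<Longrightarrow> r i \<le> 1" "(r i)^2 = real i / real N" for i
    using N(1) by (auto simp: r_def)
  have bF: "norm (F z) \<le> C1 * exp (c * (norm z)^2)" for z
  proof -
    have "C1 * exp ((a - \<delta> / 4) * (norm z)^2) \<le> C1 * exp (c * (norm z)^2)"
      using C1(1) c(1) \<delta>_pos by (intro mult_left_mono iffD2[OF exp_le_cancel_iff] mult_right_mono) auto
    then show ?thesis using C1(2)[of z] by linarith
  qed
  have hA: "A i holomorphic_on UNIV" for i
    by (cases "i = 0") (auto simp: A_def intro!: holomorphic_intros holomorphic_on_compose_gen[OF _ G_entire, unfolded o_def])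
  have bA: "\<exists>K\<ge>0. \<forall>z. norm (A i z * F z) \<le> K * exp (c * (norm z)^2)" if i: "i \<le> N" for i
  proof (cases "i = 0")
    case True
    then show ?thesis using bF C1(1) by (auto simp: A_def)
  next
    case False
    then have ri: "0 < r i" "r i \<le> 1" using r i by auto
    have a0': "0 \<le> a" using a0 by simp
    show ?thesis
      by (rule factor_dilation_growth[OF F FG a0' c(1) ri]) (use False in \<open>auto simp: A_def\<close>)
  qed
  have "transports (A i)" if "i \<le> N" for i
    using that
  proof (induction i)
    case 0
    have "A 0 = (\<lambda>_. 1)" by (simp add: A_def)
    then show ?case using transports_one[OF bF c(2) C1(1)] by simp
  next
    case (Suc i)
    obtain K where K: "K \<ge> 0" "\<And>z. norm (A i z * F z) \<le> K * exp (c * (norm z)^2)" using bA[of i] Suc.prems by auto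
    obtain K' where K': "K' \<ge> 0" "\<And>z. norm (A (Suc i) z * F z) \<le> K' * exp (c * (norm z)^2)" using bA[of "Suc i"] Suc.prems by auto
    have ir: "r i < r (Suc i)" using N(1) by (simp add: r_def divide_strict_right_mono)
    have "((r (Suc i))^2 - (r i)^2) * \<Lambda> = \<Lambda> / N" unfolding r(4) using N(1) by (simp add: field_simps)
    then have "((r (Suc i))^2 - (r i)^2) * \<Lambda> < \<kappa>" using N(2) by simp
    from dilation_quotient_circles[OF r(1) ir r(3)[OF Suc.prems] this]
    have circ: "\<exists>\<rho>\<ge>R. \<forall>z. norm z = \<rho> \<longrightarrow> norm (A (Suc i) z) \<le> norm (A i z) * exp (\<kappa> * \<rho>^2)" for R
    proof -
      have "(if r i = 0 then 1 else G (of_real (r i) * z)) = A i z" for z using r(2)[of i] by (cases i) (auto simp: A_def r_def)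
      then show ?thesis
        using dilation_quotient_circles[OF r(1) ir r(3)[OF Suc.prems] \<open>((r (Suc i))^2 - (r i)^2) * \<Lambda> < \<kappa>\<close>, of R]
        by (auto simp: A_def)
    qed
    show ?case
      by (rule transports_step[OF hA _ K(2,1) hA K'(2,1) bF C1(1) c(2) \<kappa>(2) circ]) (use Suc in auto)
  qed
  from this[of N] have "transports (A N)" by simp
  moreover have "A N = G" using N(1) by (auto simp: A_def r_def)
  ultimately show ?thesis by simp
qed

end

lemma entire_product_nonzero:
  assumes "F holomorphic_on UNIV" "\<exists>z. F z \<noteq> 0" "G holomorphic_on UNIV" "\<exists>z. G z \<noteq> 0"
  shows "\<exists>z::complex. F z * G z \<noteq> 0"
proof (rule ccontr)
  assume "\<not> ?thesis"
  then have "cball 0 1 \<subseteq> {z \<in> cball 0 1. F z = 0} \<union> {z \<in> cball 0 1. G z = 0}" by auto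
  from finite_subset[OF this] have "finite (cball (0::complex) 1)"
    using finite_zeros_cball[OF assms(1,2)] finite_zeros_cball[OF assms(3,4)] by blast
  moreover have "infinite (ball (0::complex) 1)" using uncountable_ball[of 1 "0::complex"] countable_finite by force
  ultimately show False using finite_subset[OF ball_subset_cball] by blast
qed

lemma entire_eq_const_if_mult_eq:
  assumes J: "J holomorphic_on UNIV" and P: "P holomorphic_on UNIV" "\<exists>z. P z \<noteq> 0"
    and eq: "\<And>z. J z * P z = c * P z"
  shows "J z = c"
proof -
  have "J z - c = 0"
  proof (rule entire_zero_if_small_on_circles[of "\<lambda>z. J z - c"])
    show "(\<lambda>z. J z - c) holomorphic_on UNIV" using J by (intro holomorphic_intros)
    fix e R :: real assume e: "e > 0"
    obtain \<rho> where \<rho>: "\<rho> > R" "\<And>z. norm z = \<rho> \<Longrightarrow> P z \<noteq> 0" using zero_free_circle[OF P] by blast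
    have "J z = c" if "norm z = \<rho>" for z using eq[of z] \<rho>(2)[OF that] by simp
    then show "\<exists>\<rho>\<ge>R. \<forall>z. norm z = \<rho> \<longrightarrow> norm (J z - c) \<le> e" using e \<rho>(1) by (intro exI[of _ \<rho>]) auto
  qed
  then show ?thesis by simp
qed

text \<open>If \<open>|g|\<close> tends to infinity in all directions, then \<open>1 / g\<close> has a removable singularity at infinity,
so \<open>g\<close> is a polynomial, too small to dominate a Gaussian.\<close>

lemma no_entire_gaussian_growth_everywhere:
  assumes g: "g holomorphic_on UNIV" and \<gamma>: "\<gamma> > 0" and k: "k > 0"
    and low: "\<And>z. norm z \<ge> R \<Longrightarrow> k * exp (\<gamma> * (norm z)^2) \<le> norm (g z)"
  shows False
proof -
  have nt: "filterlim (\<lambda>z::complex. norm z) at_top at_infinity" by (rule filterlim_norm_at_top)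
  have ev: "\<forall>\<^sub>F z::complex in at_infinity. norm z \<ge> R" by (auto simp: eventually_at_infinity)
  have "((\<lambda>x. inverse k * exp (- \<gamma> * x^2)) \<longlongrightarrow> 0) at_top" using \<gamma> by real_asymp
  from filterlim_compose[OF this nt]
  have l0: "((\<lambda>z::complex. inverse k * exp (- \<gamma> * (norm z)^2)) \<longlongrightarrow> 0) at_infinity" .
  have "((inverse \<circ> g) \<longlongrightarrow> 0) at_infinity"
  proof (rule Lim_null_comparison[OF _ l0])
    show "\<forall>\<^sub>F z in at_infinity. norm ((inverse \<circ> g) z) \<le> inverse k * exp (- \<gamma> * (norm z)^2)"
      using ev
    proof eventually_elim
      case (elim z)
      have "inverse (norm (g z)) \<le> inverse (k * exp (\<gamma> * (norm z)^2))"
        using low[OF elim] k by (intro le_imp_inverse_le) auto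
      then show ?case by (simp add: norm_inverse exp_minus inverse_mult_distrib)
    qed
  qed
  from pole_at_infinity[OF g this] obtain a n where poly: "\<And>z. g z = (\<Sum>i\<le>n. a i * z ^ i)" by metis
  have "((\<lambda>x. \<Sum>i\<le>n. norm (a i) * exp (real i * x - \<gamma> * x^2)) \<longlongrightarrow> (\<Sum>i\<le>n. norm (a i) * 0)) at_top"
  proof (intro tendsto_sum tendsto_mult tendsto_const)
    show "((\<lambda>x. exp (real i * x - \<gamma> * x^2)) \<longlongrightarrow> 0) at_top" for i using \<gamma> by real_asymp
  qed
  then have "((\<lambda>x. \<Sum>i\<le>n. norm (a i) * exp (real i * x - \<gamma> * x^2)) \<longlongrightarrow> 0) at_top" by simp
  from order_tendstoD(2)[OF this k] obtain X where X: "\<And>x. x \<ge> X \<Longrightarrow> (\<Sum>i\<le>n. norm (a i) * exp (real i * x - \<gamma> * x^2)) < k"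
    by (auto simp: eventually_at_top_linorder)
  define x where "x = max X (max R 0)"
  have x: "x \<ge> X" "x \<ge> R" "x \<ge> 0" by (auto simp: x_def)
  define z where "z = complex_of_real x"
  have nz: "norm z = x" using x by (simp add: z_def)
  have "k * exp (\<gamma> * x^2) \<le> norm (g z)" using low[of z] nz x by simp
  also have "\<dots> \<le> (\<Sum>i\<le>n. norm (a i) * x ^ i)"
    unfolding poly using norm_sum[of "\<lambda>i. a i * z ^ i" "{..n}"] by (simp add: norm_mult norm_power nz)
  also have "\<dots> \<le> (\<Sum>i\<le>n. norm (a i) * exp (real i * x))"
  proof (intro sum_mono mult_left_mono)
    fix i
    have "x \<le> exp x" using exp_ge_add_one_self[of x] by linarith
    then have "x ^ i \<le> exp x ^ i" using x by (intro power_mono) auto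
    then show "x ^ i \<le> exp (real i * x)" by (simp add: exp_of_nat_mult)
  qed auto
  also have "\<dots> = (\<Sum>i\<le>n. norm (a i) * exp (real i * x - \<gamma> * x^2)) * exp (\<gamma> * x^2)"
    by (simp add: sum_distrib_right exp_diff mult.assoc)
  also have "\<dots> < k * exp (\<gamma> * x^2)" using X[OF x(1)] by (intro mult_strict_right_mono) auto
  finally show False by simp
qed

context orthogonal_multiple
begin

text \<open>The density of the positive measure \<open>\<nu>\<close>, which is \<open>g\<close> times the annihilating density.\<close>

definition mass :: "complex \<Rightarrow> real" where
  "mass z = (norm (g z * F z))^2 * exp (- pi * (norm z)^2)"

lemma mass_density: "g z * density z = complex_of_real (mass z)"
proof -
  have "g z * density z = (g z * F z) * cnj (g z * F z) * complex_of_real (exp (- pi * (norm z)^2))"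
    by (simp add: density_def)
  also have "(g z * F z) * cnj (g z * F z) = complex_of_real ((norm (g z * F z))^2)"
    by (rule complex_norm_square[symmetric])
  finally show ?thesis by (simp add: mass_def)
qed

lemma mass_integrable: "integrable lborel mass"
  using fock_integrable[OF gF] by (simp add: mass_def[abs_def])

lemma mass_nonneg: "mass z \<ge> 0"
  by (simp add: mass_def)

lemma mass_bound: "mass z \<le> B^2"
proof -
  have "mass z \<le> (B * exp (pi / 2 * (norm z)^2))^2 * exp (- pi * (norm z)^2)"
    unfolding mass_def using B(2)[of z] by (intro mult_right_mono power_mono) auto
  also have "\<dots> = B^2 * (exp (pi * (norm z)^2) * exp (- pi * (norm z)^2))"
    by (simp add: power_mult_distrib flip: exp_double)
  also have "\<dots> = B^2" by (simp add: exp_minus)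
  finally show ?thesis .
qed

abbreviation cmass :: "complex \<Rightarrow> complex" where "cmass z \<equiv> complex_of_real (mass z)"

lemma cmass: "integrable lborel cmass" "norm (cmass z) \<le> B^2"
  using mass_integrable mass_bound[of z] mass_nonneg[of z] by (auto intro: integrable_of_real)

text \<open>The weights match exactly: \<open>C\<^sub>g\<close> is bounded, and
\<open>|g C\<^sub>1 F G| = |g F| |G C\<^sub>1| \<le> K |g F| exp (- (1 - \<alpha>) pi / 2 |z|^2)\<close>, whose square is integrable against
\<open>exp (- \<alpha> pi |z|^2)\<close> since \<open>g F\<close> lies in the Fock space. Thus \<open>J F G\<close> lies in the weighted space of
the hypothesis, and \<open>J = C\<^sub>g - g C\<^sub>1\<close> is constant.\<close>

lemma mass_transform_factorizes:
  assumes rg: "regular_growth G E H \<delta> \<Lambda>" and \<alpha>: "\<alpha> < 1"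
    and FG: "F * G \<in> fock_space \<alpha>"
    and unique: "entire_multiples (F * G) \<inter> fock_space \<alpha> \<subseteq> const_multiples (F * G)"
  obtains K \<gamma> where "K > 0" "\<gamma> > 0" "\<And>w. norm (cauchy_transform density w) \<le> K * exp (- \<gamma> * (norm w)^2)"
    "\<And>w. cauchy_transform cmass w = g w * cauchy_transform density w"
proof -
  interpret regular_growth G E H \<delta> \<Lambda> by fact
  define a where "a = \<alpha> * pi / 2"
  have a: "a < pi / 2" using \<alpha> by (simp add: a_def)
  obtain C where C: "C \<ge> 0" "\<And>z. norm (F z * G z) \<le> C * exp (a * (norm z)^2)"
    using fock_pointwise[OF FG] unfolding a_def times_fun_apply by blast
  obtain C1 where C1: "C1 \<ge> 0" "\<And>z. norm (F z) \<le> C1 * exp ((a - \<delta> / 4) * (norm z)^2)" and "a > 0"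
    using factor_growth[OF F C(2,1) F_nz] by blast
  define c where "c = a - \<delta> / 4"
  have c: "c < pi / 2" using a \<delta>_pos by (simp add: c_def)
  note C1' = C1(2)[folded c_def]
  have bF1: "norm ((\<lambda>_. 1) z * F z) \<le> C1 * exp (c * (norm z)^2)" for z using C1' by simp
  have t1: "transports (\<lambda>_. 1)" by (rule transports_one[OF C1' c C1(1)])
  obtain K1 where K1: "K1 \<ge> 0" "\<And>w. norm (1 * cauchy_transform density w) \<le> K1 * exp (- (pi / 2 - c) * (norm w)^2)"
    using transports_decay[OF holomorphic_on_const t1 bF1 c C1(1)] by blast
  note tw1 = twisted_density[OF holomorphic_on_const bF1 c C1(1)]
  have ui: "integrable lborel density" using tw1(1)[of 0] by simp
  obtain Kd where ub: "\<And>z. norm (density z) \<le> Kd" using tw1(2)[of 0] by auto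
  have tG: "transports G" by (rule transports_regular_growth[OF rg C(2,1) a])
  have GF: "norm (G z * F z) \<le> C * exp (a * (norm z)^2)" for z using C(2)[of z] by (simp add: mult.commute)
  obtain K where K: "K \<ge> 0" "\<And>w. norm (G w * cauchy_transform density w) \<le> K * exp (- (pi / 2 - a) * (norm w)^2)"
    using transports_decay[OF G_entire tG GF a C(1)] by blast
  define J where "J w = (LBINT z. divided_difference g z w * density z)" for w
  have hi: "integrable lborel (\<lambda>z. g z * density z)" and hb: "\<And>z. norm (g z * density z) \<le> B^2"
    unfolding mass_density using cmass by auto
  have J: "J w = cauchy_transform cmass w - g w * cauchy_transform density w" for w
    unfolding J_def divided_difference_transform_eq[OF g ui ub hi hb] mass_density ..
  have Jh: "J holomorphic_on UNIV"
    unfolding J_def by (rule divided_difference_transform_entire[OF g ui hi])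
  define M where "M = 16 * B^2 + (LBINT z. norm (cmass z))"
  have M: "norm (cauchy_transform cmass w) \<le> M" for w
    unfolding M_def by (rule cauchy_transform_bounded[OF cmass])
  have FGh: "(F * G) holomorphic_on UNIV" using FG by (simp add: fock_space_def entire_def)
  have JFGm: "J * (F * G) \<in> entire"
    using Jh FGh by (auto simp: entire_def times_fun_def intro!: holomorphic_intros)
  have "J * (F * G) \<in> fock_space \<alpha>"
  proof -
    have fgi: "integrable lborel (\<lambda>z. (norm (F z * G z))^2 * exp (- \<alpha> * pi * (norm z)^2))"
      using FG by (simp add: fock_space_def)
    have dom: "integrable lborel (\<lambda>z. 2 * M^2 * ((norm (F z * G z))^2 * exp (- \<alpha> * pi * (norm z)^2)) + 2 * K^2 * mass z)"
      using fgi mass_integrable by (intro Bochner_Integration.integrable_add integrable_mult_right)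
    have pt: "(norm ((J * (F * G)) z))^2 * exp (- \<alpha> * pi * (norm z)^2)
        \<le> 2 * M^2 * ((norm (F z * G z))^2 * exp (- \<alpha> * pi * (norm z)^2)) + 2 * K^2 * mass z" for z
    proof -
      let ?p = "norm (cauchy_transform cmass z) * norm (F z * G z)"
      let ?q = "norm (g z * F z) * norm (G z * cauchy_transform density z)"
      have "norm ((J * (F * G)) z) = norm (cauchy_transform cmass z * (F z * G z) - (g z * F z) * (G z * cauchy_transform density z))"
        by (simp add: J algebra_simps)
      also have "\<dots> \<le> norm (cauchy_transform cmass z * (F z * G z)) + norm ((g z * F z) * (G z * cauchy_transform density z))"
        by (rule norm_triangle_ineq4)
      also have "\<dots> = ?p + ?q" by (simp only: norm_mult)
      finally have "(norm ((J * (F * G)) z))^2 \<le> (?p + ?q)^2" by (intro power_mono) auto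
      also have "\<dots> \<le> 2 * ?p^2 + 2 * ?q^2"
        using sum_squares_bound[of ?p ?q] by (simp add: power2_sum)
      finally have sq: "(norm ((J * (F * G)) z))^2 \<le> 2 * ?p^2 + 2 * ?q^2" .
      have "(norm ((J * (F * G)) z))^2 * exp (- \<alpha> * pi * (norm z)^2)
         \<le> (2 * ?p^2 + 2 * ?q^2) * exp (- \<alpha> * pi * (norm z)^2)"
        by (rule mult_right_mono[OF sq]) simp
      also have "\<dots> = 2 * (?p^2 * exp (- \<alpha> * pi * (norm z)^2)) + 2 * (?q^2 * exp (- \<alpha> * pi * (norm z)^2))"
        by (simp only: distrib_right mult.assoc)
      also have "?p^2 * exp (- \<alpha> * pi * (norm z)^2) \<le> M^2 * ((norm (F z * G z))^2 * exp (- \<alpha> * pi * (norm z)^2))"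
        unfolding power_mult_distrib mult.assoc using M[of z] by (intro mult_right_mono power_mono) auto
      also have "?q^2 * exp (- \<alpha> * pi * (norm z)^2) \<le> K^2 * mass z"
      proof -
        have "?q^2 * exp (- \<alpha> * pi * (norm z)^2) \<le> ((norm (g z * F z)) * (K * exp (- (pi / 2 - a) * (norm z)^2)))^2 * exp (- \<alpha> * pi * (norm z)^2)"
          using K(2)[of z] by (intro mult_right_mono power_mono mult_left_mono) auto
        also have "\<dots> = K^2 * ((norm (g z * F z))^2 * (exp (2 * (- (pi / 2 - a) * (norm z)^2)) * exp (- \<alpha> * pi * (norm z)^2)))"
          by (simp only: power_mult_distrib exp_double mult_ac)
        also have "exp (2 * (- (pi / 2 - a) * (norm z)^2)) * exp (- \<alpha> * pi * (norm z)^2) = exp (- pi * (norm z)^2)"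
          unfolding exp_add[symmetric] by (simp add: a_def algebra_simps)
        finally show ?thesis by (simp only: mass_def)
      qed
      finally show ?thesis by (simp add: mult.assoc)
    qed
    have cJ: "continuous_on UNIV (J * (F * G))" using JFGm by (rule entire_continuous)
    have "integrable lborel (\<lambda>z. (norm ((J * (F * G)) z))^2 * exp (- \<alpha> * pi * (norm z)^2))"
    proof (rule Bochner_Integration.integrable_bound[OF dom])
      have [measurable]: "(J * (F * G)) \<in> borel_measurable borel" using cJ by (rule borel_measurable_continuous_onI)
      show "(\<lambda>z. (norm ((J * (F * G)) z))^2 * exp (- \<alpha> * pi * (norm z)^2)) \<in> borel_measurable lborel" by measurable
      show "AE z in lborel. norm ((norm ((J * (F * G)) z))^2 * exp (- \<alpha> * pi * (norm z)^2))
         \<le> norm (2 * M^2 * ((norm (F z * G z))^2 * exp (- \<alpha> * pi * (norm z)^2)) + 2 * K^2 * mass z)"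
      proof (rule AE_I2)
        fix z
        show "norm ((norm ((J * (F * G)) z))^2 * exp (- \<alpha> * pi * (norm z)^2))
         \<le> norm (2 * M^2 * ((norm (F z * G z))^2 * exp (- \<alpha> * pi * (norm z)^2)) + 2 * K^2 * mass z)"
          using pt[of z] unfolding real_norm_def by (simp only: abs_of_nonneg mult_nonneg_nonneg zero_le_power2 exp_ge_zero)
      qed
    qed
    then show ?thesis using JFGm by (simp add: fock_space_def)
  qed
  moreover have "J * (F * G) \<in> entire_multiples (F * G)" using Jh by (auto simp: entire_multiples_def entire_def)
  ultimately have "J * (F * G) \<in> const_multiples (F * G)" using unique by blast
  then obtain j where j: "J * (F * G) = (\<lambda>z. j * (F * G) z)" by (auto simp: const_multiples_def)
  have Gnz: "\<exists>z. G z \<noteq> 0"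
  proof -
    obtain R where R: "\<And>z. norm z \<ge> R \<Longrightarrow> norm z \<notin> E \<Longrightarrow> G z \<noteq> 0" using asymptotics[of 1] by auto
    obtain R0 where R0: "\<And>R. R \<ge> R0 \<Longrightarrow> \<exists>\<rho>\<ge>R. \<rho> \<notin> E"
      using zero_relative_measure_avoid[OF E_thin zero_less_one zero_less_one zero_less_one] unfolding mult_1 by meson
    obtain \<rho> where \<rho>: "\<rho> \<ge> max R0 (max R 0)" "\<rho> \<notin> E" using R0[OF max.cobounded1] by blast
    show ?thesis using R[of "complex_of_real \<rho>"] \<rho> by (intro exI[of _ "complex_of_real \<rho>"]) auto
  qed
  have Jj: "J z = j" for z
  proof (rule entire_eq_const_if_mult_eq[OF Jh FGh])
    show "\<exists>z. (F * G) z \<noteq> 0" using entire_product_nonzero[OF F F_nz G_entire Gnz] by simp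
    show "J z * (F * G) z = j * (F * G) z" for z using fun_cong[OF j, of z] by simp
  qed
  define \<gamma> where "\<gamma> = pi / 2 - c"
  have \<gamma>: "\<gamma> > 0" using c by (simp add: \<gamma>_def)
  define L where "L = K1 + 1"
  have L: "L > 0" "norm (cauchy_transform density w) \<le> L * exp (- \<gamma> * (norm w)^2)" for w
  proof -
    show "L > 0" using K1(1) by (simp add: L_def)
    have "K1 * exp (- \<gamma> * (norm w)^2) \<le> L * exp (- \<gamma> * (norm w)^2)" by (intro mult_right_mono) (auto simp: L_def)
    then show "norm (cauchy_transform density w) \<le> L * exp (- \<gamma> * (norm w)^2)"
      using K1(2)[of w, folded \<gamma>_def] unfolding mult_1 by (rule order_trans[rotated])
  qed
  \<comment> \<open>A constant \<open>j \<noteq> 0\<close> would give \<open>|g| \<ge> |j| / (2 |C\<^sub>1|)\<close> near infinity.\<close>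
  have "j = 0"
  proof (rule ccontr)
    assume j0: "j \<noteq> 0"
    have "(cauchy_transform cmass \<longlongrightarrow> 0) at_infinity" by (rule cauchy_transform_tendsto_0[OF cmass])
    from tendstoD[OF this, of "norm j / 2"] obtain R where R: "\<And>w. norm w \<ge> R \<Longrightarrow> norm (cauchy_transform cmass w) < norm j / 2"
      using j0 by (auto simp: eventually_at_infinity)
    have low: "norm j / (2 * L) * exp (\<gamma> * (norm w)^2) \<le> norm (g w)" if w: "norm w \<ge> R" for w
    proof -
      have "norm j \<le> norm (cauchy_transform cmass w) + norm (g w * cauchy_transform density w)"
        using J[of w] Jj[of w] norm_triangle_ineq4 by metis
      then have "norm j / 2 \<le> norm (g w * cauchy_transform density w)" using R[OF w] by linarith
      also have "\<dots> \<le> norm (g w) * (L * exp (- \<gamma> * (norm w)^2))"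
        unfolding norm_mult using L(2) by (intro mult_left_mono) auto
      finally show ?thesis using L(1) by (simp add: exp_minus field_simps)
    qed
    show False
      by (rule no_entire_gaussian_growth_everywhere[OF g \<gamma> _ low]) (use j0 L in auto)
  qed
  then have "cauchy_transform cmass w = g w * cauchy_transform density w" for w using J[of w] Jj[of w] by simp
  then show ?thesis using that[OF L(1) \<gamma> L(2)] by blast
qed

end

section \<open>Circles on which a Cauchy transform is asymptotically flat\<close>

lemma sum_inverse_dyadic_le: "(\<Sum>j<2 ^ p. 1 / max 1 (real j)) \<le> real p + 1"
proof (induction p)
  case (Suc p)
  have un: "{..<2 ^ Suc p} = {..<2 ^ p} \<union> {2 ^ p..<2 ^ Suc p :: nat}" by auto
  have "(\<Sum>j<2 ^ Suc p. 1 / max 1 (real j)) = (\<Sum>j<2 ^ p. 1 / max 1 (real j)) + (\<Sum>j=2 ^ p..<2 ^ Suc p. 1 / max 1 (real j))"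
    unfolding un by (rule sum.union_disjoint) auto
  also have "(\<Sum>j=2 ^ p..<2 ^ Suc p. 1 / max 1 (real j)) \<le> (\<Sum>j=2 ^ p..<2 ^ Suc p::nat. 1 / 2 ^ p)"
  proof (intro sum_mono)
    fix j :: nat assume "j \<in> {2 ^ p..<2 ^ Suc p}"
    then have "real (2 ^ p) \<le> real j" by (simp only: of_nat_le_iff atLeastLessThan_iff)
    then have "2 ^ p \<le> max 1 (real j)" by (simp add: le_max_iff_disj)
    then show "1 / max 1 (real j) \<le> 1 / 2 ^ p" by (intro divide_left_mono) auto
  qed
  also have "\<dots> = 1" by simp
  finally show ?case using Suc by simp
qed simp

text \<open>The grid points on either side of \<open>x\<close> are reindexed by their distance from the one nearest to \<open>x\<close>,
so each side is at most a harmonic sum.\<close>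

lemma sum_inverse_dist_grid_le:
  fixes x :: real
  assumes n: "n = 2 ^ p"
  shows "(\<Sum>i<n. 1 / max 1 \<bar>x - real i\<bar>) \<le> 2 * (real p + 1)"
proof -
  have half: "(\<Sum>i\<in>S. 1 / max 1 \<bar>x - real i\<bar>) \<le> real p + 1"
    if S: "S \<subseteq> {..<n}" and q: "\<And>i. i \<in> S \<Longrightarrow> q i < n \<and> real (q i) \<le> \<bar>x - real i\<bar>" and inj: "inj_on q S" for S q
  proof -
    have "(\<Sum>i\<in>S. 1 / max 1 \<bar>x - real i\<bar>) \<le> (\<Sum>i\<in>S. 1 / max 1 (real (q i)))"
    proof (intro sum_mono divide_left_mono)
      fix i assume "i \<in> S"
      then show "max 1 (real (q i)) \<le> max 1 \<bar>x - real i\<bar>" using q[of i] by (intro max.mono) auto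
    qed auto
    also have "\<dots> = (\<Sum>j\<in>q ` S. 1 / max 1 (real j))" using inj by (simp add: sum.reindex)
    also have "\<dots> \<le> (\<Sum>j<n. 1 / max 1 (real j))" using q by (intro sum_mono2) auto
    also have "\<dots> \<le> real p + 1" unfolding n by (rule sum_inverse_dyadic_le)
    finally show ?thesis .
  qed
  define A where "A = {i. i < n \<and> x < real i}"
  define C where "C = {i. i < n \<and> real i \<le> x}"
  have fin: "finite A" "finite C" by (auto simp: A_def C_def)
  have sA: "(\<Sum>i\<in>A. 1 / max 1 \<bar>x - real i\<bar>) \<le> real p + 1"
  proof (rule half)
    show "A \<subseteq> {..<n}" by (auto simp: A_def)
    have mi: "Min A \<le> i" "Min A \<in> A" if "i \<in> A" for i using that fin by (auto intro: Min_in)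
    show "inj_on (\<lambda>i. i - Min A) A" using mi(1) by (intro inj_onI) (metis le_add_diff_inverse)
    fix i assume i: "i \<in> A"
    have "x < real (Min A)" "Min A \<le> i" "i < n" using mi[OF i] i by (auto simp: A_def)
    then show "i - Min A < n \<and> real (i - Min A) \<le> \<bar>x - real i\<bar>" by (auto simp: of_nat_diff)
  qed
  have sC: "(\<Sum>i\<in>C. 1 / max 1 \<bar>x - real i\<bar>) \<le> real p + 1"
  proof (rule half)
    show "C \<subseteq> {..<n}" by (auto simp: C_def)
    have ma: "i \<le> Max C" "Max C \<in> C" if "i \<in> C" for i using that fin by (auto intro: Max_in)
    show "inj_on (\<lambda>i. Max C - i) C" using ma(1) by (intro inj_onI) (metis diff_diff_cancel)
    fix i assume i: "i \<in> C"
    have "real (Max C) \<le> x" "i \<le> Max C" "Max C < n" using ma[OF i] by (auto simp: C_def)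
    then show "Max C - i < n \<and> real (Max C - i) \<le> \<bar>x - real i\<bar>" by (auto simp: of_nat_diff)
  qed
  have "{..<n} = A \<union> C" "A \<inter> C = {}" by (auto simp: A_def C_def)
  then have "(\<Sum>i<n. 1 / max 1 \<bar>x - real i\<bar>) = (\<Sum>i\<in>A. 1 / max 1 \<bar>x - real i\<bar>) + (\<Sum>i\<in>C. 1 / max 1 \<bar>x - real i\<bar>)"
    using fin by (simp add: sum.union_disjoint)
  also have "\<dots> \<le> (real p + 1) + (real p + 1)" by (rule add_mono[OF sA sC])
  finally show ?thesis by simp
qed

text \<open>Wide enough to contain \<open>r / 2 \<le> |z| < 2 r\<close> for all \<open>r\<close> between \<open>2^k\<close> and \<open>2^(k+1)\<close>.\<close>

definition dyadic_annulus :: "nat \<Rightarrow> complex set" where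
  "dyadic_annulus k = {z. 2 ^ k / 2 \<le> norm z \<and> norm z < 4 * 2 ^ k}"

lemma dyadic_annulus_borel [measurable]: "dyadic_annulus k \<in> sets borel"
  unfolding dyadic_annulus_def by measurable

lemma dyadic_annulus_overlap:
  "(\<Sum>k<K. indicator (dyadic_annulus k) z) \<le> (3::real)"
proof -
  define S where "S = {k. k < K \<and> z \<in> dyadic_annulus k}"
  have "(\<Sum>k<K. indicator (dyadic_annulus k) z) = (\<Sum>k\<in>S. 1::real)"
    unfolding S_def by (intro sum.mono_neutral_cong_right) (auto simp: indicator_def)
  also have "\<dots> = real (card S)" by simp
  also have "card S \<le> 3"
  proof (cases "S = {}")
    case False
    have fin: "finite S" by (simp add: S_def)
    define k where "k = Min S"
    have k: "k \<in> S" using fin False by (simp add: k_def)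
    have "j \<in> {k..<k+3}" if j: "j \<in> S" for j
    proof -
      have "k \<le> j" using fin j by (simp add: k_def)
      moreover have "(2::real) ^ j < 2 ^ (k + 3)"
        using j k unfolding S_def dyadic_annulus_def by (auto simp: power_add)
      then have "j < k + 3" using power_less_imp_less_exp[of "2::real"] by simp
      ultimately show ?thesis by simp
    qed
    then have "card S \<le> card {k..<k+3}" by (intro card_mono) auto
    then show ?thesis by simp
  qed simp
  finally show ?thesis by simp
qed

text \<open>The masses of the annuli have a finite sum while the harmonic series diverges. The factor \<open>k + 1\<close>
gained here compensates a logarithm in \<open>exists_quiet_circle\<close>.\<close>

lemma exists_light_annulus:
  fixes m :: "complex \<Rightarrow> real"
  assumes m: "integrable lborel m" "\<And>z. m z \<ge> 0" and \<eta>: "\<eta> > 0"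
  shows "\<exists>k\<ge>k0. real (k + 1) * (LBINT z. indicator (dyadic_annulus k) z * m z) < \<eta>"
proof (rule ccontr)
  assume neg: "\<not> ?thesis"
  define \<nu> where "\<nu> k = (LBINT z. indicator (dyadic_annulus k) z * m z)" for k
  have [measurable]: "m \<in> borel_measurable borel" using m by simp
  have int: "integrable lborel (\<lambda>z. indicator (dyadic_annulus k) z * m z)" for k
    by (rule Bochner_Integration.integrable_bound[OF m(1)]) (auto simp: indicator_def)
  have nu0: "\<nu> k \<ge> 0" for k unfolding \<nu>_def by (intro integral_nonneg_AE) (auto simp: m(2))
  have "(\<Sum>k<K. \<nu> k) \<le> 3 * (LBINT z. m z)" for K
  proof -
    have "(\<Sum>k<K. \<nu> k) = (LBINT z. (\<Sum>k<K. indicator (dyadic_annulus k) z * m z))"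
      unfolding \<nu>_def by (rule Bochner_Integration.integral_sum[symmetric]) (rule int)
    also have "\<dots> \<le> (LBINT z. 3 * m z)"
    proof (rule integral_mono)
      show "(\<Sum>k<K. indicator (dyadic_annulus k) z * m z) \<le> 3 * m z" for z
        unfolding sum_distrib_right[symmetric] by (intro mult_right_mono dyadic_annulus_overlap m(2))
      show "integrable lborel (\<lambda>z. \<Sum>k<K. indicator (dyadic_annulus k) z * m z)"
        by (rule Bochner_Integration.integrable_sum) (rule int)
      show "integrable lborel (\<lambda>z. 3 * m z)" using m by simp
    qed
    finally show ?thesis by simp
  qed
  then have "summable \<nu>" using nu0 by (intro summableI_nonneg_bounded)
  then have "summable (\<lambda>k. \<nu> k / \<eta>)" by (rule summable_divide)
  then have "summable (\<lambda>k. inverse (real k + 1))"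
  proof (rule summable_comparison_test_ev[rotated])
    show "\<forall>\<^sub>F k in sequentially. norm (inverse (real k + 1)) \<le> \<nu> k / \<eta>"
      using eventually_ge_at_top[of k0]
    proof eventually_elim
      case (elim k)
      then have "real (k + 1) * \<nu> k \<ge> \<eta>" using neg unfolding \<nu>_def by (auto simp: not_less)
      then show ?case using \<eta> by (simp add: field_simps)
    qed
  qed
  then have "summable (\<lambda>k. inverse (real (Suc k)))" by (simp add: add.commute)
  then have "summable (\<lambda>k. inverse (real k))" by (subst (asm) summable_Suc_iff)
  then show False using not_summable_harmonic[where 'a=real] by simp
qed

text \<open>Points with \<open>|z| < r / 2\<close> or \<open>|z| \<ge> 2 r\<close> contribute little for every large \<open>r\<close>. For the rest, the
kernel is at most \<open>1 / max \<sigma> ||z| - r|\<close> outside the disc of radius \<open>\<sigma>\<close> about \<open>w\<close>, a bound that is the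
same for all \<open>w\<close> on the circle. Averaging it over \<open>8^k\<close> radii in \<open>[2^k, 2^(k+1))\<close> with spacing
\<open>\<sigma> = 4^-k\<close> costs a factor of order \<open>k + 1\<close>, which a light annulus absorbs; some radius does at
least as well as the average. The spacing is so small that the disc about \<open>w\<close> contributes only
\<open>64 b / 2^k\<close>.\<close>

lemma exists_quiet_circle:
  fixes m :: "complex \<Rightarrow> real"
  assumes m: "integrable lborel m" "\<And>z. m z \<ge> 0" "\<And>z. m z \<le> b" and \<eta>: "\<eta> > 0"
  shows "\<exists>r\<ge>X. r > 0 \<and> (\<forall>w. norm w = r \<longrightarrow> (LBINT z. norm z / norm (z - w) * m z) \<le> \<eta>)"
proof -
  have [measurable]: "m \<in> borel_measurable borel" using m by simp
  have b0: "b \<ge> 0" using m(2)[of 0] m(3)[of 0] by linarith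
  define a where "a R = (LBINT z. (indicator {z. norm z < R} z * (2 * norm z / R)) * m z)" for R
  define c where "c R = (LBINT z. indicator {z. norm z \<ge> R} z * m z)" for R
  have la: "(a \<longlongrightarrow> 0) at_top"
    unfolding a_def
  proof (rule integral_vanishing_weight[OF m(1), where K=2])
    show "\<bar>indicator {z. norm z < R} z * (2 * norm z / R)\<bar> \<le> 2" if "R > 0" for R and z :: complex
      using that by (auto simp: indicator_def field_simps)
    show "((\<lambda>R. indicator {z. norm z < R} z * (2 * norm z / R)) \<longlongrightarrow> 0) at_top" for z :: complex
    proof (rule Lim_null_comparison)
      show "\<forall>\<^sub>F R in at_top. norm (indicator {z. norm z < R} z * (2 * norm z / R)) \<le> 2 * norm z / R"
        using eventually_gt_at_top[of 0] by eventually_elim (auto simp: indicator_def)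
      show "((\<lambda>R. 2 * norm z / R) \<longlongrightarrow> 0) at_top" by real_asymp
    qed
  qed measurable
  have lc: "(c \<longlongrightarrow> 0) at_top" unfolding c_def by (rule integral_tail_tendsto_0[OF m(1)])
  have two: "filterlim (\<lambda>k::nat. (2::real) ^ k) at_top sequentially" by real_asymp
  have la': "(\<lambda>k. a (2 ^ k)) \<longlonglongrightarrow> 0" by (rule filterlim_compose[OF la two])
  have lc': "(\<lambda>k. c (2 * 2 ^ k)) \<longlonglongrightarrow> 0"
    by (rule filterlim_compose[OF lc]) real_asymp
  have lb': "(\<lambda>k. 64 * b / 2 ^ k) \<longlonglongrightarrow> 0" by real_asymp
  have "\<forall>\<^sub>F k in sequentially. a (2 ^ k) < \<eta> / 8 \<and> c (2 * 2 ^ k) < \<eta> / 16 \<and> 64 * b / 2 ^ k < \<eta> / 8 \<and> X \<le> 2 ^ k"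
    using \<eta> order_tendstoD(2)[OF la', of "\<eta> / 8"] order_tendstoD(2)[OF lc', of "\<eta> / 16"]
       order_tendstoD(2)[OF lb', of "\<eta> / 8"] two[unfolded filterlim_at_top] by (auto intro!: eventually_conj)
  then obtain k0 where k0: "\<And>k. k \<ge> k0 \<Longrightarrow> a (2 ^ k) < \<eta> / 8 \<and> c (2 * 2 ^ k) < \<eta> / 16 \<and> 64 * b / 2 ^ k < \<eta> / 8 \<and> X \<le> 2 ^ k"
    by (auto simp: eventually_sequentially)
  define \<nu> where "\<nu> k = (LBINT z. indicator (dyadic_annulus k) z * m z)" for k
  obtain k where k: "k \<ge> k0" "real (k + 1) * \<nu> k < \<eta> / 64"
    using exists_light_annulus[OF m(1,2), of "\<eta> / 64" k0] \<eta> unfolding \<nu>_def by auto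
  define R where "R = (2::real) ^ k"
  define \<sigma> where "\<sigma> = 1 / (4::real) ^ k"
  define n where "n = (8::nat) ^ k"
  have pos: "R > 0" "\<sigma> > 0" "n > 0" "R \<ge> 1" by (auto simp: R_def \<sigma>_def n_def)
  have n2: "n = 2 ^ (3 * k)" by (simp add: n_def power_mult)
  have n\<sigma>: "real n * \<sigma> = R"
  proof -
    have "real n = 2 ^ k * 4 ^ k" unfolding n_def by (simp flip: power_mult_distrib)
    then show ?thesis by (simp add: \<sigma>_def R_def)
  qed
  define r where "r i = R + real i * \<sigma>" for i
  have r: "R \<le> r i" "i < n \<Longrightarrow> r i < 2 * R" for i
  proof -
    show "R \<le> r i" using pos by (simp add: r_def)
    assume "i < n"
    then have "real i * \<sigma> < real n * \<sigma>" using pos by (intro mult_strict_right_mono) auto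
    then show "r i < 2 * R" unfolding n\<sigma> by (simp add: r_def)
  qed
  define q where "q i z = 1 / max \<sigma> \<bar>norm z - r i\<bar>" for i and z :: complex
  have [measurable]: "q i \<in> borel_measurable borel" for i unfolding q_def by measurable
  have q0: "0 \<le> q i z" "q i z \<le> 1 / \<sigma>" for i z
    using pos by (auto simp: q_def intro!: divide_left_mono)
  define \<Phi> where "\<Phi> i = (LBINT z. q i z * (indicator (dyadic_annulus k) z * m z))" for i
  have annint: "integrable lborel (\<lambda>z. indicator (dyadic_annulus k) z * m z)"
    by (rule Bochner_Integration.integrable_bound[OF m(1)]) (auto simp: indicator_def)
  have \<Phi>int: "integrable lborel (\<lambda>z. q i z * (indicator (dyadic_annulus k) z * m z))" for i
  proof (rule Bochner_Integration.integrable_bound)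
    show "integrable lborel (\<lambda>z. 1 / \<sigma> * (indicator (dyadic_annulus k) z * m z))" using annint by (rule integrable_mult_right)
    show "AE z in lborel. norm (q i z * (indicator (dyadic_annulus k) z * m z)) \<le> norm (1 / \<sigma> * (indicator (dyadic_annulus k) z * m z))"
      using q0 m(2) pos by (intro AE_I2) (auto simp: abs_mult intro!: mult_right_mono simp del: times_divide_eq_left)
  qed measurable
  have qsum: "(\<Sum>i<n. q i z) \<le> 6 * real (k + 1) / \<sigma>" for z
  proof -
    have "q i z = 1 / \<sigma> * (1 / max 1 \<bar>(norm z - R) / \<sigma> - real i\<bar>)" for i
    proof -
      have "max \<sigma> \<bar>norm z - r i\<bar> = \<sigma> * max 1 (\<bar>norm z - r i\<bar> / \<sigma>)"
        using pos by (auto simp: max_def field_simps)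
      also have "\<bar>norm z - r i\<bar> / \<sigma> = \<bar>(norm z - r i) / \<sigma>\<bar>" using pos by (simp add: abs_divide)
      also have "(norm z - r i) / \<sigma> = (norm z - R) / \<sigma> - real i" using pos by (simp add: r_def field_simps)
      finally show ?thesis by (simp add: q_def)
    qed
    then have "(\<Sum>i<n. q i z) = 1 / \<sigma> * (\<Sum>i<n. 1 / max 1 \<bar>(norm z - R) / \<sigma> - real i\<bar>)"
      by (simp only: sum_distrib_left)
    also have "\<dots> \<le> 1 / \<sigma> * (2 * (real (3 * k) + 1))"
      using pos by (intro mult_left_mono sum_inverse_dist_grid_le[OF n2]) auto
    also have "\<dots> \<le> 1 / \<sigma> * (6 * real (k + 1))" using pos by (intro mult_left_mono) auto
    finally show ?thesis by simp
  qed
  have "(\<Sum>i<n. \<Phi> i) = (LBINT z. (\<Sum>i<n. q i z * (indicator (dyadic_annulus k) z * m z)))"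
    unfolding \<Phi>_def by (rule Bochner_Integration.integral_sum[symmetric]) (rule \<Phi>int)
  also have "\<dots> \<le> (LBINT z. 6 * real (k + 1) / \<sigma> * (indicator (dyadic_annulus k) z * m z))"
  proof (rule integral_mono)
    show "(\<Sum>i<n. q i z * (indicator (dyadic_annulus k) z * m z)) \<le> 6 * real (k + 1) / \<sigma> * (indicator (dyadic_annulus k) z * m z)" for z
      unfolding sum_distrib_right[symmetric] by (intro mult_right_mono qsum) (auto simp: m(2))
  qed (use \<Phi>int annint in auto)
  also have "\<dots> = 6 * real (k + 1) / \<sigma> * \<nu> k" unfolding \<nu>_def by (rule integral_mult_right_zero)
  finally have sum\<Phi>: "(\<Sum>i<n. \<Phi> i) \<le> 6 * real (k + 1) / \<sigma> * \<nu> k" .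
  have "\<exists>i<n. \<Phi> i \<le> 6 * real (k + 1) * \<nu> k / R"
  proof (rule ccontr)
    assume "\<not> ?thesis"
    then have gt: "6 * real (k + 1) * \<nu> k / R < \<Phi> i" if "i < n" for i using that by (auto simp: not_le)
    have "(\<Sum>i<n. 6 * real (k + 1) * \<nu> k / R) < (\<Sum>i<n. \<Phi> i)"
      using gt pos by (intro sum_strict_mono) auto
    moreover have "(\<Sum>i<n. 6 * real (k + 1) * \<nu> k / R) = real n * (6 * real (k + 1) * \<nu> k / R)" by simp
    moreover have "real n * (6 * real (k + 1) * \<nu> k / R) = 6 * real (k + 1) / \<sigma> * \<nu> k"
      unfolding n\<sigma>[symmetric] using pos by (simp add: field_simps)
    ultimately show False using sum\<Phi> by linarith
  qed
  then obtain i where i: "i < n" "\<Phi> i \<le> 6 * real (k + 1) * \<nu> k / R" by blast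
  have main: "(LBINT z. norm z / norm (z - w) * m z) \<le> \<eta>" if w: "norm w = r i" for w
  proof -
    define N where "N z = (indicator {z. norm z < R} z * (2 * norm z / R)) * m z
       + 2 * (indicator {z. norm z \<ge> 2 * R} z * m z) + 4 * R * (q i z * (indicator (dyadic_annulus k) z * m z))" for z
    have i1: "integrable lborel (\<lambda>z. (indicator {z. norm z < R} z * (2 * norm z / R)) * m z)"
    proof (rule Bochner_Integration.integrable_bound)
      show "integrable lborel (\<lambda>z. 2 * m z)" using m by simp
      have "\<bar>indicator {z. norm z < R} z * (2 * norm z / R)\<bar> \<le> 2" for z :: complex
        using pos by (auto simp: indicator_def field_simps)
      from mult_right_mono[OF this m(2)]
      show "AE z in lborel. norm ((indicator {z. norm z < R} z * (2 * norm z / R)) * m z) \<le> norm (2 * m z)"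
        using m(2) by (intro AE_I2) (simp only: real_norm_def abs_mult abs_of_nonneg[OF m(2)] abs_numeral)
    qed measurable
    have i2: "integrable lborel (\<lambda>z. indicator {z. norm z \<ge> 2 * R} z * m z)"
      by (rule Bochner_Integration.integrable_bound[OF m(1)]) (auto simp: indicator_def)
    have Nint: "integrable lborel N"
      unfolding N_def using i1 i2 \<Phi>int[of i] by (intro Bochner_Integration.integrable_add integrable_mult_right)
    have Nm: "N \<in> borel_measurable borel" using Nint by simp
    have N0: "N z \<ge> 0" for z unfolding N_def using m(2)[of z] pos q0[of i z] by (auto intro!: add_nonneg_nonneg mult_nonneg_nonneg)
    have NI: "(LBINT z. N z) \<le> 3 * \<eta> / 4"
    proof -
      have "(LBINT z. N z) = a R + 2 * c (2 * R) + 4 * R * \<Phi> i"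
        unfolding N_def a_def c_def \<Phi>_def using i1 i2 \<Phi>int[of i]
        by (simp only: Bochner_Integration.integral_add Bochner_Integration.integrable_add integrable_mult_right integral_mult_right_zero)
      moreover have "4 * R * \<Phi> i \<le> 4 * R * (6 * real (k + 1) * \<nu> k / R)" using i(2) pos by (intro mult_left_mono) auto
      moreover have "4 * R * (6 * real (k + 1) * \<nu> k / R) = 24 * (real (k + 1) * \<nu> k)" using pos by simp
      ultimately show ?thesis using k0[OF k(1)] k(2) \<eta> unfolding R_def by linarith
    qed
    have pt: "ennreal (norm z / norm (z - w) * m z) \<le>
        ennreal (N z) + ennreal (4 * R * b) * (ennreal (1 / norm (z - w)) * indicator (ball w \<sigma>) z)" for z
    proof (cases "norm z < r i / 2")
      case True
      then have "norm (z - w) \<ge> r i / 2" using w norm_triangle_ineq3[of z w] by linarith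
      then have "norm z / norm (z - w) \<le> norm z / (r i / 2)"
        using r(1)[of i] pos by (intro divide_left_mono mult_pos_pos) auto
      also have "\<dots> \<le> norm z / (R / 2)" using r(1)[of i] pos by (intro divide_left_mono) auto
      also have "\<dots> = 2 * norm z / R" by simp
      finally have "norm z / norm (z - w) * m z \<le> 2 * norm z / R * m z" by (rule mult_right_mono[OF _ m(2)])
      moreover have "norm z < R" using True r(2)[OF i(1)] by linarith
      then have "2 * norm z / R * m z \<le> N z" unfolding N_def using m(2)[of z] pos q0[of i z] by (auto intro!: add_nonneg_nonneg mult_nonneg_nonneg)
      ultimately have "ennreal (norm z / norm (z - w) * m z) \<le> ennreal (N z)" by (intro ennreal_leI) linarith
      then show ?thesis by (rule order_trans) simp
    next
      case ge: False
      show ?thesis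
      proof (cases "norm z \<ge> 2 * r i")
        case True
        then have "norm (z - w) \<ge> norm z / 2" "norm z > 0" using w norm_triangle_ineq2[of z w] r(1)[of i] pos by linarith+
        then have "norm z / norm (z - w) \<le> 2" by (simp add: divide_le_eq)
        then have "norm z / norm (z - w) * m z \<le> 2 * m z" using m(2) by (intro mult_right_mono) auto
        moreover have "norm z \<ge> 2 * R" using True r(1)[of i] by linarith
        then have "2 * m z \<le> N z" unfolding N_def using m(2)[of z] pos q0[of i z] by (auto intro!: add_nonneg_nonneg mult_nonneg_nonneg)
        ultimately have "ennreal (norm z / norm (z - w) * m z) \<le> ennreal (N z)" by (intro ennreal_leI) linarith
        then show ?thesis by (rule order_trans) simp
      next
        case False
        then have z4: "norm z \<le> 4 * R" "norm z < 4 * R" using r(2)[OF i(1)] by linarith+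
        show ?thesis
        proof (cases "z \<in> ball w \<sigma>")
          case True
          have "norm z * m z \<le> 4 * R * b" using z4 m(2,3) pos by (intro mult_mono) auto
          then have "norm z * m z / norm (z - w) \<le> 4 * R * b / norm (z - w)" by (rule divide_right_mono) simp
          then have "ennreal (norm z / norm (z - w) * m z) \<le> ennreal (4 * R * b * (1 / norm (z - w)))"
            by (intro ennreal_leI) simp
          also have "\<dots> = ennreal (4 * R * b) * (ennreal (1 / norm (z - w)) * indicator (ball w \<sigma>) z)"
            using True pos b0 ennreal_mult'[of "4 * R * b" "1 / norm (z - w)"] by simp
          finally show ?thesis by (rule order_trans) simp
        next
          case False
          then have "norm (z - w) \<ge> \<sigma>" by (simp add: dist_norm norm_minus_commute)
          moreover have "norm (z - w) \<ge> \<bar>norm z - r i\<bar>" using norm_triangle_ineq3[of z w] w by simp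
          ultimately have "norm (z - w) \<ge> max \<sigma> \<bar>norm z - r i\<bar>" by simp
          then have "norm z / norm (z - w) \<le> norm z / max \<sigma> \<bar>norm z - r i\<bar>"
            using pos by (intro divide_left_mono mult_pos_pos) auto
          also have "\<dots> = norm z * q i z" by (simp add: q_def)
          also have "\<dots> \<le> 4 * R * q i z" using z4 q0[of i z] by (intro mult_right_mono) auto
          finally have "norm z / norm (z - w) * m z \<le> 4 * R * q i z * m z" using m(2) by (intro mult_right_mono) auto
          moreover have "z \<in> dyadic_annulus k" using ge r(1)[of i] z4 unfolding dyadic_annulus_def R_def[symmetric] by auto
          then have "4 * R * q i z * m z \<le> N z" unfolding N_def using m(2)[of z] pos q0[of i z] by (auto intro!: add_nonneg_nonneg mult_nonneg_nonneg)
          ultimately have "ennreal (norm z / norm (z - w) * m z) \<le> ennreal (N z)" by (intro ennreal_leI) linarith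
          then show ?thesis by (rule order_trans) simp
        qed
      qed
    qed
    have [measurable]: "(indicator (ball w \<sigma>) :: complex \<Rightarrow> ennreal) \<in> borel_measurable borel"
      by (intro borel_measurable_indicator) simp
    have "(\<integral>\<^sup>+z. ennreal (norm z / norm (z - w) * m z) \<partial>lborel) \<le>
       (\<integral>\<^sup>+z. ennreal (N z) + ennreal (4 * R * b) * (ennreal (1 / norm (z - w)) * indicator (ball w \<sigma>) z) \<partial>lborel)"
      by (intro nn_integral_mono pt)
    also have "\<dots> = (\<integral>\<^sup>+z. ennreal (N z) \<partial>lborel) + ennreal (4 * R * b) * (\<integral>\<^sup>+z. ennreal (1 / norm (z - w)) * indicator (ball w \<sigma>) z \<partial>lborel)"
      using Nm by (subst nn_integral_add) (auto simp: nn_integral_cmult)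
    also have "\<dots> \<le> ennreal (3 * \<eta> / 4) + ennreal (4 * R * b) * ennreal (16 * \<sigma>)"
    proof (intro add_mono mult_left_mono nn_integral_inverse_dist_ball_le pos)
      have "(\<integral>\<^sup>+z. ennreal (N z) \<partial>lborel) = ennreal (LBINT z. N z)"
        by (rule nn_integral_eq_integral[OF Nint]) (simp add: N0)
      then show "(\<integral>\<^sup>+z. ennreal (N z) \<partial>lborel) \<le> ennreal (3 * \<eta> / 4)" using NI by (simp add: ennreal_leI)
    qed simp
    also have "ennreal (4 * R * b) * ennreal (16 * \<sigma>) = ennreal (64 * b / 2 ^ k)"
    proof -
      have "R * \<sigma> = 1 / 2 ^ k"
        unfolding R_def \<sigma>_def by (simp add: field_simps flip: power_mult_distrib)
      moreover have "4 * R * b * (16 * \<sigma>) = 64 * b * (R * \<sigma>)" by simp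
      ultimately have "4 * R * b * (16 * \<sigma>) = 64 * b / 2 ^ k" by simp
      then show ?thesis using pos b0 by (subst ennreal_mult[symmetric]) auto
    qed
    also have "ennreal (3 * \<eta> / 4) + ennreal (64 * b / 2 ^ k) = ennreal (3 * \<eta> / 4 + 64 * b / 2 ^ k)"
      using \<eta> b0 by (subst ennreal_plus) auto
    also have "\<dots> \<le> ennreal \<eta>" using k0[OF k(1)] \<eta> by (intro ennreal_leI) linarith
    finally have le: "(\<integral>\<^sup>+z. ennreal (norm z / norm (z - w) * m z) \<partial>lborel) \<le> ennreal \<eta>" .
    have "(LBINT z. norm z / norm (z - w) * m z) = enn2real (\<integral>\<^sup>+z. ennreal (norm z / norm (z - w) * m z) \<partial>lborel)"
      by (rule integral_eq_nn_integral) (auto simp: m(2))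
    also have "\<dots> \<le> \<eta>" using le \<eta> by (intro enn2real_leI) auto
    finally show ?thesis .
  qed
  have "r i \<ge> X" using r(1)[of i] k0[OF k(1)] by (auto simp: R_def)
  moreover have "r i > 0" using r(1)[of i] pos by linarith
  ultimately show ?thesis using main by blast
qed

section \<open>Few zeros\<close>

lemma mult_two_thirds_power_le: "real n * (2 / 3) ^ n \<le> 2"
proof -
  have "real n / 2 \<le> 1 + real n * (1 / 2)" by simp
  also have "\<dots> \<le> (1 + 1 / 2) ^ n" using Bernoulli_inequality[of "1/2::real" n] by simp
  finally have "real n / 2 * (2 / 3) ^ n \<le> (3 / 2) ^ n * (2 / 3) ^ n" by (intro mult_right_mono) auto
  also have "\<dots> = 1" by (simp flip: power_mult_distrib)
  finally show ?thesis by simp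
qed

lemma mult_third_power_le: "real n * (1 / 3) ^ n \<le> 1"
proof -
  have "real n \<le> 1 + real n * 2" by simp
  also have "\<dots> \<le> (1 + 2) ^ n" using Bernoulli_inequality[of 2 n] by simp
  finally have "real n * (1 / 3) ^ n \<le> 3 ^ n * (1 / 3) ^ n" by (intro mult_right_mono) auto
  also have "\<dots> = 1" by (simp flip: power_mult_distrib)
  finally show ?thesis .
qed

lemma inverse_le_dyadic_shells:
  assumes x: "0 \<le> x" "x \<le> 2 ^ I"
  shows "1 / x \<le> (if x \<le> 1 then 1 / x else 0) + (\<Sum>i<I. (if x \<le> 2 ^ Suc i then 1 / 2 ^ i else (0::real)))"
proof (cases "x \<le> 1")
  case True
  then show ?thesis by (simp add: sum_nonneg)
next
  case False
  define j where "j = (LEAST i. x \<le> 2 ^ i)"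
  have j: "x \<le> 2 ^ j" unfolding j_def using x(2) by (rule LeastI)
  have "j \<le> I" unfolding j_def using x(2) by (rule Least_le)
  have "j \<noteq> 0" using j False by (intro notI) simp
  then obtain i where i: "j = Suc i" using not0_implies_Suc by blast
  have "\<not> x \<le> 2 ^ i" using not_less_Least[of i "\<lambda>i. x \<le> 2 ^ i"] i unfolding j_def by auto
  then have "1 / x \<le> 1 / 2 ^ i" by (intro divide_left_mono) (auto simp: not_le intro!: mult_pos_pos less_trans[of 0 "2 ^ i" x])
  also have "\<dots> = (\<Sum>i\<in>{i}. (if x \<le> 2 ^ Suc i then 1 / 2 ^ i else 0))" using j i by simp
  also have "\<dots> \<le> (\<Sum>i<I. (if x \<le> 2 ^ Suc i then 1 / 2 ^ i else 0))"
    using i \<open>j \<le> I\<close> by (intro sum_mono2) auto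
  finally show ?thesis using False by simp
qed

text \<open>Turns sums of logarithms over zeros into counts of zeros in discs of dyadic radii.\<close>

lemma ln_le_dyadic_count:
  assumes x: "1 \<le> x" "x \<le> 2 ^ J"
  shows "ln x \<le> (\<Sum>j<J. (if 2 ^ j \<le> x then 1 else (0::real)))"
  using x(2)
proof (induction J)
  case 0
  then show ?case using x(1) by simp
next
  case (Suc J)
  show ?case
  proof (cases "x \<le> 2 ^ J")
    case True
    have "0 \<le> (if 2 ^ J \<le> x then 1 else (0::real))" by simp
    then show ?thesis using Suc.IH[OF True] unfolding sum.lessThan_Suc by linarith
  next
    case False
    have all: "2 ^ j \<le> x" if "j < Suc J" for j
    proof -
      have "(2::real) ^ j \<le> 2 ^ J" using that by (intro power_increasing) auto
      then show ?thesis using False by linarith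
    qed
    have "ln x \<le> ln (2 ^ Suc J)" using Suc.prems x(1) by (subst ln_le_cancel_iff) auto
    also have "\<dots> = real (Suc J) * ln 2" by (rule ln_realpow)
    also have "\<dots> \<le> real (Suc J) * 1" using ln_2_less_1 by (intro mult_left_mono) auto
    also have "\<dots> = (\<Sum>j<Suc J. (if 2 ^ j \<le> x then 1 else (0::real)))" using all by simp
    finally show ?thesis .
  qed
qed

context orthogonal_multiple
begin

text \<open>The points \<open>t 0, ..., t (n - 1)\<close> are zeros of \<open>g\<close> counted with multiplicity. Further zeros may
remain in the cofactor, so sublists of zero lists are zero lists.\<close>

definition zero_list :: "nat \<Rightarrow> (nat \<Rightarrow> complex) \<Rightarrow> bool" where
  "zero_list n t \<longleftrightarrow> (\<exists>e. e holomorphic_on UNIV \<and> (\<forall>z. g z = (\<Prod>i<n. z - t i) * e z))"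

definition amplitude :: "complex \<Rightarrow> real" where
  "amplitude z = norm (g z * F z) * exp (- (pi / 2) * (norm z)^2)"

lemma amplitude_nonneg: "amplitude z \<ge> 0"
  by (simp add: amplitude_def)

lemma amplitude_sq: "(amplitude z)^2 = mass z"
  unfolding amplitude_def mass_def power_mult_distrib exp_double[symmetric] by simp

lemma amplitude_le: "amplitude z \<le> B"
  by (rule power2_le_imp_le) (simp_all add: amplitude_sq mass_bound B(1))

text \<open>Maximum principle on the circle of radius \<open>4 \<rho>\<close> about \<open>z\<close>, where each selected zero is at distance at
least \<open>3 \<rho>\<close>. The twist \<open>exp (- pi cnj z (\<zeta> - z))\<close> recentres the weight at \<open>z\<close>, so that the growth of
\<open>f\<close> costs only \<open>exp (pi / 2 (4 \<rho>)^2)\<close>.\<close>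

lemma amplitude_small_near_zeros:
  assumes t: "zero_list n t" and \<rho>: "\<rho> > 0" and S: "S = {i. i < n \<and> norm (z - t i) \<le> \<rho>}"
  shows "amplitude z \<le> B * exp (8 * pi * \<rho>^2) * (\<Prod>i\<in>S. norm (z - t i) / (3 * \<rho>))"
proof -
  obtain e where e: "e holomorphic_on UNIV" "\<And>z. g z = (\<Prod>i<n. z - t i) * e z"
    using t by (auto simp: zero_list_def)
  define k where "k \<zeta> = (\<Prod>i\<in>{..<n} - S. \<zeta> - t i) * e \<zeta> * F \<zeta> * exp (- of_real pi * cnj z * (\<zeta> - z))" for \<zeta>
  have hk: "k holomorphic_on UNIV" unfolding k_def by (intro holomorphic_intros e(1) F)
  have SS: "S \<subseteq> {..<n}" "finite S" using S by auto
  have split: "g \<zeta> * F \<zeta> * exp (- of_real pi * cnj z * (\<zeta> - z)) = (\<Prod>i\<in>S. \<zeta> - t i) * k \<zeta>" for \<zeta>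
  proof -
    have "(\<Prod>i<n. \<zeta> - t i) = (\<Prod>i\<in>{..<n} - S. \<zeta> - t i) * (\<Prod>i\<in>S. \<zeta> - t i)"
      by (rule prod.subset_diff) (use SS in auto)
    then show ?thesis by (simp add: e(2) k_def)
  qed
  define M where "M = B * exp (pi / 2 * (norm z)^2) * exp (8 * pi * \<rho>^2)"
  have M0: "M \<ge> 0" using B(1) by (simp add: M_def)
  have "norm (k z) \<le> M / (3 * \<rho>) ^ card S"
  proof (rule maximum_modulus_disc[OF hk, of z "4 * \<rho>"])
    show "norm (z - z) \<le> 4 * \<rho>" using \<rho> by simp
    fix \<zeta> assume \<zeta>: "norm (\<zeta> - z) = 4 * \<rho>"
    have "norm (exp (- of_real pi * cnj z * (\<zeta> - z))) = exp (- pi * Re (cnj z * (\<zeta> - z)))"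
    proof -
      have "- of_real pi * cnj z * (\<zeta> - z) = of_real (- pi) * (cnj z * (\<zeta> - z))" by (simp only: of_real_minus mult.assoc)
      then show ?thesis by (simp only: norm_exp_eq_Re scaleR_conv_of_real[symmetric] scaleR_complex.sel)
    qed
    then have "norm (g \<zeta> * F \<zeta> * exp (- of_real pi * cnj z * (\<zeta> - z))) = norm (g \<zeta> * F \<zeta>) * exp (- pi * Re (cnj z * (\<zeta> - z)))"
      by (simp only: norm_mult[of "g \<zeta> * F \<zeta>"])
    also have "\<dots> \<le> B * exp (pi / 2 * (norm \<zeta>)^2) * exp (- pi * Re (cnj z * (\<zeta> - z)))"
      using B(2)[of \<zeta>] by (intro mult_right_mono) auto
    also have "\<dots> = B * exp (pi / 2 * (norm \<zeta>)^2 + - pi * Re (cnj z * (\<zeta> - z)))" by (simp only: exp_add mult.assoc)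
    also have "pi / 2 * (norm \<zeta>)^2 + - pi * Re (cnj z * (\<zeta> - z)) = pi / 2 * (norm z)^2 + pi / 2 * (norm (\<zeta> - z))^2"
      unfolding cmod_power2 by (simp add: power2_eq_square field_simps)
    also have "pi / 2 * (norm (\<zeta> - z))^2 = 8 * pi * \<rho>^2" unfolding \<zeta> by (simp add: power_mult_distrib)
    also have "B * exp (pi / 2 * (norm z)^2 + 8 * pi * \<rho>^2) = M" by (simp add: M_def exp_add)
    finally have up: "norm (\<Prod>i\<in>S. \<zeta> - t i) * norm (k \<zeta>) \<le> M" unfolding split by (simp add: norm_mult)
    have "(3 * \<rho>) ^ card S = (\<Prod>i\<in>S. 3 * \<rho>)" by simp
    also have "\<dots> \<le> (\<Prod>i\<in>S. norm (\<zeta> - t i))"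
    proof (rule prod_mono)
      fix i assume "i \<in> S"
      then have "norm (z - t i) \<le> \<rho>" using S by simp
      then show "0 \<le> 3 * \<rho> \<and> 3 * \<rho> \<le> norm (\<zeta> - t i)"
        using \<zeta> \<rho> norm_triangle_ineq4[of "\<zeta> - t i" "z - t i"] by simp
    qed
    also have "\<dots> = norm (\<Prod>i\<in>S. \<zeta> - t i)" by (simp add: prod_norm)
    finally have "(3 * \<rho>) ^ card S * norm (k \<zeta>) \<le> norm (\<Prod>i\<in>S. \<zeta> - t i) * norm (k \<zeta>)" by (rule mult_right_mono) simp
    then have "(3 * \<rho>) ^ card S * norm (k \<zeta>) \<le> M" using up by linarith
    then show "norm (k \<zeta>) \<le> M / (3 * \<rho>) ^ card S" using \<rho> by (simp add: pos_le_divide_eq mult.commute)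
  qed
  have "norm (g z * F z) = norm (\<Prod>i\<in>S. z - t i) * norm (k z)"
    using split[of z] by (simp add: norm_mult)
  also have "\<dots> \<le> (\<Prod>i\<in>S. norm (z - t i)) * (M / (3 * \<rho>) ^ card S)"
    using \<open>norm (k z) \<le> M / (3 * \<rho>) ^ card S\<close> unfolding prod_norm[symmetric] by (intro mult_left_mono) (auto intro: prod_nonneg)
  also have "\<dots> = M * (\<Prod>i\<in>S. norm (z - t i) / (3 * \<rho>))" by (simp add: prod_dividef)
  finally have "amplitude z \<le> M * (\<Prod>i\<in>S. norm (z - t i) / (3 * \<rho>)) * exp (- (pi / 2) * (norm z)^2)"
    unfolding amplitude_def by (intro mult_right_mono) auto
  also have "\<dots> = B * exp (8 * pi * \<rho>^2) * (\<Prod>i\<in>S. norm (z - t i) / (3 * \<rho>)) * (exp (pi / 2 * (norm z)^2) * exp (- (pi / 2) * (norm z)^2))"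
    by (simp add: M_def)
  also have "exp (pi / 2 * (norm z)^2) * exp (- (pi / 2) * (norm z)^2) = 1" by (simp add: exp_add[symmetric])
  finally show ?thesis by simp
qed

text \<open>If the disc contains more than \<open>64 \<rho>^2\<close> zeros, then the factors \<open>1 / 3\<close> beat \<open>exp (8 pi \<rho>^2)\<close> and \<open>f\<close>
is exponentially small in their number.\<close>

lemma amplitude_mult_zero_count:
  assumes t: "zero_list n t" and \<rho>: "\<rho> > 0" and S: "S = {i. i < n \<and> norm (z - t i) \<le> \<rho>}"
  shows "amplitude z * real (card S) \<le> 64 * \<rho>^2 * amplitude z + 2 * B"
proof (cases "real (card S) \<le> 64 * \<rho>^2")
  case True
  then have "amplitude z * real (card S) \<le> amplitude z * (64 * \<rho>^2)" by (intro mult_left_mono amplitude_nonneg)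
  then show ?thesis using B(1) by (simp add: mult_ac)
next
  case False
  define m where "m = card S"
  have m: "64 * \<rho>^2 < real m" using False by (simp add: m_def)
  have "(\<Prod>i\<in>S. norm (z - t i) / (3 * \<rho>)) \<le> (\<Prod>i\<in>S. 1 / 3)"
  proof (rule prod_mono)
    fix i assume "i \<in> S"
    then show "0 \<le> norm (z - t i) / (3 * \<rho>) \<and> norm (z - t i) / (3 * \<rho>) \<le> 1 / 3" using S \<rho> by (simp add: field_simps)
  qed
  also have "\<dots> = (1 / 3) ^ m" by (simp add: m_def)
  finally have p: "(\<Prod>i\<in>S. norm (z - t i) / (3 * \<rho>)) \<le> (1 / 3) ^ m" .
  have ex: "exp (8 * pi * \<rho>^2) \<le> 2 ^ m"
  proof -
    have "8 * pi * \<rho>^2 \<le> 8 * 4 * \<rho>^2" using pi_less_4 by (intro mult_right_mono) auto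
    then have "8 * pi * \<rho>^2 \<le> real m * (1 / 2)" using m by simp
    then have "exp (8 * pi * \<rho>^2) \<le> exp (real m * (1 / 2))" by simp
    also have "\<dots> = exp (1 / 2) ^ m" by (rule exp_of_nat_mult)
    also have "\<dots> \<le> 2 ^ m" using exp_half_le2 by (intro power_mono) auto
    finally show ?thesis .
  qed
  have "amplitude z \<le> B * exp (8 * pi * \<rho>^2) * (\<Prod>i\<in>S. norm (z - t i) / (3 * \<rho>))"
    by (rule amplitude_small_near_zeros[OF t \<rho> S])
  also have "\<dots> \<le> B * 2 ^ m * (1 / 3) ^ m" using p ex B(1) \<rho> by (intro mult_mono) (auto intro: prod_nonneg)
  also have "\<dots> = B * (2 / 3) ^ m" by (simp add: power_divide)
  finally have "amplitude z * real m \<le> B * (2 / 3) ^ m * real m" by (intro mult_right_mono) auto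
  also have "\<dots> = B * (real m * (2 / 3) ^ m)" by simp
  also have "\<dots> \<le> B * 2" using B(1) by (intro mult_left_mono mult_two_thirds_power_le)
  also have "\<dots> \<le> 64 * \<rho>^2 * amplitude z + 2 * B" using amplitude_nonneg[of z] by simp
  finally show ?thesis by (simp add: m_def)
qed

text \<open>For a zero at distance less than one, its own factor in the product absorbs the pole of the kernel.\<close>

lemma amplitude_mult_close_zeros:
  assumes t: "zero_list n t" and S: "S = {i. i < n \<and> norm (z - t i) \<le> 1}"
  shows "amplitude z * (\<Sum>i\<in>S. 1 / norm (z - t i)) \<le> B * exp (8 * pi)"
proof -
  have fin: "finite S" using S by auto
  have "amplitude z * (1 / norm (z - t j)) \<le> B * exp (8 * pi) * (1 / 3) ^ card S" if j: "j \<in> S" for j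
  proof -
    have "(\<Prod>i\<in>S. norm (z - t i) / 3) = norm (z - t j) / 3 * (\<Prod>i\<in>S - {j}. norm (z - t i) / 3)"
      using fin j by (rule prod.remove)
    also have "\<dots> \<le> norm (z - t j) / 3 * (\<Prod>i\<in>S - {j}. 1 / 3)"
      using S by (intro mult_left_mono prod_mono) auto
    also have "\<dots> = norm (z - t j) * (1 / 3) ^ Suc (card (S - {j}))" by simp
    also have "Suc (card (S - {j})) = card S" using fin j by (rule card_Suc_Diff1)
    finally have p: "(\<Prod>i\<in>S. norm (z - t i) / 3) \<le> norm (z - t j) * (1 / 3) ^ card S" .
    have "amplitude z \<le> B * exp (8 * pi) * (\<Prod>i\<in>S. norm (z - t i) / 3)"
      using amplitude_small_near_zeros[OF t zero_less_one S] by simp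
    also have "\<dots> \<le> B * exp (8 * pi) * (norm (z - t j) * (1 / 3) ^ card S)" using p B(1) by (intro mult_left_mono) auto
    finally have "amplitude z * (1 / norm (z - t j)) \<le> B * exp (8 * pi) * (norm (z - t j) * (1 / 3) ^ card S) * (1 / norm (z - t j))"
      by (rule mult_right_mono) simp
    also have "\<dots> \<le> B * exp (8 * pi) * (1 / 3) ^ card S" using B(1) by (cases "z = t j") auto
    finally show ?thesis .
  qed
  then have "(\<Sum>j\<in>S. amplitude z * (1 / norm (z - t j))) \<le> (\<Sum>j\<in>S. B * exp (8 * pi) * (1 / 3) ^ card S)"
    by (rule sum_mono)
  also have "\<dots> = B * exp (8 * pi) * (real (card S) * (1 / 3) ^ card S)" by simp
  also have "\<dots> \<le> B * exp (8 * pi) * 1" using B(1) by (intro mult_left_mono mult_third_power_le) auto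
  finally show ?thesis by (simp add: sum_distrib_left)
qed

text \<open>Shell by shell: at scale \<open>2^j\<close> the kernel is \<open>2^-j\<close> and there are either at most of the order of
\<open>4^j\<close> zeros, or so many that the amplitude is negligible. The result is what one would get from
zeros distributed like area.\<close>

lemma amplitude_mult_zero_potential:
  assumes t: "zero_list n t" and I: "\<And>i. i < n \<Longrightarrow> norm (z - t i) \<le> 2 ^ I"
  shows "amplitude z * (\<Sum>i<n. 1 / norm (z - t i)) \<le> B * (exp (8 * pi) + 4) + 256 * 2 ^ I * amplitude z"
proof -
  define S where "S = {i. i < n \<and> norm (z - t i) \<le> 1}"
  define T where "T j = {i. i < n \<and> norm (z - t i) \<le> 2 ^ Suc j}" for j
  have "(\<Sum>i<n. 1 / norm (z - t i)) \<le> (\<Sum>i<n. (if norm (z - t i) \<le> 1 then 1 / norm (z - t i) else 0)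
       + (\<Sum>j<I. (if norm (z - t i) \<le> 2 ^ Suc j then 1 / 2 ^ j else 0)))"
    by (intro sum_mono inverse_le_dyadic_shells I) auto
  also have "\<dots> = (\<Sum>i<n. (if norm (z - t i) \<le> 1 then 1 / norm (z - t i) else 0))
       + (\<Sum>j<I. \<Sum>i<n. (if norm (z - t i) \<le> 2 ^ Suc j then 1 / 2 ^ j else 0))"
    unfolding sum.distrib by (subst sum.swap) (rule refl)
  also have "(\<Sum>i<n. (if norm (z - t i) \<le> 1 then 1 / norm (z - t i) else 0)) = (\<Sum>i\<in>S. 1 / norm (z - t i))"
    unfolding S_def by (intro sum.mono_neutral_cong_right) auto
  also have "(\<Sum>j<I. \<Sum>i<n. (if norm (z - t i) \<le> 2 ^ Suc j then 1 / 2 ^ j else (0::real))) = (\<Sum>j<I. real (card (T j)) / 2 ^ j)"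
  proof (rule sum.cong[OF refl])
    fix j
    have "(\<Sum>i<n. (if norm (z - t i) \<le> 2 ^ Suc j then 1 / 2 ^ j else (0::real))) = (\<Sum>i\<in>T j. 1 / 2 ^ j)"
      unfolding T_def by (intro sum.mono_neutral_cong_right) auto
    then show "(\<Sum>i<n. (if norm (z - t i) \<le> 2 ^ Suc j then 1 / 2 ^ j else (0::real))) = real (card (T j)) / 2 ^ j" by simp
  qed
  finally have "amplitude z * (\<Sum>i<n. 1 / norm (z - t i)) \<le> amplitude z * ((\<Sum>i\<in>S. 1 / norm (z - t i)) + (\<Sum>j<I. real (card (T j)) / 2 ^ j))"
    by (intro mult_left_mono amplitude_nonneg)
  also have "\<dots> = amplitude z * (\<Sum>i\<in>S. 1 / norm (z - t i)) + (\<Sum>j<I. amplitude z * real (card (T j)) / 2 ^ j)"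
    by (simp add: distrib_left sum_distrib_left)
  also have "amplitude z * (\<Sum>i\<in>S. 1 / norm (z - t i)) \<le> B * exp (8 * pi)"
    by (rule amplitude_mult_close_zeros[OF t S_def])
  also have "(\<Sum>j<I. amplitude z * real (card (T j)) / 2 ^ j) \<le> (\<Sum>j<I. 256 * amplitude z * 2 ^ j + 2 * B * (1 / 2) ^ j)"
  proof (rule sum_mono)
    fix j
    have "amplitude z * real (card (T j)) / 2 ^ j \<le> (64 * (2 ^ Suc j)^2 * amplitude z + 2 * B) / 2 ^ j"
      by (intro divide_right_mono amplitude_mult_zero_count[OF t _ T_def]) auto
    also have "\<dots> = 256 * amplitude z * 2 ^ j + 2 * B * (1 / 2) ^ j"
    proof -
      have "64 * (2 ^ Suc j)^2 * amplitude z / 2 ^ j = 256 * amplitude z * 2 ^ j"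
        by (simp add: power2_eq_square)
      moreover have "2 * B / 2 ^ j = 2 * B * (1 / 2) ^ j" by (simp add: power_one_over)
      ultimately show ?thesis by (simp only: add_divide_distrib)
    qed
    finally show "amplitude z * real (card (T j)) / 2 ^ j \<le> 256 * amplitude z * 2 ^ j + 2 * B * (1 / 2) ^ j" .
  qed
  also have "\<dots> = 256 * amplitude z * (\<Sum>j<I. 2 ^ j) + 2 * B * (\<Sum>j<I. (1 / 2) ^ j)"
    by (simp add: sum.distrib sum_distrib_left)
  also have "\<dots> \<le> 256 * amplitude z * 2 ^ I + 2 * B * 2"
  proof (intro add_mono mult_left_mono)
    have "(\<Sum>j<I. 2 ^ j) = (2::real) ^ I - 1" by (simp add: geometric_sum)
    then show "(\<Sum>j<I. 2 ^ j) \<le> (2::real) ^ I" by simp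
    have "(\<Sum>j<I. (1 / 2::real) ^ j) = 2 - 2 * (1 / 2) ^ I" by (induction I) auto
    then show "(\<Sum>j<I. (1 / 2::real) ^ j) \<le> 2" by simp
  qed (auto simp: B(1) amplitude_nonneg)
  finally show ?thesis by (simp add: algebra_simps)
qed

end

context orthogonal_multiple
begin

abbreviation total_mass :: real where "total_mass \<equiv> (LBINT z. mass z)"

lemma zero_list_root:
  assumes "zero_list n t" "i < n"
  shows "g (t i) = 0"
proof -
  obtain e where "\<And>z. g z = (\<Prod>i<n. z - t i) * e z" using assms(1) by (auto simp: zero_list_def)
  moreover have "(\<Prod>j<n. t i - t j) = 0" using assms(2) by (intro prod_zero) auto
  ultimately show ?thesis by simp
qed

lemma integrable_kernel_mass: "integrable lborel (\<lambda>z. cmass z / (z - w))"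
  by (rule cauchy_kernel_bound(1)[OF cmass, of 1]) simp

text \<open>From \<open>1 + w / (z - w) = z / (z - w)\<close>: the right side measures how far \<open>w C\<^sub>\<nu> w\<close> is from \<open>- \<nu>(\<complex>)\<close>.\<close>

lemma weighted_kernel:
  shows "integrable lborel (\<lambda>z. norm z / norm (z - w) * mass z)"
    and "norm (w * cauchy_transform cmass w + of_real total_mass) \<le> (LBINT z. norm z / norm (z - w) * mass z)"
proof -
  have i: "integrable lborel (\<lambda>z. cmass z + w * (cmass z / (z - w)))"
    by (intro Bochner_Integration.integrable_add cmass integrable_mult_right integrable_kernel_mass)
  have ae: "AE z in lborel. norm (cmass z + w * (cmass z / (z - w))) = norm z / norm (z - w) * mass z"
  proof -
    have "AE z in lborel. z \<noteq> w" by (rule AE_lborel_singleton)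
    then show ?thesis
    proof eventually_elim
      case (elim z)
      then have "cmass z + w * (cmass z / (z - w)) = z / (z - w) * cmass z" by (simp add: field_simps)
      then show ?case using mass_nonneg[of z] by (simp add: norm_mult norm_divide)
    qed
  qed
  have m: "(\<lambda>z. norm z / norm (z - w) * mass z) \<in> borel_measurable lborel" using mass_integrable by simp
  have ni: "integrable lborel (\<lambda>z. norm (cmass z + w * (cmass z / (z - w))))" using i by (rule integrable_norm)
  show "integrable lborel (\<lambda>z. norm z / norm (z - w) * mass z)"
    using integrable_cong_AE_imp[OF ni m] ae by (simp add: eq_commute)
  have eq: "w * cauchy_transform cmass w + of_real total_mass = (LBINT z. cmass z + w * (cmass z / (z - w)))"
    unfolding cauchy_transform_def
    by (simp only: Bochner_Integration.integral_add[OF cmass(1) integrable_mult_right[OF integrable_kernel_mass]]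
        integral_mult_right_zero integral_complex_of_real add.commute)
  have "norm (w * cauchy_transform cmass w + of_real total_mass) \<le> (LBINT z. norm (cmass z + w * (cmass z / (z - w))))"
    unfolding eq by (rule integral_norm_bound)
  also have "\<dots> = (LBINT z. norm z / norm (z - w) * mass z)"
    by (rule integral_cong_AE) (use ni m ae in auto)
  finally show "norm (w * cauchy_transform cmass w + of_real total_mass) \<le> (LBINT z. norm z / norm (z - w) * mass z)" .
qed

text \<open>At a zero of \<open>g\<close> the Cauchy transform vanishes, so it is as far as possible from its expected size.\<close>

lemma zero_potential_lower:
  assumes fac: "\<And>w. cauchy_transform cmass w = g w * cauchy_transform density w" and "g w = 0"
  shows "total_mass \<le> (LBINT z. norm z / norm (z - w) * mass z)"
proof -
  have "cauchy_transform cmass w = 0" using fac[of w] assms(2) by simp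
  then have "norm (complex_of_real total_mass) \<le> (LBINT z. norm z / norm (z - w) * mass z)"
    using weighted_kernel(2)[of w] by simp
  then show ?thesis by simp
qed

lemma truncated_moment_tendsto_0:
  assumes p: "p > (0::nat)"
  shows "((\<lambda>s. LBINT z. (indicator {z. norm z < 2 * s} z * (norm z / s) ^ p) * mass z) \<longlongrightarrow> 0) at_top"
proof (rule integral_vanishing_weight[OF mass_integrable, where K="2 ^ p"])
  show "\<bar>indicator {z. norm z < 2 * s} z * (norm z / s) ^ p\<bar> \<le> 2 ^ p" if s: "s > 0" for s and z :: complex
  proof (cases "norm z < 2 * s")
    case True
    then have "(norm z / s) ^ p \<le> 2 ^ p" using s by (intro power_mono) (auto simp: field_simps)
    then show ?thesis using True s by simp
  qed simp
  show "((\<lambda>s. indicator {z. norm z < 2 * s} z * (norm z / s) ^ p) \<longlongrightarrow> 0) at_top" for z :: complex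
  proof (rule Lim_null_comparison)
    show "\<forall>\<^sub>F s in at_top. norm (indicator {z. norm z < 2 * s} z * (norm z / s) ^ p) \<le> (norm z / s) ^ p"
      using eventually_gt_at_top[of 0] by eventually_elim (auto simp: indicator_def)
    have "((\<lambda>s. norm z / s) \<longlongrightarrow> 0) at_top" by real_asymp
    then have "((\<lambda>s. (norm z / s) ^ p) \<longlongrightarrow> 0 ^ p) at_top" by (rule tendsto_power)
    then show "((\<lambda>s. (norm z / s) ^ p) \<longlongrightarrow> 0) at_top" unfolding zero_power[OF p] .
  qed
qed measurable

lemma mass_integrable_indicator:
  assumes [measurable]: "\<phi> \<in> borel_measurable borel" and b: "\<And>z. \<bar>\<phi> z\<bar> \<le> (K::real)"
  shows "integrable lborel (\<lambda>z. \<phi> z * mass z)"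
proof (rule Bochner_Integration.integrable_bound)
  show "integrable lborel (\<lambda>z. K * mass z)" using mass_integrable by simp
  show "(\<lambda>z. \<phi> z * mass z) \<in> borel_measurable lborel" using mass_integrable by simp
  show "AE z in lborel. norm (\<phi> z * mass z) \<le> norm (K * mass z)"
  proof (rule AE_I2)
    fix z
    have "norm (\<phi> z * mass z) \<le> K * mass z" using mult_right_mono[OF b[of z] mass_nonneg[of z]] mass_nonneg[of z] by (simp add: abs_mult)
    then show "norm (\<phi> z * mass z) \<le> norm (K * mass z)" by simp
  qed
qed

text \<open>The lower bound of \<open>zero_potential_lower\<close> is summed over the zeros and the order of summation and
integration is exchanged. Where \<open>|z| \<ge> 2 s\<close> each term is at most \<open>2 \<nu>\<close>; elsewhere
\<open>amplitude_mult_zero_potential\<close> applies. The parameter \<open>\<epsilon>\<close> comes from splitting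
\<open>|z| amplitude z \<le> |z|^2 mass z / (2 \<epsilon>) + \<epsilon> / 2\<close>.\<close>

lemma zero_count_bound_large:
  assumes fac: "\<And>w. cauchy_transform cmass w = g w * cauchy_transform density w"
    and t: "zero_list n t" "\<And>i. i < n \<Longrightarrow> norm (t i) \<le> s" and s: "s \<ge> 1" and \<epsilon>: "\<epsilon> > 0"
  defines "C \<equiv> B * (exp (8 * pi) + 4)"
  shows "real n * total_mass \<le> 2 * real n * (LBINT z. indicator {z. norm z \<ge> 2 * s} z * mass z)
    + s^2 * (C / (2 * \<epsilon>) * (LBINT z. (indicator {z. norm z < 2 * s} z * (norm z / s) ^ 2) * mass z)
         + 2048 * (LBINT z. (indicator {z. norm z < 2 * s} z * (norm z / s) ^ 1) * mass z) + 8 * C * \<epsilon>)"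
proof -
  have C0: "C \<ge> 0" using B(1) by (simp add: C_def)
  obtain I where I: "4 * s \<le> 2 ^ I" "2 ^ I \<le> 8 * s"
  proof -
    define J where "J = (LEAST i. 4 * s \<le> 2 ^ i)"
    obtain i where "4 * s < 2 ^ i" using real_arch_pow[of 2 "4 * s"] by auto
    then have "4 * s \<le> 2 ^ i" by simp
    then have J: "4 * s \<le> 2 ^ J" unfolding J_def by (rule LeastI)
    have "J \<noteq> 0" using J s by (intro notI) simp
    then obtain k where k: "J = Suc k" using not0_implies_Suc by blast
    have "\<not> 4 * s \<le> 2 ^ k" using not_less_Least[of k "\<lambda>i. 4 * s \<le> 2 ^ i"] k unfolding J_def by auto
    then show ?thesis using that[OF J] k by simp
  qed
  define N where "N z = 2 * real n * (indicator {z. norm z \<ge> 2 * s} z * mass z)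
    + s^2 * (C / (2 * \<epsilon>)) * ((indicator {z. norm z < 2 * s} z * (norm z / s) ^ 2) * mass z)
    + s^2 * 2048 * ((indicator {z. norm z < 2 * s} z * (norm z / s) ^ 1) * mass z)
    + C * \<epsilon> / 2 * indicator (ball 0 (2 * s)) z" for z
  have pw: "\<bar>indicator {z. norm z < 2 * s} z * (norm z / s) ^ p\<bar> \<le> 2 ^ p" for p :: nat and z :: complex
  proof (cases "norm z < 2 * s")
    case True
    then have "(norm z / s) ^ p \<le> 2 ^ p" using s by (intro power_mono) (auto simp: field_simps)
    then show ?thesis using True s by simp
  qed simp
  have i1: "integrable lborel (\<lambda>z. indicator {z. norm z \<ge> 2 * s} z * mass z)"
    by (rule mass_integrable_indicator[where K=1]) (auto simp: indicator_def)
  have i2: "integrable lborel (\<lambda>z. (indicator {z. norm z < 2 * s} z * (norm z / s) ^ p) * mass z)" for p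
    by (rule mass_integrable_indicator[OF _ pw]) measurable
  have i3: "integrable lborel (indicator (ball (0::complex) (2 * s)) :: complex \<Rightarrow> real)"
    using s by (simp add: integrable_indicator_iff emeasure_ball_complex)
  have pt: "(\<Sum>i<n. norm z / norm (z - t i) * mass z) \<le> N z" for z
  proof (cases "norm z < 2 * s")
    case True
    have "norm (z - t i) \<le> 2 ^ I" if "i < n" for i
      using norm_triangle_ineq4[of z "t i"] t(2)[OF that] True I(1) s by linarith
    from amplitude_mult_zero_potential[OF t(1) this]
    have pot: "amplitude z * (\<Sum>i<n. 1 / norm (z - t i)) \<le> C + 256 * 2 ^ I * amplitude z" by (simp add: C_def)
    have "(\<Sum>i<n. norm z / norm (z - t i) * mass z) = norm z * amplitude z * (amplitude z * (\<Sum>i<n. 1 / norm (z - t i)))"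
      unfolding amplitude_sq[symmetric] by (simp add: sum_distrib_left power2_eq_square mult_ac)
    also have "\<dots> \<le> norm z * amplitude z * (C + 256 * 2 ^ I * amplitude z)"
      by (intro mult_left_mono pot mult_nonneg_nonneg amplitude_nonneg) auto
    also have "\<dots> = C * (norm z * amplitude z) + 256 * 2 ^ I * (norm z * mass z)"
      unfolding amplitude_sq[symmetric] by (simp add: power2_eq_square algebra_simps)
    also have "C * (norm z * amplitude z) \<le> C * ((norm z)^2 * mass z / (2 * \<epsilon>) + \<epsilon> / 2)"
    proof (intro mult_left_mono C0)
      have "0 \<le> (norm z * amplitude z - \<epsilon>)^2 / (2 * \<epsilon>)" using \<epsilon> by simp
      also have "\<dots> = (norm z)^2 * mass z / (2 * \<epsilon>) + \<epsilon> / 2 - norm z * amplitude z"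
        unfolding amplitude_sq[symmetric] using \<epsilon> by (simp add: power2_eq_square field_simps)
      finally show "norm z * amplitude z \<le> (norm z)^2 * mass z / (2 * \<epsilon>) + \<epsilon> / 2" by simp
    qed
    also have "256 * 2 ^ I * (norm z * mass z) \<le> 256 * (8 * s) * (norm z * mass z)"
      using I(2) mass_nonneg[of z] by (intro mult_right_mono mult_left_mono mult_nonneg_nonneg) auto
    also have "C * ((norm z)^2 * mass z / (2 * \<epsilon>) + \<epsilon> / 2) + 256 * (8 * s) * (norm z * mass z) = N z"
      unfolding N_def using True s by (simp add: power2_eq_square field_simps)
    finally show ?thesis by simp
  next
    case False
    have "norm z / norm (z - t i) * mass z \<le> 2 * mass z" if "i < n" for i
    proof -
      have "norm (z - t i) \<ge> norm z / 2" "norm z > 0"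
        using norm_triangle_ineq2[of z "t i"] t(2)[OF that] False s by linarith+
      then have "norm z / norm (z - t i) \<le> 2" by (simp add: divide_le_eq)
      then show ?thesis using mass_nonneg by (intro mult_right_mono)
    qed
    then have "(\<Sum>i<n. norm z / norm (z - t i) * mass z) \<le> (\<Sum>i<n. 2 * mass z)" by (intro sum_mono) auto
    also have "\<dots> = N z" unfolding N_def using False by simp
    finally show ?thesis .
  qed
  have "real n * total_mass = (\<Sum>i<n. total_mass)" by simp
  also have "\<dots> \<le> (\<Sum>i<n. LBINT z. norm z / norm (z - t i) * mass z)"
    by (intro sum_mono zero_potential_lower[OF fac] zero_list_root[OF t(1)]) auto
  also have "\<dots> = (LBINT z. (\<Sum>i<n. norm z / norm (z - t i) * mass z))"
    by (rule Bochner_Integration.integral_sum[symmetric]) (rule weighted_kernel(1))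
  also have "\<dots> \<le> (LBINT z. N z)"
  proof (rule integral_mono[OF _ _ pt])
    show "integrable lborel (\<lambda>z. \<Sum>i<n. norm z / norm (z - t i) * mass z)"
      by (rule Bochner_Integration.integrable_sum) (rule weighted_kernel(1))
    show "integrable lborel N" unfolding N_def
      by (intro Bochner_Integration.integrable_add integrable_mult_right i1 i2 i3)
  qed
  also have "\<dots> = 2 * real n * (LBINT z. indicator {z. norm z \<ge> 2 * s} z * mass z)
    + s^2 * (C / (2 * \<epsilon>)) * (LBINT z. (indicator {z. norm z < 2 * s} z * (norm z / s) ^ 2) * mass z)
    + s^2 * 2048 * (LBINT z. (indicator {z. norm z < 2 * s} z * (norm z / s) ^ 1) * mass z)
    + C * \<epsilon> / 2 * (pi * (2 * s)^2)"
  proof -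
    have "(LBINT z. indicator (ball (0::complex) (2 * s)) z) = pi * (2 * s)^2"
      using s by (simp add: measure_def emeasure_ball_complex)
    then show ?thesis unfolding N_def
      by (simp only: Bochner_Integration.integral_add Bochner_Integration.integrable_add integrable_mult_right i1 i2 i3 integral_mult_right_zero)
  qed
  also have "C * \<epsilon> / 2 * (pi * (2 * s)^2) \<le> C * \<epsilon> / 2 * (4 * (2 * s)^2)"
    using pi_less_4 C0 \<epsilon> by (intro mult_left_mono mult_right_mono) auto
  also have "C * \<epsilon> / 2 * (4 * (2 * s)^2) = s^2 * (8 * C * \<epsilon>)" by (simp add: power2_eq_square)
  finally show ?thesis by (simp add: distrib_left)
qed

text \<open>Every integral on the right side of \<open>zero_count_bound_large\<close> tends to zero as \<open>s\<close> grows, for fixed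
\<open>\<epsilon>\<close>; for bounded \<open>s\<close> the count is absorbed into \<open>N\<close>.\<close>

lemma zero_count_subquadratic:
  assumes fac: "\<And>w. cauchy_transform cmass w = g w * cauchy_transform density w"
    and m0: "total_mass > 0" and \<eta>: "\<eta> > 0"
  shows "\<exists>N\<ge>0. \<forall>n t s. zero_list n t \<longrightarrow> (\<forall>i<n. norm (t i) \<le> s) \<longrightarrow> real n \<le> \<eta> * s^2 + N"
proof -
  define C where "C = B * (exp (8 * pi) + 4)"
  have C0: "C \<ge> 0" using B(1) by (simp add: C_def)
  define q where "q = C + 1"
  have q: "q > 0" "C \<le> q" using C0 by (auto simp: q_def)
  define \<epsilon> where "\<epsilon> = \<eta> * total_mass / (64 * q)"
  have \<epsilon>: "\<epsilon> > 0" using \<eta> m0 q by (simp add: \<epsilon>_def)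
  have C\<epsilon>: "8 * C * \<epsilon> \<le> \<eta> * total_mass / 8"
  proof -
    have "8 * C * \<epsilon> \<le> 8 * q * \<epsilon>" using \<epsilon> q by (intro mult_right_mono) auto
    also have "\<dots> = \<eta> * total_mass / 8" using q by (simp add: \<epsilon>_def)
    finally show ?thesis .
  qed
  define T where "T s = (LBINT z. indicator {z. norm z \<ge> 2 * s} z * mass z)" for s
  define P where "P p s = (LBINT z. (indicator {z. norm z < 2 * s} z * (norm z / s) ^ p) * mass z)" for p :: nat and s
  have lT: "(T \<longlongrightarrow> 0) at_top"
  proof -
    have "filterlim (\<lambda>s::real. 2 * s) at_top at_top" by real_asymp
    from filterlim_compose[OF integral_tail_tendsto_0[OF mass_integrable] this] show ?thesis by (simp add: T_def[abs_def])
  qed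
  have lP: "(P 2 \<longlongrightarrow> 0) at_top" "(P 1 \<longlongrightarrow> 0) at_top"
    unfolding P_def[abs_def] by (rule truncated_moment_tendsto_0, simp)+
  have lim: "((\<lambda>s. C / (2 * \<epsilon>) * P 2 s + 2048 * P 1 s) \<longlongrightarrow> C / (2 * \<epsilon>) * 0 + 2048 * 0) at_top"
    by (intro tendsto_intros lP)
  have "\<forall>\<^sub>F s in at_top. T s < total_mass / 4 \<and> C / (2 * \<epsilon>) * P 2 s + 2048 * P 1 s < \<eta> * total_mass / 8 \<and> s \<ge> 1"
    using m0 \<eta> order_tendstoD(2)[OF lT, of "total_mass / 4"] order_tendstoD(2)[OF lim, of "\<eta> * total_mass / 8"] eventually_ge_at_top[of 1]
    by (intro eventually_conj) auto
  then obtain s0 where s0: "\<And>s. s \<ge> s0 \<Longrightarrow> T s < total_mass / 4 \<and> C / (2 * \<epsilon>) * P 2 s + 2048 * P 1 s < \<eta> * total_mass / 8 \<and> s \<ge> 1"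
    by (auto simp: eventually_at_top_linorder)
  have big: "real n \<le> \<eta> * s^2" if t: "zero_list n t" "\<And>i. i < n \<Longrightarrow> norm (t i) \<le> s" and s: "s \<ge> s0" for n t s
  proof -
    have s1: "s \<ge> 1" using s0[OF s] by blast
    have "real n * total_mass \<le> 2 * real n * T s + s^2 * (C / (2 * \<epsilon>) * P 2 s + 2048 * P 1 s + 8 * C * \<epsilon>)"
      using zero_count_bound_large[OF fac t s1 \<epsilon>] unfolding T_def P_def C_def by simp
    also have "\<dots> \<le> 2 * real n * (total_mass / 4) + s^2 * (\<eta> * total_mass / 8 + \<eta> * total_mass / 8)"
      using s0[OF s] C\<epsilon> by (intro add_mono mult_left_mono) auto
    also have "\<dots> = real n * total_mass / 2 + \<eta> * s^2 * total_mass / 4" by (simp add: field_simps)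
    finally have "real n * total_mass \<le> real n * total_mass / 2 + \<eta> * s^2 * total_mass / 4" .
    moreover have "0 \<le> \<eta> * s^2 * total_mass" using \<eta> m0 by simp
    ultimately have "real n * total_mass \<le> \<eta> * s^2 * total_mass" by linarith
    then show ?thesis using m0 by simp
  qed
  show ?thesis
  proof (intro exI[of _ "\<eta> * s0^2"] conjI allI impI)
    show "0 \<le> \<eta> * s0^2" using \<eta> by simp
    fix n t s assume t: "zero_list n t" "\<forall>i<n. norm (t i) \<le> s"
    show "real n \<le> \<eta> * s^2 + \<eta> * s0^2"
    proof (cases "s \<ge> s0")
      case True
      have "0 \<le> \<eta> * s0^2" using \<eta> by simp
      then show ?thesis using big[OF t(1) _ True] t(2) by force
    next
      case False
      have "norm (t i) \<le> s0" if "i < n" for i using t(2) that False by force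
      then have "real n \<le> \<eta> * s0^2" using big[OF t(1), of s0] by auto
      moreover have "0 \<le> \<eta> * s^2" using \<eta> by simp
      ultimately show ?thesis by linarith
    qed
  qed
qed

end

section \<open>The measure vanishes\<close>

lemma minimum_modulus_disc:
  assumes e: "e holomorphic_on UNIV" and r: "r > 0" and nz: "\<And>z. norm z \<le> r \<Longrightarrow> e z \<noteq> 0"
    and low: "\<And>w. norm w = r \<Longrightarrow> m \<le> norm (e w)" and m: "m > 0" and p: "norm p \<le> r"
  shows "m \<le> norm (e p)"
proof -
  have "norm (inverse (e p)) \<le> inverse m"
  proof (rule maximum_modulus_frontier[of "\<lambda>z. inverse (e z)" "cball 0 r" "inverse m" p])
    show "(\<lambda>z. inverse (e z)) holomorphic_on interior (cball 0 r)"
      using nz by (intro holomorphic_intros holomorphic_on_subset[OF e]) auto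
    show "continuous_on (closure (cball 0 r)) (\<lambda>z. inverse (e z))"
      using nz by (intro continuous_intros holomorphic_on_imp_continuous_on holomorphic_on_subset[OF e]) auto
    fix z :: complex assume "z \<in> frontier (cball 0 r)"
    then have "norm z = r" using r by (simp add: frontier_cball)
    then show "norm (inverse (e z)) \<le> inverse m" using low m by (simp add: norm_inverse le_imp_inverse_le)
  qed (use p in auto)
  then have "inverse (norm (e p)) \<le> inverse m" by (simp add: norm_inverse)
  moreover have "norm (e p) > 0" using nz[OF p] by simp
  ultimately show ?thesis using m by (simp add: inverse_le_iff_le)
qed

lemma gauss_beats_linear_at_top:
  fixes m c d e :: real
  assumes "m > 0" "c > 0"
  shows "filterlim (\<lambda>r. m / r * exp (c * r^2 - d * r - e)) at_top at_top"
  using assms by real_asymp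

context orthogonal_multiple
begin

lemma zero_list_subset:
  assumes t: "zero_list n t" and S: "S \<subseteq> {..<n}"
  obtains t' where "zero_list (card S) t'" "t' ` {..<card S} = t ` S"
proof -
  obtain e where e: "e holomorphic_on UNIV" "\<And>z. g z = (\<Prod>i<n. z - t i) * e z" using t by (auto simp: zero_list_def)
  have fin: "finite S" using S finite_subset by blast
  obtain f where f: "bij_betw f {..<card S} S"
    using ex_bij_betw_nat_finite[OF fin] by (auto simp: atLeast0LessThan)
  define t' where "t' = t \<circ> f"
  have "g z = (\<Prod>i<card S. z - t' i) * ((\<Prod>i\<in>{..<n} - S. z - t i) * e z)" for z
  proof -
    have "(\<Prod>i<n. z - t i) = (\<Prod>i\<in>{..<n} - S. z - t i) * (\<Prod>i\<in>S. z - t i)"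
      by (rule prod.subset_diff) (use S in auto)
    also have "(\<Prod>i\<in>S. z - t i) = (\<Prod>i<card S. z - t' i)"
      unfolding t'_def o_def by (rule prod.reindex_bij_betw[OF f, symmetric])
    finally show ?thesis using e(2)[of z] by simp
  qed
  then have "zero_list (card S) t'" unfolding zero_list_def
    by (intro exI[of _ "\<lambda>z. (\<Prod>i\<in>{..<n} - S. z - t i) * e z"]) (auto intro!: holomorphic_intros e(1))
  moreover have "t' ` {..<card S} = t ` S" unfolding t'_def image_comp[symmetric] bij_betw_imp_surj_on[OF f] ..
  ultimately show ?thesis by (rule that)
qed

text \<open>A bounded number of zeros allows a list of maximal length; a zero of the cofactor would extend it.\<close>

lemma zero_list_maximal:
  assumes bound: "\<And>n t. zero_list n t \<Longrightarrow> (\<And>i. i < n \<Longrightarrow> t i \<in> K) \<Longrightarrow> n \<le> M"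
  obtains n t e where "zero_list n t" "\<And>i. i < n \<Longrightarrow> t i \<in> K" "e holomorphic_on UNIV"
    "\<And>z. g z = (\<Prod>i<n. z - t i) * e z" "\<And>z. z \<in> K \<Longrightarrow> e z \<noteq> 0"
proof -
  define P where "P n \<longleftrightarrow> (\<exists>t. zero_list n t \<and> (\<forall>i<n. t i \<in> K))" for n
  have P0: "P 0" unfolding P_def zero_list_def using g by auto
  have bd: "\<And>n. P n \<Longrightarrow> n \<le> M" using bound unfolding P_def by blast
  define n where "n = Greatest P"
  have Pn: "P n" unfolding n_def using P0 bd by (rule GreatestI_nat)
  have mx: "m \<le> n" if "P m" for m unfolding n_def using that bd by (rule Greatest_le_nat)
  obtain t where t: "zero_list n t" "\<And>i. i < n \<Longrightarrow> t i \<in> K" using Pn by (auto simp: P_def)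
  obtain e where e: "e holomorphic_on UNIV" "\<And>z. g z = (\<Prod>i<n. z - t i) * e z" using t(1) by (auto simp: zero_list_def)
  have "e a \<noteq> 0" if a: "a \<in> K" for a
  proof
    assume ea: "e a = 0"
    define t' where "t' = t(n := a)"
    have "e z = (z - a) * divided_difference e a z" for z using ea by (auto simp: divided_difference_def)
    then have "g z = (\<Prod>i<Suc n. z - t' i) * divided_difference e a z" for z
      using e(2)[of z] by (simp add: t'_def mult.assoc)
    then have "zero_list (Suc n) t'" unfolding zero_list_def using divided_difference_holomorphic[OF e(1)] by blast
    moreover have "\<forall>i<Suc n. t' i \<in> K" using t(2) a by (auto simp: t'_def less_Suc_eq)
    ultimately have "P (Suc n)" unfolding P_def by blast
    then show False using mx[of "Suc n"] by simp
  qed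
  then show ?thesis using that t e by blast
qed

text \<open>On a quiet circle of radius \<open>r\<close> one has \<open>|g| \<ge> \<mu>\<close> with \<open>\<mu>\<close> of order \<open>exp (\<gamma> r^2) / r\<close>. Let \<open>g = P e\<close>
with \<open>P\<close> the product over the zeros in the disc. Then \<open>|e| \<ge> \<mu> / (2 r)^n\<close> on the circle, hence also at
a fixed point \<open>p\<close> with \<open>g p \<noteq> 0\<close>, and \<open>|g p| \<ge> \<mu> (\<Prod>i<n. |p - t i| / (2 r))\<close>. Since the zeros are few,
the logarithm of the product is at least \<open>- \<gamma> / 2 r^2 - O(r)\<close>, and \<open>|g p|\<close> would exceed every bound.\<close>

lemma zero_mass:
  assumes fac: "\<And>w. cauchy_transform cmass w = g w * cauchy_transform density w"
    and decay: "K > 0" "\<gamma> > 0" "\<And>w. norm (cauchy_transform density w) \<le> K * exp (- \<gamma> * (norm w)^2)"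
  shows "total_mass = 0"
proof (rule ccontr)
  assume ne: "total_mass \<noteq> 0"
  have "total_mass \<ge> 0" by (intro integral_nonneg_AE) (simp add: mass_nonneg)
  then have m0: "total_mass > 0" using ne by simp
  have "\<exists>p. g p \<noteq> 0"
  proof (rule ccontr)
    assume "\<not> ?thesis"
    then have "mass z = 0" for z by (simp add: mass_def)
    then show False using ne by simp
  qed
  then obtain p where p: "g p \<noteq> 0" by blast
  have "continuous_on UNIV g" using g by (rule holomorphic_on_imp_continuous_on)
  then have "open {z. g z \<noteq> 0}" by (intro open_Collect_neq continuous_intros)
  then obtain \<tau> where \<tau>: "\<tau> > 0" "ball p \<tau> \<subseteq> {z. g z \<noteq> 0}" using p by (auto simp: open_contains_ball)
  have far: "norm (p - a) \<ge> \<tau>" if "g a = 0" for a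
  proof (rule ccontr)
    assume "\<not> ?thesis"
    then have "a \<in> ball p \<tau>" by (simp add: dist_norm)
    then show False using \<tau>(2) that by blast
  qed
  \<comment> \<open>The dyadic counts below add up to at most \<open>11 \<eta> r^2\<close>, which has to be \<open>\<gamma> / 2 r^2\<close>.\<close>
  define \<eta> where "\<eta> = \<gamma> / 22"
  have \<eta>: "\<eta> > 0" using decay by (simp add: \<eta>_def)
  obtain N where N: "N \<ge> 0" "\<And>n t s. zero_list n t \<Longrightarrow> (\<And>i. i < n \<Longrightarrow> norm (t i) \<le> s) \<Longrightarrow> real n \<le> \<eta> * s^2 + N"
    using zero_count_subquadratic[OF fac m0 \<eta>] by blast
  define D where "D = 2 * \<eta> * (norm p)^2 + N"
  have D0: "D \<ge> 0" using N(1) \<eta> by (simp add: D_def)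
  have key: "\<exists>r\<ge>X. r > 0 \<and> total_mass / (2 * r * K) * exp (\<gamma> / 2 * r^2 - D * (2 * r / \<tau> + 1)) \<le> norm (g p)" for X
  proof -
    obtain r where r: "r \<ge> max X (norm p + 1)" "r > 0" and
      quiet: "\<And>w. norm w = r \<Longrightarrow> (LBINT z. norm z / norm (z - w) * mass z) \<le> total_mass / 2"
      using exists_quiet_circle[OF mass_integrable mass_nonneg mass_bound, of "total_mass / 2"] m0 by (meson half_gt_zero)
    define \<mu> where "\<mu> = total_mass / (2 * r * K) * exp (\<gamma> * r^2)"
    have \<mu>: "\<mu> > 0" using m0 r decay by (simp add: \<mu>_def)
    have gl: "\<mu> \<le> norm (g w)" if w: "norm w = r" for w
    proof -
      have "norm (w * cauchy_transform cmass w + of_real total_mass) \<le> total_mass / 2"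
        using order_trans[OF weighted_kernel(2) quiet[OF w]] .
      then have "total_mass / 2 \<le> norm (w * cauchy_transform cmass w)"
        using norm_triangle_ineq4[of "w * cauchy_transform cmass w + of_real total_mass" "w * cauchy_transform cmass w"] m0 by simp
      also have "\<dots> = r * norm (g w) * norm (cauchy_transform density w)" unfolding fac by (simp add: norm_mult w)
      also have "\<dots> \<le> r * norm (g w) * (K * exp (- \<gamma> * r^2))"
        using decay(3)[of w] r(2) w by (intro mult_left_mono) auto
      finally show ?thesis using r(2) decay(1) by (simp add: \<mu>_def exp_minus field_simps)
    qed
    have "n \<le> nat \<lfloor>\<eta> * r^2 + N\<rfloor>" if "zero_list n t" "\<And>i. i < n \<Longrightarrow> t i \<in> cball 0 r" for n t
    proof -
      have "real n \<le> \<eta> * r^2 + N" using that by (intro N(2)) auto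
      then show ?thesis by (simp add: le_nat_floor)
    qed
    then obtain n t e where t: "zero_list n t" "\<And>i. i < n \<Longrightarrow> t i \<in> cball 0 r" and e: "e holomorphic_on UNIV"
      "\<And>z. g z = (\<Prod>i<n. z - t i) * e z" "\<And>z. z \<in> cball 0 r \<Longrightarrow> e z \<noteq> 0"
      using zero_list_maximal by blast
    have tf: "norm (p - t i) \<ge> \<tau>" if "i < n" for i using far zero_list_root[OF t(1) that] by blast
    have el: "\<mu> / (2 * r) ^ n \<le> norm (e w)" if w: "norm w = r" for w
    proof -
      have "(\<Prod>i<n. norm (w - t i)) \<le> (\<Prod>i<n. 2 * r)"
      proof (rule prod_mono)
        fix i assume "i \<in> {..<n}"
        then show "0 \<le> norm (w - t i) \<and> norm (w - t i) \<le> 2 * r"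
          using norm_triangle_ineq4[of w "t i"] t(2)[of i] w by simp
      qed
      then have "(\<Prod>i<n. norm (w - t i)) * norm (e w) \<le> (2 * r) ^ n * norm (e w)" by (intro mult_right_mono) auto
      moreover have "norm (g w) = (\<Prod>i<n. norm (w - t i)) * norm (e w)" unfolding e(2) by (simp add: norm_mult prod_norm)
      ultimately have "\<mu> \<le> (2 * r) ^ n * norm (e w)" using gl[OF w] by linarith
      then show ?thesis using r(2) by (simp add: pos_divide_le_eq mult.commute)
    qed
    have ep: "\<mu> / (2 * r) ^ n \<le> norm (e p)"
      by (rule minimum_modulus_disc[OF e(1) r(2) _ el]) (use e(3) r \<mu> in auto)
    define x where "x i = 2 * r / norm (p - t i)" for i
    \<comment> \<open>A crude number of dyadic levels: \<open>J\<close> times a constant only has to be \<open>o(r^2)\<close>.\<close>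
    define J where "J = nat \<lceil>2 * r / \<tau>\<rceil>"
    have J: "2 * r / \<tau> \<le> real J" "real J \<le> 2 * r / \<tau> + 1" using r(2) \<tau>(1) by (auto simp: J_def)
    have x: "1 \<le> x i" "x i \<le> 2 ^ J" if i: "i < n" for i
    proof -
      have "norm (p - t i) \<le> 2 * r" using norm_triangle_ineq4[of p "t i"] t(2)[OF i] r(1) by simp
      moreover have "norm (p - t i) > 0" using tf[OF i] \<tau>(1) by linarith
      ultimately show "1 \<le> x i" by (simp only: x_def le_divide_eq_1_pos)
      have "x i \<le> 2 * r / \<tau>" unfolding x_def using tf[OF i] \<tau>(1) r(2) by (intro divide_left_mono mult_pos_pos) auto
      also have "\<dots> \<le> real J" by (rule J(1))
      also have "\<dots> \<le> 2 ^ J" using less_exp[of J] by (metis less_imp_le of_nat_le_iff of_nat_numeral of_nat_power)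
      finally show "x i \<le> 2 ^ J" .
    qed
    have cnt: "real (card {i. i < n \<and> 2 ^ j \<le> x i}) \<le> 8 * \<eta> * r^2 * (1 / 4) ^ j + D" for j
    proof -
      define S where "S = {i. i < n \<and> 2 ^ j \<le> x i}"
      define s where "s = 2 * r / 2 ^ j + norm p"
      obtain t' where t': "zero_list (card S) t'" "t' ` {..<card S} = t ` S"
        using zero_list_subset[OF t(1), of S] by (auto simp: S_def)
      have "norm a \<le> s" if a: "a \<in> t ` S" for a
      proof -
        obtain i where i: "a = t i" "i < n" "2 ^ j \<le> x i" using a by (auto simp: S_def)
        have "norm (p - t i) > 0" using tf[OF i(2)] \<tau>(1) by linarith
        then have "norm (p - t i) \<le> 2 * r / 2 ^ j" using i(3) by (simp add: x_def field_simps)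
        then show ?thesis using norm_triangle_ineq4[of p "p - t i"] by (simp add: s_def i(1))
      qed
      then have "norm (t' i) \<le> s" if "i < card S" for i
        using imageI[of i "{..<card S}" t'] that unfolding t'(2) by blast
      from N(2)[OF t'(1) this] have "real (card S) \<le> \<eta> * s^2 + N" by simp
      also have "s^2 \<le> 2 * (2 * r / 2 ^ j)^2 + 2 * (norm p)^2"
        unfolding s_def using sum_squares_bound[of "2 * r / 2 ^ j" "norm p"] by (simp add: power2_sum)
      finally have "real (card S) \<le> \<eta> * (2 * (2 * r / 2 ^ j)^2 + 2 * (norm p)^2) + N"
        using \<eta> by (simp add: mult_left_mono)
      also have "(2 * r / 2 ^ j)^2 = 4 * r^2 * (1 / 4) ^ j"
      proof -
        have "((2::real) ^ j)^2 = 4 ^ j" by (simp add: power2_eq_square flip: power_mult_distrib)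
        then show ?thesis by (simp add: power_divide power_mult_distrib)
      qed
      finally show ?thesis by (simp add: S_def D_def algebra_simps)
    qed
    have "(\<Sum>i<n. ln (x i)) \<le> (\<Sum>i<n. \<Sum>j<J. (if 2 ^ j \<le> x i then 1 else 0))"
      by (intro sum_mono ln_le_dyadic_count x) auto
    also have "\<dots> = (\<Sum>j<J. \<Sum>i<n. (if 2 ^ j \<le> x i then 1 else 0))" by (rule sum.swap)
    also have "\<dots> = (\<Sum>j<J. real (card {i. i < n \<and> 2 ^ j \<le> x i}))"
    proof (rule sum.cong[OF refl])
      fix j
      have "(\<Sum>i<n. (if 2 ^ j \<le> x i then 1 else (0::real))) = (\<Sum>i\<in>{i. i < n \<and> 2 ^ j \<le> x i}. 1)"
        by (intro sum.mono_neutral_cong_right) auto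
      then show "(\<Sum>i<n. (if 2 ^ j \<le> x i then 1 else (0::real))) = real (card {i. i < n \<and> 2 ^ j \<le> x i})" by simp
    qed
    also have "\<dots> \<le> (\<Sum>j<J. 8 * \<eta> * r^2 * (1 / 4) ^ j + D)" by (intro sum_mono cnt)
    also have "\<dots> = 8 * \<eta> * r^2 * (\<Sum>j<J. (1 / 4) ^ j) + real J * D" by (simp add: sum.distrib sum_distrib_left)
    also have "\<dots> \<le> 8 * \<eta> * r^2 * (11 / 8) + (2 * r / \<tau> + 1) * D"
    proof (intro add_mono mult_left_mono mult_right_mono J(2) D0)
      have "(\<Sum>j<J. (1 / 4 :: real) ^ j) = 4 / 3 - 4 / 3 * (1 / 4) ^ J" by (induction J) auto
      also have "\<dots> \<le> 4 / 3" by simp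
      finally show "(\<Sum>j<J. (1 / 4 :: real) ^ j) \<le> 11 / 8" by simp
    qed (use \<eta> in auto)
    finally have lnx: "(\<Sum>i<n. ln (x i)) \<le> \<gamma> / 2 * r^2 + D * (2 * r / \<tau> + 1)" by (simp add: \<eta>_def mult.commute)
    have prodx: "(\<Prod>i<n. norm (p - t i)) = (2 * r) ^ n * exp (- (\<Sum>i<n. ln (x i)))"
    proof -
      have "norm (p - t i) = 2 * r * exp (- ln (x i))" if "i < n" for i
      proof -
        have "x i > 0" using x[OF that] by linarith
        then have "exp (- ln (x i)) = 1 / x i" by (simp add: exp_minus field_simps)
        then show ?thesis using r(2) by (simp add: x_def)
      qed
      then have "(\<Prod>i<n. norm (p - t i)) = (\<Prod>i<n. 2 * r * exp (- ln (x i)))" by (intro prod.cong) auto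
      also have "\<dots> = (2 * r) ^ n * exp (\<Sum>i<n. - ln (x i))" by (simp add: prod.distrib exp_sum)
      finally show ?thesis by (simp add: sum_negf)
    qed
    have "\<mu> * exp (- (\<gamma> / 2 * r^2 + D * (2 * r / \<tau> + 1))) \<le> \<mu> * exp (- (\<Sum>i<n. ln (x i)))"
      using lnx \<mu> by (intro mult_left_mono) auto
    also have "\<dots> = (\<Prod>i<n. norm (p - t i)) * (\<mu> / (2 * r) ^ n)" unfolding prodx using r(2) by simp
    also have "\<dots> \<le> (\<Prod>i<n. norm (p - t i)) * norm (e p)" by (intro mult_left_mono ep prod_nonneg) auto
    also have "\<dots> = norm (g p)" unfolding e(2) by (simp add: norm_mult prod_norm)
    finally have "\<mu> * exp (- (\<gamma> / 2 * r^2 + D * (2 * r / \<tau> + 1))) \<le> norm (g p)" .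
    moreover have "\<mu> * exp (- (\<gamma> / 2 * r^2 + D * (2 * r / \<tau> + 1))) = total_mass / (2 * r * K) * exp (\<gamma> * r^2 + - (\<gamma> / 2 * r^2 + D * (2 * r / \<tau> + 1)))"
      unfolding \<mu>_def by (simp only: exp_add mult.assoc)
    moreover have "\<gamma> * r^2 + - (\<gamma> / 2 * r^2 + D * (2 * r / \<tau> + 1)) = \<gamma> / 2 * r^2 - D * (2 * r / \<tau> + 1)" by simp
    ultimately show ?thesis using r by (intro exI[of _ r]) auto
  qed
  have "filterlim (\<lambda>r. total_mass / (2 * r * K) * exp (\<gamma> / 2 * r^2 - D * (2 * r / \<tau> + 1))) at_top at_top"
  proof -
    have eq: "total_mass / (2 * r * K) * exp (\<gamma> / 2 * r^2 - D * (2 * r / \<tau> + 1))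
        = total_mass / (2 * K) / r * exp (\<gamma> / 2 * r^2 - (D * 2 / \<tau>) * r - D)" for r
      by (simp add: algebra_simps)
    show ?thesis unfolding eq by (rule gauss_beats_linear_at_top) (use m0 decay(1,2) in auto)
  qed
  then have "\<forall>\<^sub>F r in at_top. norm (g p) < total_mass / (2 * r * K) * exp (\<gamma> / 2 * r^2 - D * (2 * r / \<tau> + 1))"
    by (rule filterlim_at_top_dense[THEN iffD1, rule_format])
  then obtain X where "\<And>r. r \<ge> X \<Longrightarrow> norm (g p) < total_mass / (2 * r * K) * exp (\<gamma> / 2 * r^2 - D * (2 * r / \<tau> + 1))"
    by (auto simp: eventually_at_top_linorder)
  then show False using key[of X] by (meson not_less)
qed

end

section \<open>The closed span of the exponential multiples\<close>

lemma integrable_gauss_bounded: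
  fixes f :: "complex \<Rightarrow> complex"
  assumes f: "f \<in> entire" and bd: "\<And>z. norm (f z) \<le> C * exp (a * norm z + c * (norm z)^2)"
    and c: "c < \<gamma> * pi / 2"
  shows "f \<in> fock_space \<gamma>"
proof -
  have [measurable]: "f \<in> borel_measurable borel" using f by (intro borel_measurable_continuous_onI entire_continuous)
  define d where "d = \<gamma> * pi - 2 * c"
  have d: "d > 0" using c by (simp add: d_def)
  have "integrable lborel (\<lambda>z. (norm (f z))^2 * exp (- \<gamma> * pi * (norm z)^2))"
  proof (rule Bochner_Integration.integrable_bound)
    show "integrable lborel (\<lambda>z::complex. C^2 * exp ((2 * a) * norm z - d * (norm z)^2))"
      by (intro integrable_mult_right integrable_gauss_linear d)
    show "AE z in lborel. norm ((norm (f z))^2 * exp (- \<gamma> * pi * (norm z)^2)) \<le> norm (C^2 * exp ((2 * a) * norm z - d * (norm z)^2))"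
    proof (rule AE_I2)
      fix z
      have "(norm (f z))^2 * exp (- \<gamma> * pi * (norm z)^2) \<le> (C * exp (a * norm z + c * (norm z)^2))^2 * exp (- \<gamma> * pi * (norm z)^2)"
        using bd[of z] by (intro mult_right_mono power_mono) auto
      also have "\<dots> = C^2 * exp (2 * (a * norm z + c * (norm z)^2) + - \<gamma> * pi * (norm z)^2)"
        by (simp only: power_mult_distrib exp_double[symmetric] mult.assoc exp_add[symmetric])
      also have "2 * (a * norm z + c * (norm z)^2) + - \<gamma> * pi * (norm z)^2 = (2 * a) * norm z - d * (norm z)^2"
        by (simp add: d_def algebra_simps)
      finally show "norm ((norm (f z))^2 * exp (- \<gamma> * pi * (norm z)^2)) \<le> norm (C^2 * exp ((2 * a) * norm z - d * (norm z)^2))"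
        by simp
    qed
  qed measurable
  then show ?thesis using f by (simp add: fock_space_def)
qed

lemma exp_multiples_in_fock:
  assumes F: "F \<in> entire" and bd: "\<And>z. norm (F z) \<le> C * exp (c * (norm z)^2)" and c: "c < pi / 2"
  shows "exp_fun w * F \<in> entire_multiples F \<inter> fock_space 1"
proof
  have e: "exp_fun w \<in> entire" unfolding exp_fun_def entire_def by (auto intro!: holomorphic_intros)
  then show "exp_fun w * F \<in> entire_multiples F" by (auto simp: entire_multiples_def)
  show "exp_fun w * F \<in> fock_space 1"
  proof (rule integrable_gauss_bounded)
    show "exp_fun w * F \<in> entire" using e F by (auto simp: entire_def times_fun_def intro!: holomorphic_intros)
    fix z
    have "norm ((exp_fun w * F) z) \<le> exp (norm w * norm z) * (C * exp (c * (norm z)^2))"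
      unfolding times_fun_apply norm_mult exp_fun_def using norm_exp[of "w * z"] bd[of z]
      by (intro mult_mono) (auto simp: norm_mult)
    also have "\<dots> = C * exp (norm w * norm z + c * (norm z)^2)" by (simp only: exp_add mult_ac)
    finally show "norm ((exp_fun w * F) z) \<le> C * exp (norm w * norm z + c * (norm z)^2)" .
  qed (use c in simp)
qed

lemma entire_multiples_fock_closed:
  assumes F: "F holomorphic_on UNIV" "\<exists>z. F z \<noteq> 0"
    and f: "f \<in> fock_space 1" and appr: "\<And>e. e > 0 \<Longrightarrow> \<exists>s\<in>entire_multiples F \<inter> fock_space 1. fock_norm (f - s) < e"
  shows "f \<in> entire_multiples F \<inter> fock_space 1"
proof -
  have "\<exists>h. h holomorphic_on UNIV \<and> h * F \<in> fock_space 1 \<and> fock_norm (f - h * F) < 1 / real (Suc n)" for n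
    using appr[of "1 / real (Suc n)"] by (force simp: entire_multiples_def entire_def)
  then obtain h where h: "\<And>n. h n holomorphic_on UNIV" "\<And>n. h n * F \<in> fock_space 1"
    "\<And>n. fock_norm (f - h n * F) < 1 / real (Suc n)" by metis
  have Cauchy: "\<exists>N. \<forall>m\<ge>N. \<forall>n\<ge>N. fock_norm (h m * F - h n * F) < e" if e: "e > 0" for e
  proof -
    obtain N where N: "1 / real (Suc N) < e / 2" using reals_Archimedean[of "e / 2"] e by (auto simp: inverse_eq_divide)
    have b: "fock_norm (f - h n * F) < e / 2" if "n \<ge> N" for n
    proof -
      have "1 / real (Suc n) \<le> 1 / real (Suc N)" using that by (intro divide_left_mono) auto
      then show ?thesis using h(3)[of n] N by linarith
    qed
    have "fock_norm (h m * F - h n * F) < e" if "m \<ge> N" "n \<ge> N" for m n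
    proof -
      have "fock_norm ((f - h n * F) - (f - h m * F)) \<le> fock_norm (f - h n * F) + fock_norm (f - h m * F)"
        by (intro fock_norm_triangle fock_space_diff f h(2))
      then show ?thesis using b[OF that(1)] b[OF that(2)] by simp
    qed
    then show ?thesis by blast
  qed
  obtain g where g: "g holomorphic_on UNIV" "g * F \<in> fock_space 1" "(\<lambda>n. fock_norm (h n * F - g * F)) \<longlonglongrightarrow> 0"
    using fock_multiples_complete[OF F h(1,2) Cauchy] by blast
  have "fock_norm (f - g * F) \<le> 0"
  proof (rule LIMSEQ_le_const)
    have "(\<lambda>n. 1 / real (Suc n) + fock_norm (h n * F - g * F)) \<longlonglongrightarrow> 0 + 0"
      by (intro tendsto_add LIMSEQ_Suc[OF lim_1_over_n] g(3))
    then show "(\<lambda>n. 1 / real (Suc n) + fock_norm (h n * F - g * F)) \<longlonglongrightarrow> 0" by simp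
    have "fock_norm (f - g * F) \<le> 1 / real (Suc n) + fock_norm (h n * F - g * F)" for n
    proof -
      have "fock_norm ((f - h n * F) - (g * F - h n * F)) \<le> fock_norm (f - h n * F) + fock_norm (g * F - h n * F)"
        by (intro fock_norm_triangle fock_space_diff f h(2) g(2))
      then show ?thesis using h(3)[of n] fock_norm_minus_commute[of "g * F" "h n * F"] by simp
    qed
    then show "\<exists>N. \<forall>n\<ge>N. fock_norm (f - g * F) \<le> 1 / real (Suc n) + fock_norm (h n * F - g * F)" by blast
  qed
  then have "fock_norm (f - g * F) = 0" using fock_norm_nonneg[of "f - g * F"] by linarith
  from fock_norm_eq_0[OF fock_space_diff[OF f g(2)] this] have "f = g * F" by simp
  then show ?thesis using g f by (auto simp: entire_multiples_def entire_def)
qed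

lemma fock_closure_iff:
  assumes "S \<subseteq> fock_space 1"
  shows "f \<in> fock.mtopology closure_of S \<longleftrightarrow> f \<in> fock_space 1 \<and> (\<forall>e>0. \<exists>s\<in>S. fock_norm (f - s) < e)"
  using assms unfolding fock.metric_closure_of fock.mball_def by blast

theorem theorem1p3:
  fixes F G :: "complex \<Rightarrow> complex" and \<alpha> :: real
  assumes "F \<in> entire"
    and "G \<in> order2_finite_type"
    and "completely_regular_growth G"
    and "\<alpha> < 1"
    and "entire_multiples (F * G) \<inter> fock_space \<alpha> = const_multiples (F * G)"
    and "(INF \<theta>\<in>{0..2*pi}. growth_indicator G \<theta>) > 0"
  shows "(\<forall>\<gamma>\<ge>\<alpha>. F \<in> fock_space \<gamma>) \<and>
    fock.mtopology closure_of (cfun.span {exp_fun w * F | w. True})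
      = entire_multiples F \<inter> fock_space 1"
proof (cases "\<exists>z. F z \<noteq> 0")
  case False
  then have F0: "F = 0" by (auto simp: fun_eq_iff)
  have "{exp_fun w * F | w. True} = {0}" by (auto simp: F0)
  then have "cfun.span {exp_fun w * F | w. True} = {0}" by simp
  moreover have "entire_multiples F = {0}"
    using assms(1) by (auto simp: F0 entire_multiples_def)
  moreover have "f \<in> fock.mtopology closure_of {0} \<longleftrightarrow> f = 0" for f
  proof -
    have "f = 0" if f: "f \<in> fock_space 1" "\<forall>e>0. fock_norm f < e"
    proof (rule fock_norm_eq_0[OF f(1)])
      show "fock_norm f = 0" using f(2) fock_norm_nonneg[of f] by (metis less_irrefl order_less_le)
    qed
    moreover have "fock_norm 0 = 0" by (simp add: fock_norm_def)
    ultimately show ?thesis using fock_space_0 fock_closure_iff[of "{0}" f] by auto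
  qed
  ultimately show ?thesis using fock_space_0 by (auto simp: F0)
next
  case nz: True
  have Fh: "F holomorphic_on UNIV" using assms(1) by (simp add: entire_def)
  have Ge: "G \<in> entire" using assms(2) by (auto simp: order2_finite_type_def order2_type_le_def)
  obtain E H \<delta> \<Lambda> where rg: "regular_growth G E H \<delta> \<Lambda>" using regular_growthI[OF Ge assms(3,6)] by blast
  interpret regular_growth G E H \<delta> \<Lambda> by (rule rg)
  have "F * G = (\<lambda>z. 1 * (F * G) z)" by (simp add: fun_eq_iff)
  then have "F * G \<in> const_multiples (F * G)" unfolding const_multiples_def by blast
  then have FG: "F * G \<in> fock_space \<alpha>" using assms(5) by blast
  define a where "a = \<alpha> * pi / 2"
  have a: "a < pi / 2" using assms(4) by (simp add: a_def)
  obtain C where C: "C \<ge> 0" "\<And>z. norm (F z * G z) \<le> C * exp (a * (norm z)^2)"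
    using fock_pointwise[OF FG] unfolding a_def times_fun_apply by blast
  obtain C1 where C1: "C1 \<ge> 0" "\<And>z. norm (F z) \<le> C1 * exp ((a - \<delta> / 4) * (norm z)^2)" and "a > 0"
    using factor_growth[OF Fh C(2,1) nz] by blast
  have part1: "F \<in> fock_space \<gamma>" if "\<gamma> \<ge> \<alpha>" for \<gamma>
  proof (rule integrable_gauss_bounded[OF assms(1), of C1 0])
    show "norm (F z) \<le> C1 * exp (0 * norm z + (a - \<delta> / 4) * (norm z)^2)" for z using C1(2)[of z] by simp
    have "\<alpha> * pi / 2 \<le> \<gamma> * pi / 2" using that by (intro divide_right_mono mult_right_mono) auto
    then show "a - \<delta> / 4 < \<gamma> * pi / 2" using \<delta>_pos unfolding a_def by linarith
  qed
  define S where "S = cfun.span {exp_fun w * F | w. True}"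
  have "a - \<delta> / 4 < pi / 2" using a \<delta>_pos by simp
  from exp_multiples_in_fock[OF assms(1) C1(2) this]
  have "{exp_fun w * F | w. True} \<subseteq> entire_multiples F \<inter> fock_space 1" by blast
  then have S: "S \<subseteq> entire_multiples F \<inter> fock_space 1"
    unfolding S_def by (rule cfun.span_minimal[OF _ entire_multiples_fock_subspace])
  have subS: "cfun.subspace S" unfolding S_def by (rule cfun.subspace_span)
  have Sf: "S \<subseteq> fock_space 1" using S by blast
  have "fock.mtopology closure_of S \<subseteq> entire_multiples F \<inter> fock_space 1"
  proof
    fix f assume "f \<in> fock.mtopology closure_of S"
    then have "f \<in> fock_space 1" "\<And>e. e > 0 \<Longrightarrow> \<exists>s\<in>S. fock_norm (f - s) < e"
      using fock_closure_iff[OF Sf] by auto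
    then show "f \<in> entire_multiples F \<inter> fock_space 1"
      using S by (intro entire_multiples_fock_closed[OF Fh nz]) blast+
  qed
  moreover have "entire_multiples F \<inter> fock_space 1 \<subseteq> fock.mtopology closure_of S"
  proof
    fix f assume f: "f \<in> entire_multiples F \<inter> fock_space 1"
    obtain g where g: "g holomorphic_on UNIV" "g * F \<in> fock_space 1"
      and orth: "\<And>s. s \<in> S \<Longrightarrow> fock_inner (g * F) s = 0"
      and appr: "\<And>e. e > 0 \<Longrightarrow> \<exists>s\<in>S. fock_norm (f - g * F - s) < e"
      using fock_projection[OF Fh nz subS S f] by blast
    have orth': "fock_inner (exp_fun w * F) (g * F) = 0" for w
    proof -
      have "exp_fun w * F \<in> S" unfolding S_def by (rule cfun.span_base) blast
      from orth[OF this] have "cnj (fock_inner (g * F) (exp_fun w * F)) = 0" by simp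
      moreover have "cnj (fock_inner (g * F) (exp_fun w * F)) = fock_inner (exp_fun w * F) (g * F)"
        unfolding fock_inner_def by (subst Bochner_Integration.integral_cnj[symmetric]) (simp add: mult_ac)
      ultimately show ?thesis by simp
    qed
    interpret orthogonal_multiple F g by unfold_locales (use Fh nz g orth' in auto)
    obtain K \<gamma> where K: "K > 0" "\<gamma> > 0" "\<And>w. norm (cauchy_transform density w) \<le> K * exp (- \<gamma> * (norm w)^2)"
      "\<And>w. cauchy_transform cmass w = g w * cauchy_transform density w"
      using mass_transform_factorizes[OF rg assms(4) FG] assms(5) by blast
    have "total_mass = 0" by (rule zero_mass[OF K(4,1,2,3)])
    then have "pi * (fock_norm (g * F))^2 = 0" unfolding fock_norm_sq by (simp add: mass_def)
    then have "fock_norm (g * F) = 0" by simp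
    from fock_norm_eq_0[OF gF this] have "f - g * F = f" by simp
    then show "f \<in> fock.mtopology closure_of S"
      using appr f unfolding fock_closure_iff[OF Sf] by auto
  qed
  ultimately show ?thesis using part1 unfolding S_def by blast
qed

end
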